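(* Fix $\delta,\lambda,L_0,A_0\in\mathbb{R}$ with $\lambda>0$, $L_0>0$ and $A_0\in[-L_0^2/(4\pi),L_0^2/(4\pi)]$. Then the variational problem of minimizing $E$ over $$\mathcal{A}=\{(\gamma,\eta)\in H^2_{imm}([0,2\pi];\mathbb{R}^2)\times H^1_{per}([0,2\pi];\mathbb{R}^2)\colon L(\gamma)=L_0,\ A(\gamma)=A_0,\ S(\eta)=0\}$$ has a solution.
   Context: Let $\langle\cdot,\cdot\rangle$ be the Euclidean inner product on $\mathbb{R}^2$ and $J$ the counterclockwise rotation by $\pi/2$. For $k\in\mathbb{N}=\{1,2,\dots\}$, $H^k_{per}([0,2\pi];\mathbb{R}^m)$ is the set of $f\in H^k([0,2\pi];\mathbb{R}^m)$ with $\partial_x^\ell f(0)=\partial_x^\ell f(2\pi)$ for $\ell=0,\dots,k-1$. $H^2_{imm}([0,2\pi];\mathbb{R}^2)$ is the set of $\gamma\in H^2_{per}([0,2\pi];\mathbb{R}^2)$ with $\partial_x\gamma(x)\neq0$ for all $x$. For $\gamma\in H^2_{imm}$: $\partial_s=|\partial_x\gamma|^{-1}\partial_x$, $\tau=\partial_s\gamma$, $\nu=J\tau$, the curvature $\kappa$ is defined by $\partial_s\tau=\kappa\nu$, $\int_\gamma f\,\mathrm{d}s=\int_0^{2\pi}f|\partial_x\gamma|\,\mathrm{d}x$, $L(\gamma)=\int_\gamma1\,\mathrm{d}s$, and $A(\gamma)=-\frac12\int_0^{2\pi}\langle\gamma,J\partial_x\gamma\rangle\,\mathrm{d}x$ is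 the signed enclosed area. For $\eta\in H^1_{per}([0,2\pi];\mathbb{R}^2)$: $\operatorname{div}_\gamma\eta=\langle\partial_s\eta,\tau\rangle$, $\nabla_\gamma\eta=\partial_s\eta\otimes\tau$ (so $|\nabla_\gamma\eta|=|\partial_s\eta|$), and $S(\eta)=|\eta|^2-1$ (a function on $[0,2\pi]$). The energy (without length penalization) is $$E(\gamma,\eta)=\frac12\int_\gamma(\kappa+\delta\operatorname{div}_\gamma\eta)^2\,\mathrm{d}s+\frac\lambda2\int_\gamma|\nabla_\gamma\eta|^2\,\mathrm{d}s.$$ *)

theory Defs
  imports "HOL-Analysis.Analysis"
begin

abbreviation mu :: "real measure" where
  "mu \<equiv> lebesgue_on {0..2*pi}"

definition L2 :: "(real \<Rightarrow> 'a::euclidean_space) \<Rightarrow> bool" where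
  "L2 f \<longleftrightarrow> f \<in> borel_measurable mu \<and> integrable mu (\<lambda>x. (norm (f x))\<^sup>2)"

(* Pairs of a function in C^1_c((0, 2 pi)) and its derivative. *)
definition test_fun :: "(real \<Rightarrow> real) \<Rightarrow> (real \<Rightarrow> real) \<Rightarrow> bool" where
  "test_fun \<phi> \<phi>' \<longleftrightarrow>
     (\<forall>x. (\<phi> has_real_derivative \<phi>' x) (at x)) \<and> continuous_on UNIV \<phi>' \<and>
     (\<exists>K. compact K \<and> K \<subseteq> {0<..<2*pi} \<and> (\<forall>x. x \<notin> K \<longrightarrow> \<phi> x = 0))"

(* g is the weak derivative of f on (0, 2 pi), both in L^2.  Testing with C^1_c functions
   (as Brezis does in one dimension) or with smooth ones gives the same notion. *)
definition weak_deriv :: "(real \<Rightarrow> 'a::euclidean_space) \<Rightarrow> (real \<Rightarrow> 'a) \<Rightarrow> bool" where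
  "weak_deriv f g \<longleftrightarrow> L2 f \<and> L2 g \<and>
     (\<forall>\<phi> \<phi>'. test_fun \<phi> \<phi>' \<longrightarrow>
        (LINT x|mu. \<phi>' x *\<^sub>R f x) = - (LINT x|mu. \<phi> x *\<^sub>R g x))"

primrec sobolev :: "nat \<Rightarrow> (real \<Rightarrow> 'a::euclidean_space) \<Rightarrow> bool" where
  "sobolev 0 f \<longleftrightarrow> L2 f"
| "sobolev (Suc k) f \<longleftrightarrow> (\<exists>g. weak_deriv f g \<and> sobolev k g)"

(* A weak derivative of f, unique up to null sets; the continuous representative is chosen
   whenever there is one, which makes its values at single points of [0, 2 pi] meaningful. *)
definition dx :: "(real \<Rightarrow> 'a::euclidean_space) \<Rightarrow> real \<Rightarrow> 'a" where
  "dx f = (SOME g. weak_deriv f g \<and>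
     ((\<exists>h. weak_deriv f h \<and> continuous_on {0..2*pi} h) \<longrightarrow> continuous_on {0..2*pi} g))"

(* For k >= 1, elements of H^k are identified with their continuous representatives.
   Values outside [0, 2 pi] are irrelevant.  For l < k the derivative of order l lies in H^1,
   so dx yields its continuous representative. *)
definition H_per :: "nat \<Rightarrow> (real \<Rightarrow> 'a::euclidean_space) set" where
  "H_per k = {f. sobolev k f \<and> continuous_on {0..2*pi} f \<and>
     (\<forall>l<k. (dx ^^ l) f 0 = (dx ^^ l) f (2*pi))}"

definition H2_imm :: "(real \<Rightarrow> real^2) set" where
  "H2_imm = {\<gamma> \<in> H_per 2. \<forall>x\<in>{0..2*pi}. dx \<gamma> x \<noteq> 0}"

definition J :: "real^2 \<Rightarrow> real^2" where
  "J v = vector [- (v $ 2), v $ 1]"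

definition ds :: "(real \<Rightarrow> real^2) \<Rightarrow> (real \<Rightarrow> real^2) \<Rightarrow> real \<Rightarrow> real^2" where
  "ds \<gamma> f x = inverse (norm (dx \<gamma> x)) *\<^sub>R dx f x"

definition tangent :: "(real \<Rightarrow> real^2) \<Rightarrow> real \<Rightarrow> real^2" where
  "tangent \<gamma> = ds \<gamma> \<gamma>"

definition normal :: "(real \<Rightarrow> real^2) \<Rightarrow> real \<Rightarrow> real^2" where
  "normal \<gamma> x = J (tangent \<gamma> x)"

(* The tangent is only in H^1, so the defining equation of the curvature holds, and determines
   it, almost everywhere. *)
definition curvature :: "(real \<Rightarrow> real^2) \<Rightarrow> real \<Rightarrow> real" where
  "curvature \<gamma> = (SOME \<kappa>. AE x in mu. ds \<gamma> (tangent \<gamma>) x = \<kappa> x *\<^sub>R normal \<gamma> x)"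

definition curve_integral :: "(real \<Rightarrow> real^2) \<Rightarrow> (real \<Rightarrow> real) \<Rightarrow> real" where
  "curve_integral \<gamma> f = (LINT x|mu. f x * norm (dx \<gamma> x))"

definition curve_length :: "(real \<Rightarrow> real^2) \<Rightarrow> real" where
  "curve_length \<gamma> = curve_integral \<gamma> (\<lambda>x. 1)"

definition signed_area :: "(real \<Rightarrow> real^2) \<Rightarrow> real" where
  "signed_area \<gamma> = - (1/2) * (LINT x|mu. \<gamma> x \<bullet> J (dx \<gamma> x))"

definition curve_div :: "(real \<Rightarrow> real^2) \<Rightarrow> (real \<Rightarrow> real^2) \<Rightarrow> real \<Rightarrow> real" where
  "curve_div \<gamma> \<eta> x = ds \<gamma> \<eta> x \<bullet> tangent \<gamma> x"

(* Tensor product as a matrix; the norm on real^2^2 is the Frobenius norm. *)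
definition curve_grad :: "(real \<Rightarrow> real^2) \<Rightarrow> (real \<Rightarrow> real^2) \<Rightarrow> real \<Rightarrow> real^2^2" where
  "curve_grad \<gamma> \<eta> x = (\<chi> i j. ds \<gamma> \<eta> x $ i * tangent \<gamma> x $ j)"

definition S :: "(real \<Rightarrow> real^2) \<Rightarrow> real \<Rightarrow> real" where
  "S \<eta> x = (norm (\<eta> x))\<^sup>2 - 1"

definition energy :: "real \<Rightarrow> real \<Rightarrow> (real \<Rightarrow> real^2) \<Rightarrow> (real \<Rightarrow> real^2) \<Rightarrow> real" where
  "energy \<delta> lam \<gamma> \<eta> =
     1/2 * curve_integral \<gamma> (\<lambda>x. (curvature \<gamma> x + \<delta> * curve_div \<gamma> \<eta> x)\<^sup>2) +
     lam/2 * curve_integral \<gamma> (\<lambda>x. (norm (curve_grad \<gamma> \<eta> x))\<^sup>2)"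

definition admissible :: "real \<Rightarrow> real \<Rightarrow> ((real \<Rightarrow> real^2) \<times> (real \<Rightarrow> real^2)) set" where
  "admissible L0 A0 = {(\<gamma>, \<eta>). \<gamma> \<in> H2_imm \<and> \<eta> \<in> H_per 1 \<and>
     curve_length \<gamma> = L0 \<and> signed_area \<gamma> = A0 \<and> (\<forall>x\<in>{0..2*pi}. S \<eta> x = 0)}"

end

theory Submission
  imports Defs "HOL-Complex_Analysis.Great_Picard"
begin

text \<open>
  The direct method. Reparametrizing by constant speed \<open>c = L\<^sub>0 / (2\<pi>)\<close> preserves the energy, so one
  minimizes over pairs \<open>u = (\<gamma>', \<eta>)\<close> with \<open>|\<gamma>'| = c\<close> and \<open>|\<eta>| = 1\<close>, where the energy has the form
  \<open>\<integral> |T\<^bsub>u\<^esub> u'|\<^sup>2\<close> with \<open>T\<^bsub>u\<^esub>\<close> linear and continuous in \<open>u\<close>. Since \<open>\<gamma>''\<close> is orthogonal to \<open>\<gamma>'\<close>, a bound on the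
  energy bounds \<open>u'\<close> in \<open>L\<^sup>2\<close>. A minimizing sequence \<open>u\<^sub>n\<close> subconverges uniformly by Arzela-Ascoli,
  which preserves all the constraints, and midpoint combinations of the tails of \<open>u\<^sub>n'\<close> with almost
  minimal norm converge strongly in \<open>L\<^sup>2\<close>; as the energy is convex in \<open>u'\<close>, it does not increase in the
  limit. Absolute continuity is expressed by \<open>f x = f 0 + \<integral>\<^bsub>[0,x]\<^esub> g\<close> with \<open>g\<close> in \<open>L\<^sup>2\<close>. Ellipses and a figure eight show
  that the admissible set is not empty.
\<close>

subsection \<open>Square integrable functions\<close>

text \<open>Translations and reparametrizations move a curve without changing length, area or
  energy, so minimizing sequences of immersions need not be compact. Fixing the starting point and
  the speed removes this freedom up to a shift of the parameter, and \<open>|\<gamma>'| = c\<close>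
  survives uniform convergence, so a limit cannot cease to be immersed. A constant \<open>c\<close>
  also makes the curvature equal to \<open>\<gamma>'' \<bullet> J \<gamma>' / c^3\<close>, which is
  what renders the energy density the square of a map linear in \<open>u'\<close>. Working with
  \<open>\<gamma>'\<close> instead of \<open>\<gamma>\<close> puts both components of
  \<open>u\<close> at the same order of differentiability.

  Only the sum of curvature and \<delta> times divergence is penalized, with \<delta> of any size
  and sign. Coercivity therefore starts from the gradient term: it bounds \<open>\<eta>'\<close>,
  hence the divergence, and the rest of the sum bounds the curvature.

  Circles of both orientations attain the ends of the allowed range of the area. The ellipse of area
  0 collapses to a segment and is not immersed, which is why a figure eight enters.\<close>

lemma integrable_mu_iff: "integrable mu f \<longleftrightarrow> f absolutely_integrable_on {0..2*pi}"
  by (simp add: integrable_restrict_space set_integrable_def)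

text \<open>Bridge between the Lebesgue integrals of the definitions and the gauge integrals in
  which primitives and substitutions are computed.\<close>

lemma LINT_mu: "integrable mu f \<Longrightarrow> integral\<^sup>L mu f = integral {0..2*pi} f"
  for f :: "real \<Rightarrow> 'a::euclidean_space"
  by (rule lebesgue_integral_eq_integral) auto

lemma AE_mu_space: "AE x in mu. x \<in> {0..2*pi}"
  by (metis AE_I2 space_lebesgue_on)

lemma AE_mu_I: "(\<And>x. x \<in> {0..2*pi} \<Longrightarrow> P x) \<Longrightarrow> AE x in mu. P x"
  using AE_mu_space by eventually_elim auto

lemma continuous_borel_mu:
  fixes f :: "real \<Rightarrow> 'a::euclidean_space"
  shows "continuous_on {0..2*pi} f \<Longrightarrow> f \<in> borel_measurable mu"
  by (rule continuous_imp_measurable_on_sets_lebesgue) auto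

lemma continuous_integrable_mu:
  fixes f :: "real \<Rightarrow> 'a::euclidean_space"
  shows "continuous_on {0..2*pi} f \<Longrightarrow> integrable mu f"
  unfolding integrable_mu_iff by (rule absolutely_integrable_continuous_real)

lemma continuous_bounded_pos:
  fixes f :: "real \<Rightarrow> 'a::real_normed_vector"
  assumes "continuous_on {0..2*pi} f"
  obtains C where "C > 0" "\<And>x. x \<in> {0..2*pi} \<Longrightarrow> norm (f x) \<le> C"
proof -
  have "bounded (f ` {0..2*pi})"
    by (intro compact_imp_bounded compact_continuous_image assms) auto
  then show ?thesis using that by (auto simp: bounded_pos)
qed

lemma L2_integrable_square: "L2 f \<Longrightarrow> integrable mu (\<lambda>x. (norm (f x))\<^sup>2)"
  by (simp add: L2_def)

lemma L2_bound:
  fixes f :: "real \<Rightarrow> 'a::euclidean_space" and g :: "real \<Rightarrow> 'b::euclidean_space"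
  assumes f: "f \<in> borel_measurable mu" and g: "L2 g"
    and le: "AE x in mu. norm (f x) \<le> C * norm (g x)"
  shows "L2 f"
  unfolding L2_def
proof (intro conjI f)
  have [measurable]: "f \<in> borel_measurable mu" by fact
  show "integrable mu (\<lambda>x. (norm (f x))\<^sup>2)"
  proof (rule Bochner_Integration.integrable_bound)
    show "integrable mu (\<lambda>x. C\<^sup>2 * (norm (g x))\<^sup>2)"
      using g by (simp add: L2_def)
    show "AE x in mu. norm ((norm (f x))\<^sup>2) \<le> norm (C\<^sup>2 * (norm (g x))\<^sup>2)"
      using le by eventually_elim (metis norm_ge_zero power_mono power_mult_distrib
          abs_power2 real_norm_def abs_mult)
  qed measurable
qed

lemma L2_add:
  fixes f g :: "real \<Rightarrow> 'a::euclidean_space"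
  assumes f: "L2 f" and g: "L2 g"
  shows "L2 (\<lambda>x. f x + g x)"
  unfolding L2_def
proof
  have [measurable]: "f \<in> borel_measurable mu" "g \<in> borel_measurable mu"
    using f g by (auto simp: L2_def)
  show "(\<lambda>x. f x + g x) \<in> borel_measurable mu" by measurable
  show "integrable mu (\<lambda>x. (norm (f x + g x))\<^sup>2)"
  proof (rule Bochner_Integration.integrable_bound)
    show "integrable mu (\<lambda>x. 2 * (norm (f x))\<^sup>2 + 2 * (norm (g x))\<^sup>2)"
      using f g by (auto simp: L2_def)
    have "(norm (f x + g x))\<^sup>2 \<le> 2 * (norm (f x))\<^sup>2 + 2 * (norm (g x))\<^sup>2" for x
    proof -
      have "(norm (f x + g x))\<^sup>2 \<le> (norm (f x) + norm (g x))\<^sup>2"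
        by (simp add: norm_triangle_ineq power_mono)
      also have "\<dots> \<le> 2 * (norm (f x))\<^sup>2 + 2 * (norm (g x))\<^sup>2"
        using sum_squares_bound[of "norm (f x)" "norm (g x)"] by (simp add: power2_sum)
      finally show ?thesis .
    qed
    then show "AE x in mu. norm ((norm (f x + g x))\<^sup>2)
        \<le> norm (2 * (norm (f x))\<^sup>2 + 2 * (norm (g x))\<^sup>2)"
      by simp
  qed measurable
qed

lemma L2_scaleR: "L2 f \<Longrightarrow> L2 (\<lambda>x. c *\<^sub>R f x)"
  for f :: "real \<Rightarrow> 'a::euclidean_space"
  by (rule L2_bound[where g=f and C="\<bar>c\<bar>"]) (auto simp: L2_def intro!: AE_mu_I)

lemma L2_diff: "L2 f \<Longrightarrow> L2 g \<Longrightarrow> L2 (\<lambda>x. f x - g x)"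
  for f g :: "real \<Rightarrow> 'a::euclidean_space"
  using L2_add[OF _ L2_scaleR[of g "-1"]] by simp

lemma L2_const: "L2 (\<lambda>x. c)" for c :: "'a::euclidean_space"
  by (auto simp: L2_def intro!: continuous_integrable_mu)

lemma L2_continuous: "continuous_on {0..2*pi} f \<Longrightarrow> L2 f"
  for f :: "real \<Rightarrow> 'a::euclidean_space"
  by (auto simp: L2_def intro!: continuous_borel_mu continuous_integrable_mu continuous_intros)

lemma L2_inner_integrable:
  fixes f g :: "real \<Rightarrow> 'a::euclidean_space"
  assumes f: "L2 f" and g: "L2 g"
  shows "integrable mu (\<lambda>x. f x \<bullet> g x)"
proof -
  have [measurable]: "f \<in> borel_measurable mu" "g \<in> borel_measurable mu"
    using f g by (auto simp: L2_def)
  show ?thesis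
  proof (rule Bochner_Integration.integrable_bound)
    show "integrable mu (\<lambda>x. (norm (f x))\<^sup>2 + (norm (g x))\<^sup>2)"
      using f g by (auto simp: L2_def)
    have "\<bar>f x \<bullet> g x\<bar> \<le> (norm (f x))\<^sup>2 + (norm (g x))\<^sup>2" for x
      using Cauchy_Schwarz_ineq2[of "f x" "g x"] sum_squares_bound[of "norm (f x)" "norm (g x)"]
        mult_nonneg_nonneg[OF norm_ge_zero[of "f x"] norm_ge_zero[of "g x"]] by linarith
    then show "AE x in mu. norm (f x \<bullet> g x) \<le> norm ((norm (f x))\<^sup>2 + (norm (g x))\<^sup>2)"
      by simp
  qed measurable
qed

lemma L2_norm: "L2 f \<Longrightarrow> L2 (\<lambda>x. norm (f x))" for f :: "real \<Rightarrow> 'a::euclidean_space"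
  by (auto simp: L2_def)

lemma L2_integrable: "L2 f \<Longrightarrow> integrable mu f" for f :: "real \<Rightarrow> 'a::euclidean_space"
  using L2_inner_integrable[OF L2_norm[of f] L2_const[of "1::real"]]
  by (simp add: L2_def integrable_norm_iff)

lemma L2_absolutely_integrable:
  fixes f :: "real \<Rightarrow> 'a::euclidean_space"
  assumes "L2 f" "0 \<le> x" "y \<le> 2*pi"
  shows "f absolutely_integrable_on {x..y}"
  using L2_integrable[OF assms(1)] unfolding integrable_mu_iff
  by (rule set_integrable_subset) (use assms in auto)

lemma L2_integrable_on:
  fixes f :: "real \<Rightarrow> 'a::euclidean_space"
  assumes "L2 f" "0 \<le> x" "y \<le> 2*pi"
  shows "f integrable_on {x..y}"
  using L2_absolutely_integrable[OF assms] by (rule set_lebesgue_integral_eq_integral)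

lemma L2_multiplier:
  fixes f :: "real \<Rightarrow> real" and g :: "real \<Rightarrow> 'a::euclidean_space"
  assumes "continuous_on {0..2*pi} f" "L2 g"
  shows "L2 (\<lambda>x. f x *\<^sub>R g x)"
proof -
  obtain C where "C > 0" and C: "\<And>x. x \<in> {0..2*pi} \<Longrightarrow> norm (f x) \<le> C"
    using continuous_bounded_pos[OF assms(1)] by blast
  have [measurable]: "f \<in> borel_measurable mu" "g \<in> borel_measurable mu"
    using assms by (auto simp: L2_def intro: continuous_borel_mu)
  show ?thesis
    by (rule L2_bound[OF _ assms(2), where C=C]) (use C in \<open>auto intro!: AE_mu_I mult_right_mono\<close>)
qed

text \<open>The free weight \<open>t\<close> makes this a substitute for the Cauchy-Schwarz inequality.\<close>

lemma L2_integral_norm_le: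
  fixes f :: "real \<Rightarrow> 'a::euclidean_space"
  assumes f: "L2 f" and xy: "0 \<le> x" "x \<le> y" "y \<le> 2*pi" and t: "t > 0"
  shows "integral {x..y} (\<lambda>s. norm (f s))
    \<le> (t * (y - x) + (LINT s|mu. (norm (f s))\<^sup>2) / t) / 2"
proof -
  have sq: "(\<lambda>s. (norm (f s))\<^sup>2) absolutely_integrable_on {0..2*pi}"
    using f by (simp add: L2_def integrable_mu_iff)
  have sqi: "(\<lambda>s. (norm (f s))\<^sup>2) integrable_on {x..y}"
    using set_lebesgue_integral_eq_integral(1)[OF sq] by (rule integrable_on_subinterval) (use xy in auto)
  have "integral {x..y} (\<lambda>s. norm (f s)) \<le> integral {x..y} (\<lambda>s. t/2 + (1/(2*t)) * (norm (f s))\<^sup>2)"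
  proof (rule integral_le)
    show "(\<lambda>s. norm (f s)) integrable_on {x..y}"
      using L2_norm[OF f] by (rule L2_integrable_on) (use xy in auto)
    show "(\<lambda>s. t/2 + (1/(2*t)) * (norm (f s))\<^sup>2) integrable_on {x..y}"
      by (intro integrable_add integrable_on_mult_right sqi) auto
    fix s
    \<comment> \<open>Young's inequality, pointwise.\<close>
    have "0 \<le> (t - norm (f s))\<^sup>2 / (2*t)" using t by simp
    also have "\<dots> = t/2 + (1/(2*t)) * (norm (f s))\<^sup>2 - norm (f s)"
      using t by (simp add: power2_diff field_simps power2_eq_square)
    finally show "norm (f s) \<le> t/2 + (1/(2*t)) * (norm (f s))\<^sup>2" by simp
  qed
  also have "\<dots> = t/2 * (y - x) + (1/(2*t)) * integral {x..y} (\<lambda>s. (norm (f s))\<^sup>2)"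
    by (subst integral_add) (use xy integrable_on_mult_right[OF sqi, of "1/(2*t)"] in auto)
  also have "\<dots> \<le> t/2 * (y - x) + (1/(2*t)) * (LINT s|mu. (norm (f s))\<^sup>2)"
  proof -
    have "integral {x..y} (\<lambda>s. (norm (f s))\<^sup>2) \<le> integral {0..2*pi} (\<lambda>s. (norm (f s))\<^sup>2)"
      by (rule integral_subset_le)
        (use xy sqi set_lebesgue_integral_eq_integral(1)[OF sq] in auto)
    also have "\<dots> = (LINT s|mu. (norm (f s))\<^sup>2)"
      using f by (simp add: L2_def LINT_mu)
    finally show ?thesis using t by (intro add_left_mono mult_left_mono) auto
  qed
  also have "\<dots> = (t * (y - x) + (LINT s|mu. (norm (f s))\<^sup>2) / t) / 2"
    using t by (simp add: field_simps)
  finally show ?thesis .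
qed

text \<open>Riesz-Fischer. Along indices \<open>r k\<close> with distances at most
  \<open>(1/4)^k\<close> the increments are summable in L1, so this subsequence converges almost
  everywhere; Fatou's lemma turns the Cauchy bounds into distances to the limit, for the whole
  sequence.\<close>

lemma L2_complete:
  fixes f :: "nat \<Rightarrow> real \<Rightarrow> 'a::euclidean_space"
  assumes f: "\<And>n. L2 (f n)"
    and cauchy: "\<And>e. e > 0 \<Longrightarrow> \<exists>N. \<forall>m\<ge>N. \<forall>n\<ge>N. (LINT x|mu. (norm (f m x - f n x))\<^sup>2) \<le> e"
  obtains g where "L2 g" "(\<lambda>n. LINT x|mu. (norm (f n x - g x))\<^sup>2) \<longlonglongrightarrow> 0"
proof -
  have [measurable]: "f n \<in> borel_measurable mu" for n using f by (simp add: L2_def)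
  define D where "D m n = (LINT x|mu. (norm (f m x - f n x))\<^sup>2)" for m n
  have "\<exists>r. \<forall>k. (\<forall>m\<ge>r k. \<forall>n\<ge>r k. D m n \<le> (1/4)^k) \<and> r k \<le> r (Suc k)"
  proof (rule dependent_nat_choice)
    show "\<exists>N. \<forall>m\<ge>N. \<forall>n\<ge>N. D m n \<le> (1/4)^0"
      using cauchy[of 1] by (simp add: D_def)
    fix N k
    obtain N' where N': "\<forall>m\<ge>N'. \<forall>n\<ge>N'. D m n \<le> (1/4)^Suc k"
      using cauchy[of "(1/4)^Suc k"] by (auto simp: D_def)
    show "\<exists>N'. (\<forall>m\<ge>N'. \<forall>n\<ge>N'. D m n \<le> (1/4)^Suc k) \<and> N \<le> N'"
      by (rule exI[of _ "max N N'"]) (use N' in auto)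
  qed
  then obtain r where rD: "\<And>k m n. m \<ge> r k \<Longrightarrow> n \<ge> r k \<Longrightarrow> D m n \<le> (1/4)^k"
    and rS: "\<And>k. r k \<le> r (Suc k)" by blast
  have rmono: "r k \<le> r l" if "k \<le> l" for k l
    using that rS by (rule lift_Suc_mono_le[rotated])
  define h where "h k x = f (r (Suc k)) x - f (r k) x" for k x
  have L2h: "L2 (h k)" for k unfolding h_def by (intro L2_diff f)
  have [measurable]: "h k \<in> borel_measurable mu" for k using L2h by (simp add: L2_def)
  \<comment> \<open>Weight \<open>t = (1/2)^k\<close> in \<open>L2_integral_norm_le\<close>: half of
    \<open>2*pi * (1/2)^k + (1/4)^k / (1/2)^k\<close>.\<close>
  have hint: "(LINT x|mu. norm (h k x)) \<le> (pi + 1/2) * (1/2)^k" for k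
  proof -
    have "(LINT x|mu. norm (h k x)) = integral {0..2*pi} (\<lambda>x. norm (h k x))"
      by (intro LINT_mu L2_integrable L2_norm L2h)
    also have "\<dots> \<le> ((1/2)^k * (2*pi - 0) + (LINT s|mu. (norm (h k s))\<^sup>2) / (1/2)^k) / 2"
      by (rule L2_integral_norm_le[OF L2h]) auto
    also have "\<dots> \<le> ((1/2)^k * (2*pi - 0) + (1/4)^k / (1/2)^k) / 2"
      using rD[of k "r (Suc k)" "r k"] rS[of k]
      by (intro divide_right_mono add_left_mono) (auto simp: D_def h_def)
    also have "\<dots> = (pi + 1/2) * (1/2)^k"
      by (simp add: field_simps flip: power_mult_distrib)
    finally show ?thesis .
  qed
  have "AE x in mu. summable (\<lambda>k. norm (h k x))"
  proof -
    have "(\<integral>\<^sup>+ x. (\<Sum>k. ennreal (norm (h k x))) \<partial>mu) = (\<Sum>k. \<integral>\<^sup>+ x. ennreal (norm (h k x)) \<partial>mu)"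
      by (rule nn_integral_suminf) measurable
    also have "\<dots> = (\<Sum>k. ennreal (LINT x|mu. norm (h k x)))"
      by (intro suminf_cong nn_integral_eq_integral L2_integrable L2_norm L2h) auto
    also have "\<dots> \<le> (\<Sum>k. ennreal ((pi + 1/2) * (1/2)^k))"
      by (intro suminf_le ennreal_leI hint) auto
    also have "\<dots> < \<infinity>"
    proof -
      have "summable (\<lambda>k. (pi + 1/2) * (1/2)^k)" by (intro summable_mult summable_geometric) auto
      then show ?thesis by (subst suminf_ennreal2) (auto intro!: mult_nonneg_nonneg)
    qed
    finally have "AE x in mu. (\<Sum>k. ennreal (norm (h k x))) \<noteq> \<infinity>"
      by (intro nn_integral_PInf_AE) auto
    then show ?thesis
      by eventually_elim (auto intro!: summable_suminf_not_top)
  qed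
  then have conv: "AE x in mu. convergent (\<lambda>k. f (r k) x)"
  proof eventually_elim
    case (elim x)
    then have "summable (\<lambda>k. h k x)" by (rule summable_norm_cancel)
    then have "convergent (\<lambda>n. \<Sum>k<n. h k x)" by (simp add: summable_iff_convergent)
    moreover have "(\<Sum>k<n. h k x) = f (r n) x - f (r 0) x" for n
      unfolding h_def using sum_lessThan_telescope[of "\<lambda>k. f (r k) x" n] by simp
    ultimately have "convergent (\<lambda>n. f (r n) x - f (r 0) x)" by simp
    then have "convergent (\<lambda>n. f (r n) x - f (r 0) x + f (r 0) x)"
      by (intro convergent_add convergent_const)
    then show ?case by simp
  qed
  define g where "g x = lim (\<lambda>k. f (r k) x)" for x
  have [measurable]: "g \<in> borel_measurable mu"
    unfolding g_def by (rule borel_measurable_lim_metric) auto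
  have lim: "AE x in mu. (\<lambda>k. f (r k) x) \<longlonglongrightarrow> g x"
    using conv by eventually_elim (simp add: g_def convergent_LIMSEQ_iff)
  have fatou: "(\<integral>\<^sup>+ x. ennreal ((norm (f n x - g x))\<^sup>2) \<partial>mu) \<le> ennreal ((1/4)^k)"
    if n: "n \<ge> r k" for n k
  proof -
    have "(\<integral>\<^sup>+ x. ennreal ((norm (f n x - g x))\<^sup>2) \<partial>mu)
        = (\<integral>\<^sup>+ x. liminf (\<lambda>j. ennreal ((norm (f n x - f (r j) x))\<^sup>2)) \<partial>mu)"
    proof (rule nn_integral_cong_AE, use lim in eventually_elim)
      case (elim x)
      then have "(\<lambda>j. ennreal ((norm (f n x - f (r j) x))\<^sup>2)) \<longlonglongrightarrow> ennreal ((norm (f n x - g x))\<^sup>2)"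
        by (intro tendsto_intros tendsto_ennrealI)
      from lim_imp_Liminf[OF _ this] show ?case by simp
    qed
    also have "\<dots> \<le> liminf (\<lambda>j. \<integral>\<^sup>+ x. ennreal ((norm (f n x - f (r j) x))\<^sup>2) \<partial>mu)"
      by (rule nn_integral_liminf) measurable
    also have "\<dots> = liminf (\<lambda>j. ennreal (D n (r j)))"
      unfolding D_def
      by (intro arg_cong[where f=liminf] ext nn_integral_eq_integral L2_integrable_square L2_diff f) auto
    also have "\<dots> \<le> limsup (\<lambda>j. ennreal (D n (r j)))" by (rule Liminf_le_Limsup) auto
    also have "\<dots> \<le> ennreal ((1/4)^k)"
    proof (rule Limsup_bounded)
      show "\<forall>\<^sub>F j in sequentially. ennreal (D n (r j)) \<le> ennreal ((1/4)^k)"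
        using eventually_ge_at_top[of k]
        by eventually_elim (intro ennreal_leI rD n rmono)
    qed
    finally show ?thesis .
  qed
  have L2d: "L2 (\<lambda>x. f n x - g x)" if "n \<ge> r 0" for n
    unfolding L2_def
  proof
    show "integrable mu (\<lambda>x. (norm (f n x - g x))\<^sup>2)"
      by (rule integrableI_bounded) (use fatou[OF that] in \<open>auto simp: less_top[symmetric] top_unique\<close>)
  qed measurable
  \<comment> \<open>Fatou gives square integrability only of the differences \<open>f n - g\<close>;
    subtracting one of them from \<open>f (r 0)\<close> gives it for \<open>g\<close>.\<close>
  have "L2 (\<lambda>x. f (r 0) x - (f (r 0) x - g x))" by (intro L2_diff[OF f] L2d) auto
  then have L2g: "L2 g" by simp
  have "(\<lambda>n. LINT x|mu. (norm (f n x - g x))\<^sup>2) \<longlonglongrightarrow> 0"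
  proof (rule LIMSEQ_I)
    fix e :: real assume "e > 0"
    then obtain k where k: "(1/4)^k < e" using real_arch_pow_inv[of e "1/4"] by auto
    have "(LINT x|mu. (norm (f n x - g x))\<^sup>2) < e" if "n \<ge> r k" for n
    proof -
      have "ennreal (LINT x|mu. (norm (f n x - g x))\<^sup>2) \<le> ennreal ((1/4)^k)"
        using fatou[OF that]
        by (subst nn_integral_eq_integral[symmetric]) (auto intro!: L2_integrable_square L2_diff f L2g)
      then show ?thesis using k by (simp add: ennreal_le_iff)
    qed
    then show "\<exists>N. \<forall>n\<ge>N. norm ((LINT x|mu. (norm (f n x - g x))\<^sup>2) - 0) < e"
      by auto
  qed
  with L2g show ?thesis by (rule that)
qed

subsection \<open>Primitives of square integrable functions\<close>

text \<open>The derivative is an argument because it is determined only up to null sets, while the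
  pointwise identity makes \<open>f\<close> the continuous representative on the interval.\<close>

definition H1 :: "(real \<Rightarrow> 'a::euclidean_space) \<Rightarrow> (real \<Rightarrow> 'a) \<Rightarrow> bool" where
  "H1 f g \<longleftrightarrow> L2 g \<and> (\<forall>x\<in>{0..2*pi}. f x = f 0 + integral {0..x} g)"

lemma H1_L2: "H1 f g \<Longrightarrow> L2 g"
  by (simp add: H1_def)

lemma H1_eq: "H1 f g \<Longrightarrow> x \<in> {0..2*pi} \<Longrightarrow> f x = f 0 + integral {0..x} g"
  unfolding H1_def by blast

lemma H1I:
  "L2 g \<Longrightarrow> (\<And>x. x \<in> {0..2*pi} \<Longrightarrow> f x = f 0 + integral {0..x} g) \<Longrightarrow> H1 f g"
  unfolding H1_def by blast

lemma integral_split: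
  fixes g :: "real \<Rightarrow> 'a::euclidean_space"
  assumes "L2 g" "0 \<le> x" "x \<le> y" "y \<le> 2*pi"
  shows "integral {0..y} g - integral {0..x} g = integral {x..y} g"
  using Henstock_Kurzweil_Integration.integral_combine[of 0 x y g] assms
  by (simp add: L2_integrable_on algebra_simps)

lemma H1_increment:
  assumes "H1 f g" "0 \<le> x" "x \<le> y" "y \<le> 2*pi"
  shows "f y - f x = integral {x..y} g"
proof -
  have "f y = f 0 + integral {0..y} g" "f x = f 0 + integral {0..x} g"
    using H1_eq[OF assms(1), of y] H1_eq[OF assms(1), of x] assms(2-) by auto
  then show ?thesis using integral_split[OF H1_L2[OF assms(1)] assms(2-)] by simp
qed

lemma H1_continuous: "H1 f g \<Longrightarrow> continuous_on {0..2*pi} f"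
proof -
  assume H: "H1 f g"
  have "continuous_on {0..2*pi} (\<lambda>x. f 0 + integral {0..x} g)"
    by (intro continuous_intros indefinite_integral_continuous_1 L2_integrable_on) (use H1_L2[OF H] in auto)
  then show ?thesis
    by (rule continuous_on_eq) (rule H1_eq[OF H, symmetric])
qed

lemma H1_primitive: "L2 g \<Longrightarrow> H1 (\<lambda>x. c + integral {0..x} g) g"
  by (simp add: H1_def)

lemma H1_of_derivative:
  fixes f :: "real \<Rightarrow> 'a::euclidean_space"
  assumes "\<And>x. x \<in> {0..2*pi} \<Longrightarrow> (f has_vector_derivative f' x) (at x within {0..2*pi})"
    and "continuous_on {0..2*pi} f'"
  shows "H1 f f'"
proof (intro H1I L2_continuous assms)
  fix x :: real assume x: "x \<in> {0..2*pi}"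
  have "(f' has_integral f x - f 0) {0..x}"
    by (rule fundamental_theorem_of_calculus)
      (use x in \<open>auto intro: has_vector_derivative_within_subset[OF assms(1)]\<close>)
  then show "f x = f 0 + integral {0..x} f'" by (simp add: integral_unique)
qed

lemma AE_mu_negligible:
  assumes "AE x in mu. P x"
  obtains N where "negligible N" "\<And>x. x \<in> {0..2*pi} \<Longrightarrow> x \<notin> N \<Longrightarrow> P x"
proof -
  have "AE x in lebesgue. x \<in> {0..2*pi} \<longrightarrow> P x"
    using assms by (simp add: AE_restrict_space_iff)
  then obtain N where "N \<in> null_sets lebesgue" "{x. \<not> (x \<in> {0..2*pi} \<longrightarrow> P x)} \<subseteq> N"
    by (auto simp: eventually_ae_filter)
  then show ?thesis using that[of N] by (auto simp: negligible_iff_null_sets)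
qed

lemma integral_cong_AE_mu:
  assumes "AE x in mu. f x = g x" "0 \<le> a" "b \<le> 2*pi"
  shows "integral {a..b} f = integral {a..b} g"
proof -
  obtain N where "negligible N" "\<And>x. x \<in> {0..2*pi} \<Longrightarrow> x \<notin> N \<Longrightarrow> f x = g x"
    using AE_mu_negligible[OF assms(1)] by blast
  then show ?thesis by (intro integral_spike[of N]) (use assms in auto)
qed

lemma H1_cong:
  assumes "H1 f g" "\<And>x. x \<in> {0..2*pi} \<Longrightarrow> f' x = f x" "AE x in mu. g' x = g x" "L2 g'"
  shows "H1 f' g'"
proof (rule H1I[OF assms(4)])
  fix x assume x: "x \<in> {0..2*pi}"
  then show "f' x = f' 0 + integral {0..x} g'"
    using assms(2)[of x] assms(2)[of 0] H1_eq[OF assms(1) x] integral_cong_AE_mu[OF assms(3), of 0 x]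
    by simp
qed

text \<open>Substitute for the a.e. differentiability of absolutely continuous functions.\<close>

lemma constant_of_small_increments:
  fixes G :: "real \<Rightarrow> 'a::real_normed_vector"
  assumes ab: "a \<le> b"
    and small: "\<And>x e. x \<in> {a..b} \<Longrightarrow> e > 0 \<Longrightarrow> \<exists>d>0. \<forall>y z. a \<le> y \<longrightarrow> y \<le> x \<longrightarrow> x \<le> z \<longrightarrow> z \<le> b
        \<longrightarrow> z - y < d \<longrightarrow> norm (G z - G y) \<le> e * (m z - m y)"
  shows "G a = G b"
proof -
  have le: "norm (G b - G a) \<le> e * (m b - m a)" if "e > 0" for e :: real
  proof -
    \<comment> \<open>Bolzano bisection: the estimate is additive over adjacent intervals and holds
      on short intervals around each point. The premises \<open>a \<le> y\<close> and
      \<open>z \<le> b\<close> confine the induction to \<open>[a, b]\<close>.\<close>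
    have "a \<le> a \<longrightarrow> b \<le> b \<longrightarrow> norm (G b - G a) \<le> e * (m b - m a)"
      using ab
    proof (induction rule: Bolzano[where P="\<lambda>y z. a \<le> y \<longrightarrow> z \<le> b \<longrightarrow> norm (G z - G y) \<le> e * (m z - m y)"])
      case (trans x y z)
      show ?case
      proof (intro impI)
        assume "a \<le> x" "z \<le> b"
        then have "norm (G z - G y) \<le> e * (m z - m y)" "norm (G y - G x) \<le> e * (m y - m x)"
          using trans by auto
        then show "norm (G z - G x) \<le> e * (m z - m x)"
          using norm_triangle_ineq[of "G z - G y" "G y - G x"] by (simp add: algebra_simps)
      qed
    next
      case (local x)
      then show ?case using small[of x e] \<open>e > 0\<close> by (metis atLeastAtMost_iff)
    qed
    then show ?thesis by simp
  qed
  have "norm (G b - G a) \<le> 0"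
  proof (rule field_le_epsilon)
    fix e :: real assume e: "e > 0"
    \<comment> \<open>\<open>m b - m a\<close> may vanish or be negative, so \<open>e\<close> is
      divided by \<open>1 + \<bar>m b - m a\<bar>\<close>.\<close>
    have "norm (G b - G a) \<le> e / (1 + \<bar>m b - m a\<bar>) * (m b - m a)"
      by (rule le) (use e in auto)
    also have "\<dots> \<le> e / (1 + \<bar>m b - m a\<bar>) * (1 + \<bar>m b - m a\<bar>)"
      by (rule mult_left_mono) (use e in auto)
    also have "\<dots> = 0 + e" by (simp add: add_nonneg_eq_0_iff)
    finally show "norm (G b - G a) \<le> 0 + e" .
  qed
  then show ?thesis by simp
qed

section \<open>Chain and product rules\<close>

lemma strict_differentiability:
  fixes \<Phi> :: "'a::euclidean_space \<Rightarrow> 'b::euclidean_space"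
  assumes U: "open U" "u \<in> U"
    and der: "\<And>p. p \<in> U \<Longrightarrow> (\<Phi> has_derivative \<Phi>' p) (at p)"
    and cont: "\<And>h. continuous_on U (\<lambda>p. \<Phi>' p h)"
    and e: "e > 0"
  obtains d where "d > 0"
    "\<And>p h. p \<in> ball u d \<Longrightarrow> norm (\<Phi>' p h - \<Phi>' u h) \<le> e * norm h"
    "\<And>p q. p \<in> ball u d \<Longrightarrow> q \<in> ball u d \<Longrightarrow> norm (\<Phi> q - \<Phi> p - \<Phi>' u (q - p)) \<le> e * norm (q - p)"
proof -
  have lin: "bounded_linear (\<Phi>' p)" if "p \<in> U" for p
    using der[OF that] by (rule has_derivative_bounded_linear)
  \<comment> \<open>Continuity in each direction is enough: by \<open>onorm_componentwise\<close>
    this finite sum dominates the operator norm of \<open>\<Phi>' p - \<Phi>' u\<close>.\<close>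
  have "((\<lambda>p. \<Sum>b\<in>Basis. norm (\<Phi>' p b - \<Phi>' u b)) \<longlongrightarrow> (\<Sum>b\<in>Basis. norm (\<Phi>' u b - \<Phi>' u b))) (at u)"
    by (intro tendsto_intros) (use cont U in \<open>metis continuous_on_eq_continuous_at isContD\<close>)
  then have "\<forall>\<^sub>F p in at u. (\<Sum>b\<in>Basis. norm (\<Phi>' p b - \<Phi>' u b)) < e"
    by (rule order_tendstoD) (use e in auto)
  then have "\<forall>\<^sub>F p in nhds u. (\<Sum>b\<in>Basis. norm (\<Phi>' p b - \<Phi>' u b)) < e"
    by (rule eventually_nhds_conv_at[THEN iffD2, OF conjI]) (use e in auto)
  moreover have "\<forall>\<^sub>F p in nhds u. p \<in> U" using U by (rule eventually_nhds_in_open)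
  ultimately have "\<forall>\<^sub>F p in nhds u. p \<in> U \<and> (\<Sum>b\<in>Basis. norm (\<Phi>' p b - \<Phi>' u b)) < e"
    by eventually_elim auto
  then obtain d where d: "d > 0" and ball: "\<And>p. p \<in> ball u d \<Longrightarrow> p \<in> U"
    and small: "\<And>p. p \<in> ball u d \<Longrightarrow> (\<Sum>b\<in>Basis. norm (\<Phi>' p b - \<Phi>' u b)) < e"
    by (auto simp: eventually_nhds_metric dist_commute)
  have bl: "bounded_linear (\<lambda>h. \<Phi>' p h - \<Phi>' u h)" if "p \<in> ball u d" for p
    by (intro bounded_linear_sub lin ball that U)
  have on: "onorm (\<lambda>h. \<Phi>' p h - \<Phi>' u h) \<le> e" if "p \<in> ball u d" for p
    using onorm_componentwise[OF bl[OF that]] small[OF that] by simp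
  show ?thesis
  proof (rule that[OF d])
    fix p h assume p: "p \<in> ball u d"
    show "norm (\<Phi>' p h - \<Phi>' u h) \<le> e * norm h"
      using onorm[OF bl[OF p], of h] mult_right_mono[OF on[OF p], of "norm h"] by simp
  next
    fix p q assume pq: "p \<in> ball u d" "q \<in> ball u d"
    \<comment> \<open>Mean value inequality on the convex ball, for the remainder after the
      derivative at \<open>u\<close> is subtracted.\<close>
    have "norm (\<Phi> q - \<Phi> p - \<Phi>' u (q - p)) \<le> norm (q - p) * e"
    proof (rule differentiable_bound_linearization[where S="ball u d"])
      fix t :: real assume "t \<in> {0..1}"
      then have "(1 - t) *\<^sub>R p + t *\<^sub>R q \<in> ball u d"
        by (intro convexD_alt[OF convex_ball] pq) auto
      then show "p + t *\<^sub>R (q - p) \<in> ball u d" by (simp add: algebra_simps)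
    next
      fix x assume x: "x \<in> ball u d"
      show "(\<Phi> has_derivative \<Phi>' x) (at x within ball u d)"
        by (rule has_derivative_at_withinI[OF der[OF ball[OF x]]])
      show "onorm (\<Phi>' x - \<Phi>' u) \<le> e" using on[OF x] by (simp add: fun_diff_def)
    qed (use d in auto)
    then show "norm (\<Phi> q - \<Phi> p - \<Phi>' u (q - p)) \<le> e * norm (q - p)" by (simp add: mult.commute)
  qed
qed

text \<open>In coordinates, \<open>A x (g x)\<close> is a finite sum of bounded continuous columns
  \<open>A x b\<close> with square integrable coefficients.\<close>

lemma L2_linear_image:
  fixes A :: "real \<Rightarrow> 'a::euclidean_space \<Rightarrow> 'b::euclidean_space"
  assumes lin: "\<And>x. x \<in> {0..2*pi} \<Longrightarrow> linear (A x)"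
    and cont: "\<And>h. continuous_on {0..2*pi} (\<lambda>x. A x h)" and g: "L2 g"
  shows "L2 (\<lambda>x. A x (g x))"
proof -
  have "L2 (\<lambda>x. \<Sum>b\<in>Basis. (g x \<bullet> b) *\<^sub>R A x b)"
  proof -
    have comp: "L2 (\<lambda>x. (g x \<bullet> b) *\<^sub>R A x b)" for b
    proof -
      obtain C where C: "\<And>x. x \<in> {0..2*pi} \<Longrightarrow> norm (A x b) \<le> C" "C > 0"
        using continuous_bounded_pos[OF cont] by blast
      have [measurable]: "g \<in> borel_measurable mu" "(\<lambda>x. A x b) \<in> borel_measurable mu"
        using g by (auto simp: L2_def intro: continuous_borel_mu cont)
      show ?thesis
      proof (rule L2_bound[OF _ g])
        show "AE x in mu. norm ((g x \<bullet> b) *\<^sub>R A x b) \<le> (norm b * C) * norm (g x)"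
        proof (rule AE_mu_I)
          fix x :: real assume x: "x \<in> {0..2*pi}"
          have "norm ((g x \<bullet> b) *\<^sub>R A x b) \<le> (norm (g x) * norm b) * C"
            by (simp, intro mult_mono Cauchy_Schwarz_ineq2 C x) auto
          then show "norm ((g x \<bullet> b) *\<^sub>R A x b) \<le> (norm b * C) * norm (g x)"
            by (simp add: algebra_simps)
        qed
      qed measurable
    qed
    have "L2 (\<lambda>x. \<Sum>b\<in>B. (g x \<bullet> b) *\<^sub>R A x b)" if "finite B" for B
      using that by (induction B rule: finite_induct) (auto intro: L2_add L2_const comp)
    then show ?thesis by simp
  qed
  moreover have "(\<Sum>b\<in>Basis. (g x \<bullet> b) *\<^sub>R A x b) = A x (g x)" if "x \<in> {0..2*pi}" for x
  proof -
    interpret linear "A x" by (rule lin[OF that])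
    have "A x (g x) = A x (\<Sum>b\<in>Basis. (g x \<bullet> b) *\<^sub>R b)" by (simp add: euclidean_representation)
    then show ?thesis by (simp add: sum scaleR)
  qed
  ultimately have S: "L2 (\<lambda>x. \<Sum>b\<in>Basis. (g x \<bullet> b) *\<^sub>R A x b)"
    and eq: "\<And>x. x \<in> {0..2*pi} \<Longrightarrow> A x (g x) = (\<Sum>b\<in>Basis. (g x \<bullet> b) *\<^sub>R A x b)" by auto
  show ?thesis
  proof (rule L2_bound[OF _ S, where C=1])
    have "(\<lambda>x. A x (g x)) \<in> borel_measurable mu \<longleftrightarrow>
        (\<lambda>x. \<Sum>b\<in>Basis. (g x \<bullet> b) *\<^sub>R A x b) \<in> borel_measurable mu"
      by (rule measurable_cong) (simp add: eq)
    then show "(\<lambda>x. A x (g x)) \<in> borel_measurable mu" using S by (simp add: L2_def)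
  qed (auto intro!: AE_mu_I simp: eq)
qed

text \<open>\<open>\<Phi> (f x)\<close> minus the proposed primitive is constant: near each point
  its increments are at most \<open>e\<close> times those of \<open>m\<close>, the primitive of
  \<open>norm (g t)\<close>. Comparing with \<open>m\<close> rather than with length accommodates
  unbounded \<open>g\<close>, and \<open>f\<close> is never differentiated at a point.\<close>

theorem H1_chain_rule:
  fixes \<Phi> :: "'a::euclidean_space \<Rightarrow> 'b::euclidean_space"
  assumes f: "H1 f g" and U: "open U" "\<And>x. x \<in> {0..2*pi} \<Longrightarrow> f x \<in> U"
    and der: "\<And>p. p \<in> U \<Longrightarrow> (\<Phi> has_derivative \<Phi>' p) (at p)"
    and cont: "\<And>h. continuous_on U (\<lambda>p. \<Phi>' p h)"
  shows "H1 (\<lambda>x. \<Phi> (f x)) (\<lambda>x. \<Phi>' (f x) (g x))"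
proof -
  have L2g: "L2 g" using f by (rule H1_L2)
  have fc: "continuous_on {0..2*pi} f" using f by (rule H1_continuous)
  have lin: "linear (\<Phi>' p)" if "p \<in> U" for p
    using der[OF that] by (intro bounded_linear.linear has_derivative_bounded_linear)
  have L2k: "L2 (\<lambda>x. \<Phi>' (f x) (g x))"
    by (rule L2_linear_image[OF lin _ L2g])
      (use U in \<open>auto intro!: continuous_on_compose2[OF cont fc]\<close>)
  define m where "m x = integral {0..x} (\<lambda>t. norm (g t))" for x
  define G where "G x = \<Phi> (f x) - integral {0..x} (\<lambda>t. \<Phi>' (f t) (g t))" for x
  have "G 0 = G b" if b: "b \<in> {0..2*pi}" for b
  proof (rule constant_of_small_increments[where m=m])
    fix x e :: real assume x: "x \<in> {0..b}" and e: "e > 0"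
    have xi: "x \<in> {0..2*pi}" using x b by auto
    obtain r where r: "r > 0"
      and near: "\<And>p h. p \<in> ball (f x) r \<Longrightarrow> norm (\<Phi>' p h - \<Phi>' (f x) h) \<le> e/2 * norm h"
      and strict: "\<And>p q. p \<in> ball (f x) r \<Longrightarrow> q \<in> ball (f x) r \<Longrightarrow>
        norm (\<Phi> q - \<Phi> p - \<Phi>' (f x) (q - p)) \<le> e/2 * norm (q - p)"
      using strict_differentiability[OF U(1) U(2)[OF xi] der cont, of "e/2"] e by auto
    obtain d where d: "d > 0" and dr: "\<And>y. y \<in> {0..2*pi} \<Longrightarrow> dist y x < d \<Longrightarrow> dist (f y) (f x) < r"
      using fc xi r unfolding continuous_on_iff by blast
    show "\<exists>d>0. \<forall>y z. 0 \<le> y \<longrightarrow> y \<le> x \<longrightarrow> x \<le> z \<longrightarrow> z \<le> b \<longrightarrow> z - y < d \<longrightarrow>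
        norm (G z - G y) \<le> e * (m z - m y)"
    proof (intro exI conjI allI impI)
      show "d > 0" by fact
      fix y z assume yz: "0 \<le> y" "y \<le> x" "x \<le> z" "z \<le> b" "z - y < d"
      then have yz': "0 \<le> y" "y \<le> z" "z \<le> 2*pi" using b by auto
      have fb: "f t \<in> ball (f x) r" if "t \<in> {y..z}" for t
        using dr[of t] that yz yz' by (auto simp: dist_real_def dist_commute)
      have mm: "m z - m y = integral {y..z} (\<lambda>t. norm (g t))"
        unfolding m_def by (rule integral_split[OF L2_norm[OF L2g] yz'])
      have bl: "bounded_linear (\<Phi>' (f x))"
        using der[OF U(2)[OF xi]] by (rule has_derivative_bounded_linear)
      have gi: "g integrable_on {y..z}" using L2g by (rule L2_integrable_on) (use yz' in auto)
      have ni: "(\<lambda>t. norm (g t)) integrable_on {y..z}"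
        using L2_norm[OF L2g] by (rule L2_integrable_on) (use yz' in auto)
      have ki: "(\<lambda>t. \<Phi>' (f t) (g t)) integrable_on {y..z}"
        using L2k by (rule L2_integrable_on) (use yz' in auto)
      have li: "(\<lambda>t. \<Phi>' (f x) (g t)) integrable_on {y..z}"
        using integrable_linear[OF gi bl] by (simp add: o_def)
      have inc: "f z - f y = integral {y..z} g" by (rule H1_increment[OF f yz'])
      have "integral {y..z} (\<lambda>t. \<Phi>' (f x) (g t)) = \<Phi>' (f x) (f z - f y)"
        unfolding inc using integral_linear[OF gi bl] by (simp add: o_def)
      \<comment> \<open>The first term is the error of linearizing \<open>\<Phi>\<close> at
        \<open>f x\<close>, the second the variation of \<open>\<Phi>'\<close> along
        \<open>f\<close>. Each is allotted half of \<open>e\<close>.\<close>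
      then have eq: "G z - G y = (\<Phi> (f z) - \<Phi> (f y) - \<Phi>' (f x) (f z - f y))
          - integral {y..z} (\<lambda>t. \<Phi>' (f t) (g t) - \<Phi>' (f x) (g t))"
        unfolding G_def
        by (simp add: Henstock_Kurzweil_Integration.integral_diff[OF ki li] algebra_simps
            flip: integral_split[OF L2k yz'])
      have 1: "norm (\<Phi> (f z) - \<Phi> (f y) - \<Phi>' (f x) (f z - f y)) \<le> e/2 * (m z - m y)"
      proof -
        have "norm (f z - f y) \<le> m z - m y"
          unfolding mm inc by (rule Henstock_Kurzweil_Integration.integral_norm_bound_integral[OF gi ni]) auto
        then have "e/2 * norm (f z - f y) \<le> e/2 * (m z - m y)" using e by simp
        then show ?thesis using strict[OF fb[of y] fb[of z]] yz' by auto
      qed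
      have 2: "norm (integral {y..z} (\<lambda>t. \<Phi>' (f t) (g t) - \<Phi>' (f x) (g t))) \<le> e/2 * (m z - m y)"
      proof -
        have "norm (integral {y..z} (\<lambda>t. \<Phi>' (f t) (g t) - \<Phi>' (f x) (g t)))
            \<le> integral {y..z} (\<lambda>t. e/2 * norm (g t))"
          by (rule Henstock_Kurzweil_Integration.integral_norm_bound_integral)
            (use near fb integrable_on_mult_right[OF ni, of "e/2"] in \<open>auto intro!: integrable_diff ki li\<close>)
        then show ?thesis unfolding mm by simp
      qed
      show "norm (G z - G y) \<le> e * (m z - m y)"
        unfolding eq using order_trans[OF norm_triangle_ineq4 add_mono[OF 1 2]] by simp
    qed
  qed (use b in auto)
  then have "\<Phi> (f x) = \<Phi> (f 0) + integral {0..x} (\<lambda>t. \<Phi>' (f t) (g t))" if "x \<in> {0..2*pi}" for x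
    using that unfolding G_def by (force simp: algebra_simps)
  then show ?thesis by (rule H1I[OF L2k])
qed

lemma H1_bounded_linear:
  fixes A :: "'a::euclidean_space \<Rightarrow> 'b::euclidean_space"
  assumes "H1 f g" "bounded_linear A"
  shows "H1 (\<lambda>x. A (f x)) (\<lambda>x. A (g x))"
  by (rule H1_chain_rule[OF assms(1), where U=UNIV and \<Phi>'="\<lambda>p. A"])
    (auto intro: bounded_linear_imp_has_derivative assms)

lemma L2_Pair: "L2 f \<Longrightarrow> L2 g \<Longrightarrow> L2 (\<lambda>x. (f x, g x))"
  for f :: "real \<Rightarrow> 'a::euclidean_space" and g :: "real \<Rightarrow> 'b::euclidean_space"
  by (auto simp: L2_def norm_Pair)

lemma H1_Pair:
  fixes f :: "real \<Rightarrow> 'a::euclidean_space" and h :: "real \<Rightarrow> 'b::euclidean_space"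
  assumes "H1 f g" "H1 h k"
  shows "H1 (\<lambda>x. (f x, h x)) (\<lambda>x. (g x, k x))"
proof (rule H1I)
  show L: "L2 (\<lambda>x. (g x, k x))" using assms[THEN H1_L2] by (rule L2_Pair)
  fix x assume x: "x \<in> {0..2*pi}"
  have i: "(\<lambda>x. (g x, k x)) integrable_on {0..x}" by (rule L2_integrable_on[OF L]) (use x in auto)
  have "integral {0..x} (\<lambda>x. (g x, k x)) = (integral {0..x} g, integral {0..x} k)"
    using integral_linear[OF i bounded_linear_fst] integral_linear[OF i bounded_linear_snd]
    by (simp add: o_def prod_eq_iff)
  then show "(f x, h x) = (f 0, h 0) + integral {0..x} (\<lambda>x. (g x, k x))"
    using H1_eq[OF assms(1) x] H1_eq[OF assms(2) x] by (simp add: prod_eq_iff)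
qed

lemma H1_bilinear:
  fixes f :: "real \<Rightarrow> 'a::euclidean_space" and h :: "real \<Rightarrow> 'b::euclidean_space"
    and B :: "'a \<Rightarrow> 'b \<Rightarrow> 'c::euclidean_space"
  assumes "H1 f g" "H1 h k" "bounded_bilinear B"
  shows "H1 (\<lambda>x. B (f x) (h x)) (\<lambda>x. B (f x) (k x) + B (g x) (h x))"
proof -
  interpret bounded_bilinear B by fact
  have "H1 (\<lambda>x. (\<lambda>p. B (fst p) (snd p)) (f x, h x))
      (\<lambda>x. (\<lambda>p q. B (fst p) (snd q) + B (fst q) (snd p)) (f x, h x) (g x, k x))"
    by (rule H1_chain_rule[OF H1_Pair[OF assms(1,2)], where U=UNIV])
      (auto intro!: derivative_eq_intros FDERIV continuous_intros continuous_on)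
  then show ?thesis by simp
qed

subsection \<open>Weak derivatives\<close>

lemma test_fun_boundary:
  assumes "test_fun \<phi> \<phi>'"
  shows "\<phi> 0 = 0" "\<phi> (2*pi) = 0"
  using assms by (force simp: test_fun_def)+

lemma H1_test_fun: "test_fun \<phi> \<phi>' \<Longrightarrow> H1 \<phi> \<phi>'"
  unfolding test_fun_def
  by (intro H1_of_derivative)
    (auto intro: has_field_derivative_at_within continuous_on_subset
      simp flip: has_real_derivative_iff_has_vector_derivative)

text \<open>Integration by parts: the product rule for \<open>\<phi> x *\<^sub>R f x\<close>, whose
  boundary values vanish with those of \<open>\<phi>\<close>.\<close>

lemma H1_imp_weak_deriv:
  assumes f: "H1 f g"
  shows "weak_deriv f g"
  unfolding weak_deriv_def
proof (intro conjI allI impI)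
  show L2f: "L2 f" by (intro L2_continuous H1_continuous[OF f])
  show L2g: "L2 g" by (rule H1_L2[OF f])
  fix \<phi> \<phi>' assume t: "test_fun \<phi> \<phi>'"
  have p: "H1 \<phi> \<phi>'" by (rule H1_test_fun[OF t])
  have c: "continuous_on {0..2*pi} \<phi>'" using t by (auto simp: test_fun_def intro: continuous_on_subset)
  have i1: "integrable mu (\<lambda>x. \<phi> x *\<^sub>R g x)"
    by (intro L2_integrable L2_multiplier L2g H1_continuous[OF p])
  have i2: "integrable mu (\<lambda>x. \<phi>' x *\<^sub>R f x)"
    by (intro L2_integrable L2_multiplier L2f c)
  have H: "H1 (\<lambda>x. \<phi> x *\<^sub>R f x) (\<lambda>x. \<phi> x *\<^sub>R g x + \<phi>' x *\<^sub>R f x)"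
    by (rule H1_bilinear[OF p f bounded_bilinear_scaleR])
  have "0 = integral {0..2*pi} (\<lambda>x. \<phi> x *\<^sub>R g x + \<phi>' x *\<^sub>R f x)"
    using H1_eq[OF H, of "2*pi"] test_fun_boundary[OF t] by simp
  also have "\<dots> = (LINT x|mu. \<phi> x *\<^sub>R g x + \<phi>' x *\<^sub>R f x)"
    by (rule LINT_mu[symmetric]) (intro Bochner_Integration.integrable_add i1 i2)
  also have "\<dots> = (LINT x|mu. \<phi> x *\<^sub>R g x) + (LINT x|mu. \<phi>' x *\<^sub>R f x)"
    by (rule Bochner_Integration.integral_add[OF i1 i2])
  finally show "(LINT x|mu. \<phi>' x *\<^sub>R f x) = - (LINT x|mu. \<phi> x *\<^sub>R g x)"
    by (simp add: eq_neg_iff_add_eq_0 add.commute)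
qed

text \<open>Zero mean brings the primitive back to 0 to the right of the support, so it has compact
  support in the open interval.\<close>

lemma test_fun_antiderivative:
  assumes pq: "0 < p" "p \<le> q" "q < 2*pi" and c: "continuous_on UNIV \<psi>"
    and supp: "\<And>x. x \<notin> {p..q} \<Longrightarrow> \<psi> x = 0" and zero: "integral {0..2*pi} \<psi> = 0"
  shows "test_fun (\<lambda>x. integral {0..x} \<psi>) \<psi>"
  unfolding test_fun_def
proof (intro conjI allI exI[of _ "{p..q}"] impI c)
  have left: "integral {0..x} \<psi> = 0" if "x < p" for x
  proof -
    have "integral {0..x} \<psi> = integral {0..x} (\<lambda>_. 0)"
      by (rule Henstock_Kurzweil_Integration.integral_cong) (use supp that in auto)
    then show ?thesis by simp
  qed
  have intg: "\<psi> integrable_on {a..b}" for a b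
    by (rule integrable_continuous_real) (rule continuous_on_subset[OF c], simp)
  have right: "integral {0..x} \<psi> = integral {0..q} \<psi>" if "q \<le> x" for x
  proof -
    \<comment> \<open>\<open>supp\<close> leaves the value at \<open>q\<close> open; that point is a
      null set.\<close>
    have "integral {q..x} \<psi> = integral {q..x} (\<lambda>_. 0)"
      by (rule integral_spike[of "{q}"]) (use supp in auto)
    then show ?thesis
      using Henstock_Kurzweil_Integration.integral_combine[of 0 q x \<psi>] intg that pq by simp
  qed
  fix x
  show "((\<lambda>x. integral {0..x} \<psi>) has_real_derivative \<psi> x) (at x)"
  proof (cases "x < p")
    case True
    have "((\<lambda>x. 0) has_real_derivative \<psi> x) (at x)" using supp True by auto
    then show ?thesis
      by (rule has_field_derivative_transform_within_open[where S="{..<p}"]) (use True left in auto)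
  next
    case False
    \<comment> \<open>Here \<open>x \<ge> p > 0\<close>, so \<open>x\<close> is interior to
      \<open>{0..x+1}\<close> and the derivative is two-sided.\<close>
    have "((\<lambda>x. integral {0..x} \<psi>) has_real_derivative \<psi> x) (at x within {0..x+1})"
      by (rule integral_has_real_derivative) (use False pq in \<open>auto intro: continuous_on_subset[OF c]\<close>)
    moreover have "at x within {0..x+1} = at x"
      by (rule at_within_interior) (use False pq in auto)
    ultimately show ?thesis by simp
  qed
  show "integral {0..x} \<psi> = 0" if "x \<notin> {p..q}"
    using that left[of x] right[of x] right[of "2*pi"] zero pq by (cases "x < p") auto
qed (use pq in auto)

section \<open>Continuous cutoffs and the du Bois-Reymond lemma\<close>

definition trapezoid :: "real \<Rightarrow> real \<Rightarrow> nat \<Rightarrow> real \<Rightarrow> real" where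
  "trapezoid p q n x = max 0 (min 1 (real n * min (x - p) (q - x)))"

lemma trapezoid_continuous: "continuous_on A (trapezoid p q n)"
  unfolding trapezoid_def by (intro continuous_intros)

lemma trapezoid_range: "0 \<le> trapezoid p q n x" "trapezoid p q n x \<le> 1"
  by (auto simp: trapezoid_def)

lemma trapezoid_outside: "x \<notin> {p<..<q} \<Longrightarrow> trapezoid p q n x = 0"
proof -
  assume "x \<notin> {p<..<q}"
  then have "min (x - p) (q - x) \<le> 0" by auto
  then have "real n * min (x - p) (q - x) \<le> 0" by (intro mult_nonneg_nonpos) auto
  then show ?thesis by (simp add: trapezoid_def)
qed

lemma trapezoid_tendsto_indicator: "(\<lambda>n. trapezoid p q n x) \<longlonglongrightarrow> indicator {p<..<q} x"
proof (cases "x \<in> {p<..<q}")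
  case True
  define d where "d = min (x - p) (q - x)"
  have d: "d > 0" using True by (auto simp: d_def)
  obtain N where N: "1 < real N * d" using reals_Archimedean3[OF d] by blast
  have "\<forall>\<^sub>F n in sequentially. trapezoid p q n x = 1"
    using eventually_ge_at_top[of N]
  proof eventually_elim
    case (elim n)
    have "1 < real n * d" 
      using less_le_trans[OF N mult_right_mono[of "real N" "real n" d]] d elim by simp
    then show ?case by (simp add: trapezoid_def d_def[symmetric])
  qed
  then show ?thesis using True by (simp add: tendsto_eventually)
qed (simp add: trapezoid_outside)

text \<open>The sets over which the cut-off \<open>f\<close> of \<open>k\<close> integrates to 0
  form a Dynkin system containing the half-lines, hence all Borel sets. Lebesgue sets differ from
  Borel sets by subsets of null sets, and \<open>density_zero\<close> concludes.\<close>

lemma AE_zero_of_zero_primitive: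
  fixes k :: "real \<Rightarrow> 'a::euclidean_space"
  assumes k: "integrable mu k" and zero: "\<And>x. x \<in> {0..2*pi} \<Longrightarrow> integral {0..x} k = 0"
  shows "AE x in mu. k x = 0"
proof -
  define f where "f x = indicator {0..2*pi} x *\<^sub>R k x" for x
  have f: "integrable lebesgue f"
    unfolding f_def using k by (simp add: integrable_restrict_space)
  have ind: "integrable lebesgue (\<lambda>x. indicator A x *\<^sub>R f x)" if "A \<in> sets lebesgue" for A
    using that f by (rule integrable_mult_indicator)
  have half: "(LINT x|lebesgue. indicator {..a} x *\<^sub>R f x) = 0" for a
  proof -
    define b where "b = min a (2*pi)"
    have "(LINT x|lebesgue. indicator {..a} x *\<^sub>R f x) = (LINT x|lebesgue. indicator {0..b} x *\<^sub>R k x)"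
      by (rule Bochner_Integration.integral_cong) (auto simp: f_def b_def indicator_def)
    also have "\<dots> = 0"
    proof (cases "b \<ge> 0")
      case True
      have "k absolutely_integrable_on {0..b}"
        by (rule set_integrable_subset[of lebesgue "{0..2*pi}"])
          (use k in \<open>auto simp: integrable_mu_iff b_def\<close>)
      then have "(LINT x|lebesgue. indicator {0..b} x *\<^sub>R k x) = integral {0..b} k"
        using set_lebesgue_integral_eq_integral(2) by (simp add: set_lebesgue_integral_def)
      also have "\<dots> = 0" using True by (intro zero) (auto simp: b_def)
      finally show ?thesis .
    qed simp
    finally show ?thesis .
  qed
  \<comment> \<open>Complements in the Dynkin argument are taken in the whole line, where
    \<open>f\<close> vanishes beyond \<open>2*pi\<close>.\<close>
  have total: "(LINT x|lebesgue. f x) = 0"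
  proof -
    have "(LINT x|lebesgue. f x) = (LINT x|lebesgue. indicator {..2*pi} x *\<^sub>R f x)"
      by (rule Bochner_Integration.integral_cong) (auto simp: f_def indicator_def)
    then show ?thesis using half by simp
  qed
  have borel: "(LINT x|lebesgue. indicator A x *\<^sub>R f x) = 0" if "A \<in> sets borel" for A
  proof -
    have "Int_stable (range (\<lambda>a::real. {..a}))"
      by (rule Int_stableI) auto
    moreover have "range (\<lambda>a::real. {..a}) \<subseteq> Pow UNIV" by auto
    moreover have "A \<in> sigma_sets UNIV (range (\<lambda>a::real. {..a}))"
      using that by (simp add: borel_eq_atMost)
    ultimately show ?thesis
    proof (induction rule: sigma_sets_induct_disjoint)
      case (compl A)
      then have A: "A \<in> sets lebesgue"
        by (metis borel_eq_atMost sets_completionI_sets sets_lborel sets_measure_of subset_UNIV Pow_UNIV)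
      have "(LINT x|lebesgue. indicator (UNIV - A) x *\<^sub>R f x)
          = (LINT x|lebesgue. f x - indicator A x *\<^sub>R f x)"
        by (rule Bochner_Integration.integral_cong) (auto simp: indicator_def)
      also have "\<dots> = 0" using compl total by (subst Bochner_Integration.integral_diff[OF f ind[OF A]]) auto
      finally show ?case .
    next
      case (union A)
      have A: "A i \<in> sets lebesgue" for i
        using union.hyps(2)
        by (metis borel_eq_atMost sets_completionI_sets sets_lborel sets_measure_of subset_UNIV Pow_UNIV range_subsetD)
      have "(LINT x:(\<Union>i. A i)|lebesgue. f x) = (\<Sum>i. (LINT x:(A i)|lebesgue. f x))"
      proof (rule lebesgue_integral_countable_add)
        show "set_integrable lebesgue (\<Union>i. A i) f"
          unfolding set_integrable_def using A by (intro ind) auto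
      qed (use A union.hyps(1) in \<open>auto simp: disjoint_family_on_def\<close>)
      also have "\<dots> = 0" using union.IH by (simp add: set_lebesgue_integral_def)
      finally show ?case by (simp add: set_lebesgue_integral_def)
    qed (auto intro: half)
  qed
  have "finite_measure mu" by (rule finite_measure_lebesgue_on) auto
  then have sf: "sigma_finite_measure mu" by (rule finite_measure.axioms)
  show "AE x in mu. k x = 0"
  proof (rule sigma_finite_measure.density_zero[OF sf k])
    fix A :: "real set" assume Amu: "A \<in> sets mu"
    then have A: "A \<in> sets lebesgue" by (simp add: sets_restrict_space_iff)
    then obtain S N N' where S: "S \<in> sets lborel" and N: "N' \<in> null_sets lborel" "N \<subseteq> N'" "A = S \<union> N"
      by (rule sets_completionE)
    have "AE x in lebesgue. x \<notin> N'" using N(1) by (intro AE_completion AE_not_in)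
    then have "(LINT x|lebesgue. indicator A x *\<^sub>R f x) = (LINT x|lebesgue. indicator S x *\<^sub>R f x)"
      using N S A by (intro integral_cong_AE borel_measurable_integrable ind) (auto simp: indicator_def)
    moreover have "(LINT x:A|mu. k x) = (LINT x|lebesgue. indicator A x *\<^sub>R f x)"
      unfolding set_lebesgue_integral_def f_def
      by (subst integral_restrict_space) (auto simp: mult.commute)
    ultimately show "(LINT x:A|mu. k x) = 0"
      using borel S by simp
  qed
qed

lemma integral_trapezoid_tendsto:
  fixes u :: "real \<Rightarrow> 'a::euclidean_space"
  assumes u: "integrable mu u" and pq: "0 < p" "p \<le> q" "q < 2*pi"
  shows "(\<lambda>n. LINT x|mu. trapezoid p q n x *\<^sub>R u x) \<longlonglongrightarrow> integral {p..q} u"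
proof -
  have [measurable]: "trapezoid p q n \<in> borel_measurable mu" for n
    by (rule continuous_borel_mu[OF trapezoid_continuous])
  have [measurable]: "u \<in> borel_measurable mu" using u by auto
  have "(\<lambda>n. LINT x|mu. trapezoid p q n x *\<^sub>R u x)
      \<longlonglongrightarrow> (LINT x|mu. indicator {p<..<q} x *\<^sub>R u x)"
  proof (rule integral_dominated_convergence[where w="\<lambda>x. norm (u x)"])
    show "AE x in mu. (\<lambda>n. trapezoid p q n x *\<^sub>R u x) \<longlonglongrightarrow> indicator {p<..<q} x *\<^sub>R u x"
      by (intro AE_I2 tendsto_intros trapezoid_tendsto_indicator)
    show "AE x in mu. norm (trapezoid p q n x *\<^sub>R u x) \<le> norm (u x)" for n
      using trapezoid_range[of p q n] by (intro AE_I2) (simp add: mult_left_le_one_le)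
    show "(\<lambda>x. indicator {p<..<q} x *\<^sub>R u x) \<in> borel_measurable mu"
      by (intro borel_measurable_scaleR borel_measurable_indicator) (use pq in \<open>auto simp: sets_restrict_space_iff\<close>)
  qed (use u in auto)
  also have "(LINT x|mu. indicator {p<..<q} x *\<^sub>R u x) = integral {p..q} u"
  proof -
    have "(LINT x|mu. indicator {p<..<q} x *\<^sub>R u x) = (LINT x|lebesgue. indicator {p<..<q} x *\<^sub>R u x)"
      using pq by (subst integral_restrict_space) (auto intro!: Bochner_Integration.integral_cong simp: indicator_def)
    also have "\<dots> = integral {p<..<q} u"
    proof -
      have "u absolutely_integrable_on {p<..<q}"
        by (rule set_integrable_subset[of lebesgue "{0..2*pi}"])
          (use u pq in \<open>auto simp: integrable_mu_iff\<close>)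
      then show ?thesis
        using set_lebesgue_integral_eq_integral(2) by (simp add: set_lebesgue_integral_def)
    qed
    also have "\<dots> = integral {p..q} u" using integral_open_interval_real[of p q u] by simp
    finally show ?thesis .
  qed
  finally show ?thesis .
qed

text \<open>Du Bois-Reymond. Combinations of two cutoffs with mean zero are derivatives of test
  functions; in the limit the integral of \<open>h\<close> over \<open>[p, q]\<close> is
  proportional to \<open>q - p\<close>, so \<open>h\<close> minus the factor has a constant
  primitive.\<close>

lemma AE_const_of_zero_weak_deriv:
  fixes h :: "real \<Rightarrow> 'a::euclidean_space"
  assumes h: "integrable mu h"
    and zero: "\<And>\<phi> \<phi>'. test_fun \<phi> \<phi>' \<Longrightarrow> (LINT x|mu. \<phi>' x *\<^sub>R h x) = 0"
  obtains c where "AE x in mu. h x = c"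
proof -
  have pi: "pi > 2" using pi_gt3 by simp
  \<comment> \<open>The reference interval has length one and lies inside \<open>(0, 2*pi)\<close>,
    so \<open>c\<close> is the mean of \<open>h\<close> on it.\<close>
  define c where "c = integral {1..2} h"
  have proportional: "integral {p..q} h = (q - p) *\<^sub>R c" if pq: "0 < p" "p \<le> q" "q < 2*pi" for p q
  proof -
    define I where "I p q n = (LINT x|mu. trapezoid p q n x)" for p q n
    have I: "(\<lambda>n. I p q n) \<longlonglongrightarrow> q - p" if "0 < p" "p \<le> q" "q < 2*pi" for p q
      using integral_trapezoid_tendsto[of "\<lambda>x. 1::real" p q] that unfolding I_def
      by (simp add: continuous_integrable_mu)
    have eq: "I 1 2 n *\<^sub>R (LINT x|mu. trapezoid p q n x *\<^sub>R h x)
        = I p q n *\<^sub>R (LINT x|mu. trapezoid 1 2 n x *\<^sub>R h x)" for n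
    proof -
      \<comment> \<open>Each cutoff is weighted by the integral of the other, which makes the mean
        of \<open>\<psi>\<close> zero.\<close>
      define \<psi> where "\<psi> x = I 1 2 n * trapezoid p q n x - I p q n * trapezoid 1 2 n x" for x
      have Ti: "integrable mu (trapezoid p q n)" for p q
        by (intro continuous_integrable_mu trapezoid_continuous)
      have [measurable]: "trapezoid p q n \<in> borel_measurable mu" for p q
        by (rule continuous_borel_mu[OF trapezoid_continuous])
      have Thi: "integrable mu (\<lambda>x. trapezoid p q n x *\<^sub>R h x)" for p q
      proof (rule Bochner_Integration.integrable_bound[OF integrable_norm[OF h]])
        show "AE x in mu. norm (trapezoid p q n x *\<^sub>R h x) \<le> norm (norm (h x))"
          using trapezoid_range[of p q n] by (intro AE_I2) (simp add: mult_left_le_one_le)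
      qed (use h in measurable)
      have c: "continuous_on A \<psi>" for A
        unfolding \<psi>_def by (intro continuous_intros trapezoid_continuous)
      have out: "\<psi> x = 0" if "x \<notin> {min 1 p..max 2 q}" for x
      proof -
        have "x \<notin> {p<..<q}" "x \<notin> {1<..<2}" using that by auto
        then show ?thesis by (simp add: \<psi>_def trapezoid_outside)
      qed
      have "integral {0..2*pi} \<psi> = (LINT x|mu. \<psi> x)"
        by (rule LINT_mu[symmetric]) (intro continuous_integrable_mu c)
      also have "\<dots> = 0" unfolding \<psi>_def
        by (subst Bochner_Integration.integral_diff) (auto intro: Ti simp: I_def)
      finally have "test_fun (\<lambda>x. integral {0..x} \<psi>) \<psi>"
        by (intro test_fun_antiderivative[where p="min 1 p" and q="max 2 q"] c)
          (use pq pi out in auto)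
      then have "0 = (LINT x|mu. \<psi> x *\<^sub>R h x)" using zero by simp
      also have "\<dots> = (LINT x|mu. I 1 2 n *\<^sub>R (trapezoid p q n x *\<^sub>R h x)
          - I p q n *\<^sub>R (trapezoid 1 2 n x *\<^sub>R h x))"
        by (simp add: \<psi>_def scaleR_diff_left)
      also have "\<dots> = I 1 2 n *\<^sub>R (LINT x|mu. trapezoid p q n x *\<^sub>R h x)
          - I p q n *\<^sub>R (LINT x|mu. trapezoid 1 2 n x *\<^sub>R h x)"
        
        by (subst Bochner_Integration.integral_diff)
          (simp_all only: integral_scaleR_right integrable_scaleR_right Thi)
      finally show ?thesis by simp
    qed
    have "(\<lambda>n. I 1 2 n *\<^sub>R (LINT x|mu. trapezoid p q n x *\<^sub>R h x)) \<longlonglongrightarrow> (2 - 1) *\<^sub>R integral {p..q} h"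
      by (intro tendsto_scaleR I integral_trapezoid_tendsto h pq) (use pi in auto)
    moreover have "(\<lambda>n. I p q n *\<^sub>R (LINT x|mu. trapezoid 1 2 n x *\<^sub>R h x)) \<longlonglongrightarrow> (q - p) *\<^sub>R c"
      unfolding c_def by (intro tendsto_scaleR I integral_trapezoid_tendsto h pq) (use pi in auto)
    ultimately show ?thesis unfolding eq using LIMSEQ_unique by force
  qed
  define k where "k x = h x - c" for x
  have k: "integrable mu k" unfolding k_def by (intro Bochner_Integration.integrable_diff h continuous_integrable_mu) auto
  have kI: "k integrable_on {p..q}" if "0 \<le> p" "q \<le> 2*pi" for p q
    by (rule integrable_on_subinterval[of _ "{0..2*pi}"])
      (use k that in \<open>auto simp: integrable_mu_iff intro: set_lebesgue_integral_eq_integral(1)\<close>)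
  have cont: "continuous_on {0..2*pi} (\<lambda>x. integral {0..x} k)"
    by (intro indefinite_integral_continuous_1 kI) auto
  \<comment> \<open>\<open>proportional\<close> covers only intervals away from 0 and
    \<open>2*pi\<close>. Continuity extends the constancy to the closed interval, and the value at 0
    then identifies the constant as 0.\<close>
  have const: "integral {0..x} k = integral {0..1} k" if "x \<in> {0..2*pi}" for x
  proof (rule continuous_constant_on_closure[where S="{0<..<2*pi}"])
    show "continuous_on (closure {0<..<2*pi}) (\<lambda>x. integral {0..x} k)"
      using cont by simp
    show "x \<in> closure {0<..<2*pi}" using that by simp
    have kz: "integral {p..q} k = 0" if pq: "0 < p" "p \<le> q" "q < 2*pi" for p q
    proof -
      have "h integrable_on {p..q}"
        by (rule integrable_on_subinterval[of _ "{0..2*pi}"])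
          (use h that in \<open>auto simp: integrable_mu_iff intro: set_lebesgue_integral_eq_integral(1)\<close>)
      then show ?thesis unfolding k_def
        using proportional[OF pq] pq by (subst Henstock_Kurzweil_Integration.integral_diff) auto
    qed
    fix y :: real assume y: "y \<in> {0<..<2*pi}"
    show "integral {0..y} k = integral {0..1} k"
    proof (cases "y \<le> 1")
      case True
      then show ?thesis
        using Henstock_Kurzweil_Integration.integral_combine[of 0 y 1 k] kI[of 0 1] kz[of y 1] y pi by auto
    next
      case False
      then show ?thesis
        using Henstock_Kurzweil_Integration.integral_combine[of 0 1 y k] kI[of 0 y] kz[of 1 y] y pi by auto
    qed
  qed
  have "AE x in mu. k x = 0"
    by (rule AE_zero_of_zero_primitive[OF k]) (use const const[of 0] in auto)
  then have "AE x in mu. h x = c" by eventually_elim (simp add: k_def)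
  then show ?thesis by (rule that)
qed

text \<open>Since \<open>f\<close> and the primitive of \<open>g\<close> share their weak
  derivative, the difference is constant by \<open>AE_const_of_zero_weak_deriv\<close>.\<close>

lemma weak_deriv_imp_AE_primitive:
  fixes f g :: "real \<Rightarrow> 'a::euclidean_space"
  assumes w: "weak_deriv f g"
  obtains c where "AE x in mu. f x = c + integral {0..x} g"
proof -
  have L2: "L2 f" "L2 g" using w by (auto simp: weak_deriv_def)
  define F where "F x = integral {0..x} g" for x
  have F: "weak_deriv F g"
    using H1_imp_weak_deriv[OF H1_primitive[OF L2(2), of 0]] by (simp add: F_def[abs_def])
  then have L2F: "L2 F" by (simp add: weak_deriv_def)
  obtain c where "AE x in mu. f x - F x = c"
  proof (rule AE_const_of_zero_weak_deriv)
    show "integrable mu (\<lambda>x. f x - F x)" by (intro L2_integrable L2_diff L2 L2F)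
    fix \<phi> \<phi>' assume t: "test_fun \<phi> \<phi>'"
    have c: "continuous_on {0..2*pi} \<phi>'" using t by (auto simp: test_fun_def intro: continuous_on_subset)
    have "(LINT x|mu. \<phi>' x *\<^sub>R (f x - F x)) = (LINT x|mu. \<phi>' x *\<^sub>R f x) - (LINT x|mu. \<phi>' x *\<^sub>R F x)"
      unfolding scaleR_diff_right
      by (intro Bochner_Integration.integral_diff L2_integrable L2_multiplier c L2 L2F)
    then show "(LINT x|mu. \<phi>' x *\<^sub>R (f x - F x)) = 0"
      using w F t by (simp add: weak_deriv_def)
  qed
  then have "AE x in mu. f x = c + integral {0..x} g" by eventually_elim (auto simp: F_def algebra_simps)
  then show ?thesis by (rule that)
qed

lemma continuous_AE_eq:
  fixes f g :: "real \<Rightarrow> 'a::euclidean_space"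
  assumes c: "continuous_on {0..2*pi} f" "continuous_on {0..2*pi} g"
    and ae: "AE x in mu. f x = g x" and x: "x \<in> {0..2*pi}"
  shows "f x = g x"
proof -
  have cn: "continuous_on {0..2*pi} (\<lambda>x. norm (f x - g x))" by (intro continuous_intros c)
  have "integral {0..2*pi} (\<lambda>x. norm (f x - g x)) = integral {0..2*pi} (\<lambda>x. 0::real)"
    by (rule integral_cong_AE_mu) (use ae in auto)
  then have "norm (f x - g x) = 0"
    using integral_eq_0_iff[OF cn] x by auto
  then show ?thesis by simp
qed

lemma weak_deriv_continuous_imp_H1:
  fixes f g :: "real \<Rightarrow> 'a::euclidean_space"
  assumes w: "weak_deriv f g" and c: "continuous_on {0..2*pi} f"
  shows "H1 f g"
proof -
  have L2g: "L2 g" using w by (simp add: weak_deriv_def)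
  obtain a where a: "AE x in mu. f x = a + integral {0..x} g"
    using weak_deriv_imp_AE_primitive[OF w] .
  have eq: "f x = a + integral {0..x} g" if "x \<in> {0..2*pi}" for x
    by (rule continuous_AE_eq[OF c H1_continuous[OF H1_primitive[OF L2g]] a that])
  show ?thesis
  proof (rule H1I[OF L2g])
    fix x :: real assume "x \<in> {0..2*pi}"
    from eq[OF this] eq[of 0] show "f x = f 0 + integral {0..x} g" by simp
  qed
qed

lemma weak_deriv_unique:
  fixes f g g' :: "real \<Rightarrow> 'a::euclidean_space"
  assumes w: "weak_deriv f g" "weak_deriv f g'"
  shows "AE x in mu. g x = g' x"
proof -
  have L2: "L2 g" "L2 g'" using w by (auto simp: weak_deriv_def)
  obtain a where a: "AE x in mu. f x = a + integral {0..x} g"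
    using weak_deriv_imp_AE_primitive[OF w(1)] .
  obtain b where b: "AE x in mu. f x = b + integral {0..x} g'"
    using weak_deriv_imp_AE_primitive[OF w(2)] .
  have ae: "AE x in mu. a + integral {0..x} g = b + integral {0..x} g'"
    using a b by eventually_elim simp
  have eq: "a + integral {0..x} g = b + integral {0..x} g'" if "x \<in> {0..2*pi}" for x
    by (rule continuous_AE_eq[OF H1_continuous[OF H1_primitive[OF L2(1)]]
          H1_continuous[OF H1_primitive[OF L2(2)]] ae that])
  have "AE x in mu. g x - g' x = 0"
  proof (rule AE_zero_of_zero_primitive)
    show "integrable mu (\<lambda>x. g x - g' x)" by (intro L2_integrable L2_diff L2)
    fix x :: real assume x: "x \<in> {0..2*pi}"
    then show "integral {0..x} (\<lambda>x. g x - g' x) = 0"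
      using eq[OF x] eq[of 0] L2[THEN L2_integrable_on]
      by (subst Henstock_Kurzweil_Integration.integral_diff) auto
  qed
  then show ?thesis by eventually_elim simp
qed

text \<open>The condition of the choice in \<open>dx\<close> is satisfiable: take a continuous weak
  derivative if there is one, and \<open>g\<close> otherwise.\<close>

lemma
  fixes f g :: "real \<Rightarrow> 'a::euclidean_space"
  assumes w: "weak_deriv f g"
  shows weak_deriv_dx: "weak_deriv f (dx f)"
    and AE_dx_eq: "AE x in mu. dx f x = g x"
    and dx_continuous: "continuous_on {0..2*pi} g \<Longrightarrow> continuous_on {0..2*pi} (dx f)"
proof -
  let ?P = "\<lambda>g. weak_deriv f g \<and>
     ((\<exists>h. weak_deriv f h \<and> continuous_on {0..2*pi} h) \<longrightarrow> continuous_on {0..2*pi} g)"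
  have "\<exists>g. ?P g" using w by blast
  then have P: "?P (dx f)" unfolding dx_def by (rule someI_ex)
  then show w': "weak_deriv f (dx f)" by blast
  show "AE x in mu. dx f x = g x" by (rule weak_deriv_unique[OF w' w])
  show "continuous_on {0..2*pi} g \<Longrightarrow> continuous_on {0..2*pi} (dx f)" using P w by blast
qed

lemma dx_eq_continuous:
  fixes f g :: "real \<Rightarrow> 'a::euclidean_space"
  assumes "weak_deriv f g" "continuous_on {0..2*pi} g" "x \<in> {0..2*pi}"
  shows "dx f x = g x"
  using continuous_AE_eq[OF dx_continuous[OF assms(1,2)] assms(2) AE_dx_eq[OF assms(1)] assms(3)] .

subsection \<open>The energy in terms of primitives\<close>

text \<open>The weak derivative supplied by \<open>sobolev\<close> is a primitive only almost
  everywhere. The primitive \<open>h\<close> is its continuous representative, and \<open>dx\<close>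
  agrees with \<open>h\<close> at every point of the interval.\<close>

lemma H2_immD:
  assumes "\<gamma> \<in> H2_imm"
  obtains a where "H1 \<gamma> (dx \<gamma>)" "H1 (dx \<gamma>) a" "\<And>x. x \<in> {0..2*pi} \<Longrightarrow> dx \<gamma> x \<noteq> 0"
    "\<gamma> 0 = \<gamma> (2*pi)" "dx \<gamma> 0 = dx \<gamma> (2*pi)"
proof -
  have s: "sobolev 2 \<gamma>" and c: "continuous_on {0..2*pi} \<gamma>"
    and per: "\<And>l. l < 2 \<Longrightarrow> (dx ^^ l) \<gamma> 0 = (dx ^^ l) \<gamma> (2*pi)"
    and nz: "\<And>x. x \<in> {0..2*pi} \<Longrightarrow> dx \<gamma> x \<noteq> 0"
    using assms by (auto simp: H2_imm_def H_per_def)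
  obtain g g2 where g: "weak_deriv \<gamma> g" "weak_deriv g g2"
    using s by (auto simp: numeral_2_eq_2)
  obtain k where k: "AE x in mu. g x = k + integral {0..x} g2"
    using weak_deriv_imp_AE_primitive[OF g(2)] .
  define h where "h x = k + integral {0..x} g2" for x
  have h: "H1 h g2"
    unfolding h_def using g(2) by (intro H1_primitive) (simp add: weak_deriv_def)
  have "H1 \<gamma> h"
    by (rule H1_cong[OF weak_deriv_continuous_imp_H1[OF g(1) c]])
      (use k in \<open>auto simp: h_def[symmetric] intro: L2_continuous H1_continuous[OF h]\<close>)
  then have wh: "weak_deriv \<gamma> h" by (rule H1_imp_weak_deriv)
  have eq: "dx \<gamma> x = h x" if "x \<in> {0..2*pi}" for x
    by (rule dx_eq_continuous[OF wh H1_continuous[OF h] that])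
  show ?thesis
  proof (rule that)
    show "H1 \<gamma> (dx \<gamma>)" by (rule weak_deriv_continuous_imp_H1[OF weak_deriv_dx[OF wh] c])
    show "H1 (dx \<gamma>) g2" by (rule H1_cong[OF h eq]) (auto intro: H1_L2[OF h])
    show "\<gamma> 0 = \<gamma> (2*pi)" "dx \<gamma> 0 = dx \<gamma> (2*pi)" using per[of 0] per[of 1] by auto
  qed (rule nz)
qed

lemma H1_dx_eq:
  assumes "H1 \<gamma> v" "continuous_on {0..2*pi} v" "x \<in> {0..2*pi}"
  shows "dx \<gamma> x = v x"
  by (rule dx_eq_continuous[OF H1_imp_weak_deriv[OF assms(1)] assms(2,3)])

lemma H2_immI:
  assumes "H1 \<gamma> v" "H1 v a" "\<And>x. x \<in> {0..2*pi} \<Longrightarrow> v x \<noteq> 0"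
    "\<gamma> 0 = \<gamma> (2*pi)" "v 0 = v (2*pi)"
  shows "\<gamma> \<in> H2_imm"
proof -
  have dx: "dx \<gamma> x = v x" if "x \<in> {0..2*pi}" for x
    by (rule H1_dx_eq[OF assms(1) H1_continuous[OF assms(2)] that])
  have "sobolev 2 \<gamma>"
    using H1_imp_weak_deriv[OF assms(1)] H1_imp_weak_deriv[OF assms(2)] H1_L2[OF assms(2)]
    by (auto simp: numeral_2_eq_2)
  moreover have "(dx ^^ l) \<gamma> 0 = (dx ^^ l) \<gamma> (2*pi)" if "l < 2" for l
    using that assms(4,5) dx[of 0] dx[of "2*pi"] by (auto simp: less_2_cases_iff)
  ultimately show ?thesis
    using H1_continuous[OF assms(1)] assms(3) dx by (auto simp: H2_imm_def H_per_def)
qed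

lemma H_per_1_iff: "\<eta> \<in> H_per 1 \<longleftrightarrow> (\<exists>b. H1 \<eta> b) \<and> \<eta> 0 = \<eta> (2*pi)"
  unfolding H_per_def
  using weak_deriv_continuous_imp_H1[of \<eta>] H1_imp_weak_deriv[of \<eta>] H1_continuous[of \<eta>]
  by (auto intro: H1_L2)

section \<open>The rotation \<open>J\<close> and orthogonality in the plane\<close>

lemma inner_real2: "x \<bullet> y = x $ 1 * y $ 1 + x $ 2 * y $ 2" for x y :: "real^2"
  by (simp add: inner_vec_def sum_2)

lemma J_nth: "J v $ 1 = - (v $ 2)" "J v $ 2 = v $ 1"
  by (simp_all add: J_def)

lemma bounded_linear_J: "bounded_linear J"
proof -
  have "linear J"
    by (rule linearI) (simp_all add: vec_eq_iff forall_2 J_nth)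
  then show ?thesis by (simp add: linear_conv_bounded_linear)
qed

lemma J_scaleR: "J (c *\<^sub>R v) = c *\<^sub>R J v"
  by (simp add: vec_eq_iff forall_2 J_nth)

lemma norm_J: "norm (J v) = norm v"
  by (simp add: norm_eq_sqrt_inner inner_real2 J_nth)

text \<open>For \<open>v \<noteq> 0\<close> the orthogonal complement of \<open>v\<close> is spanned
  by \<open>J v\<close>. This yields the existence of the curvature, and later bounds
  \<open>\<gamma>''\<close> by its normal component.\<close>

lemma orthogonal_in_plane:
  assumes "a \<bullet> v = 0"
  shows "(norm v)\<^sup>2 *\<^sub>R a = (a \<bullet> J v) *\<^sub>R J v"
proof -
  have o: "a$1 * v$1 = - (a$2 * v$2)" using assms by (simp add: inner_real2)
  have "(v$1 * v$1 + v$2 * v$2) * a$1 = (- a$1 * v$2 + a$2 * v$1) * (- v$2)"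
    using o by algebra
  moreover have "(v$1 * v$1 + v$2 * v$2) * a$2 = (- a$1 * v$2 + a$2 * v$1) * v$1"
    using o by algebra
  ultimately show ?thesis
    by (simp add: vec_eq_iff forall_2 J_nth power2_norm_eq_inner inner_real2)
qed

text \<open>The product rule for \<open>f x \<bullet> f x\<close> and the constancy of this function
  give two weak derivatives, which agree almost everywhere.\<close>

lemma H1_constant_norm_orthogonal:
  assumes f: "H1 f g" and n: "\<And>x. x \<in> {0..2*pi} \<Longrightarrow> norm (f x) = c"
  shows "AE x in mu. g x \<bullet> f x = 0"
proof -
  have 1: "H1 (\<lambda>x. f x \<bullet> f x) (\<lambda>x. f x \<bullet> g x + g x \<bullet> f x)"
    by (rule H1_bilinear[OF f f bounded_bilinear_inner])
  have "H1 (\<lambda>x. c\<^sup>2) (\<lambda>x. 0)"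
    by (rule H1I) (auto intro: L2_const)
  then have 2: "H1 (\<lambda>x. f x \<bullet> f x) (\<lambda>x. 0)"
    by (rule H1_cong) (auto simp: n L2_const simp flip: power2_norm_eq_inner)
  have "AE x in mu. f x \<bullet> g x + g x \<bullet> f x = 0"
    by (rule weak_deriv_unique[OF H1_imp_weak_deriv[OF 1] H1_imp_weak_deriv[OF 2]])
  then show ?thesis by eventually_elim (simp add: inner_commute)
qed

text \<open>Completeness of Lebesgue measure. It makes integrals of \<open>curvature\<close>
  accessible: that choice is fixed only almost everywhere and carries no measurability of its
  own.\<close>

lemma borel_measurable_AE_mu:
  fixes f g :: "real \<Rightarrow> 'a::euclidean_space"
  assumes g: "g \<in> borel_measurable mu" and ae: "AE x in mu. f x = g x"
  shows "f \<in> borel_measurable mu"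
proof -
  have "(\<lambda>x. if x \<in> {0..2*pi} then g x else 0) \<in> borel_measurable lebesgue"
    using g by (simp add: borel_measurable_if del: atLeastAtMost_iff)
  moreover have "AE x in lebesgue. x \<in> {0..2*pi} \<longrightarrow> f x = g x"
    using ae by (simp add: AE_restrict_space_iff)
  then have "AE x in lebesgue. (if x \<in> {0..2*pi} then g x else 0) = (if x \<in> {0..2*pi} then f x else 0)"
    by eventually_elim auto
  ultimately have "(\<lambda>x. if x \<in> {0..2*pi} then f x else 0) \<in> borel_measurable lebesgue"
    by (rule borel_measurable_AE)
  then show ?thesis by (simp add: borel_measurable_if del: atLeastAtMost_iff)
qed

lemma LINT_cong_AE_mu:
  fixes f g :: "real \<Rightarrow> 'a::euclidean_space"
  assumes "g \<in> borel_measurable mu" "AE x in mu. f x = g x"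
  shows "(LINT x|mu. f x) = (LINT x|mu. g x)"
  by (intro integral_cong_AE borel_measurable_AE_mu[OF assms] assms)

text \<open>With the unit tangent as \<open>y\<close>, the Frobenius norm of
  \<open>curve_grad\<close> reduces to the norm of \<open>ds \<gamma> \<eta>\<close>.\<close>

lemma norm_outer_product: "(norm (\<chi> i j. x $ i * y $ j :: real^2^2))\<^sup>2 = (norm x)\<^sup>2 * (norm y)\<^sup>2"
  for x y :: "real^2"
  unfolding power2_norm_eq_inner inner_vec_def sum_2 by (simp add: algebra_simps)

text \<open>Replaces the choices in \<open>dx\<close> and \<open>curvature\<close> by explicit
  representatives. As \<tau> has norm 1, its derivative \<open>t\<close> is normal, so the curvature
  equation is solvable, and pairing it with the normal determines the solution almost
  everywhere.\<close>

lemma energy_formula: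
  assumes \<gamma>: "H1 \<gamma> v" "continuous_on {0..2*pi} v" "\<And>x. x \<in> {0..2*pi} \<Longrightarrow> v x \<noteq> 0"
    and \<tau>: "H1 \<tau> t" "\<And>x. x \<in> {0..2*pi} \<Longrightarrow> \<tau> x = inverse (norm (v x)) *\<^sub>R v x"
    and \<eta>: "H1 \<eta> b"
  shows "energy \<delta> lam \<gamma> \<eta> =
      1/2 * (LINT x|mu. (t x \<bullet> J (\<tau> x) / norm (v x) + \<delta> * (b x \<bullet> \<tau> x) / norm (v x))\<^sup>2 * norm (v x))
      + lam/2 * (LINT x|mu. (norm (b x))\<^sup>2 / norm (v x))"
proof -
  note dx = H1_dx_eq[OF \<gamma>(1,2)]
  have tan: "tangent \<gamma> x = \<tau> x" if "x \<in> {0..2*pi}" for x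
    using that by (simp add: tangent_def ds_def dx \<tau>)
  have nt: "norm (\<tau> x) = 1" if "x \<in> {0..2*pi}" for x
    using that by (simp add: \<tau>(2) \<gamma>(3))
  have "H1 (tangent \<gamma>) t"
    by (rule H1_cong[OF \<tau>(1)]) (auto simp: tan intro: H1_L2[OF \<tau>(1)])
  then have dt: "AE x in mu. dx (tangent \<gamma>) x = t x"
    by (intro AE_dx_eq H1_imp_weak_deriv)
  have db: "AE x in mu. dx \<eta> x = b x"
    by (intro AE_dx_eq H1_imp_weak_deriv \<eta>)
  have orth: "AE x in mu. t x \<bullet> \<tau> x = 0"
    by (rule H1_constant_norm_orthogonal[OF \<tau>(1) nt])
  let ?k = "\<lambda>x. t x \<bullet> J (\<tau> x) / norm (v x)"
  have "AE x in mu. ds \<gamma> (tangent \<gamma>) x = ?k x *\<^sub>R normal \<gamma> x"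
    using dt orth AE_mu_space
  proof eventually_elim
    case (elim x)
    then show ?case
      using orthogonal_in_plane[of "t x" "\<tau> x"] nt
      by (simp add: ds_def dx normal_def tan divide_inverse mult.commute flip: scaleR_scaleR)
  qed
  then have "AE x in mu. ds \<gamma> (tangent \<gamma>) x = curvature \<gamma> x *\<^sub>R normal \<gamma> x"
    
    unfolding curvature_def
    by (rule someI[where P="\<lambda>\<kappa>. AE x in mu. ds \<gamma> (tangent \<gamma>) x = \<kappa> x *\<^sub>R normal \<gamma> x"])
  then have k: "AE x in mu. curvature \<gamma> x = ?k x"
    using dt AE_mu_space
  proof eventually_elim
    case (elim x)
    have "J (\<tau> x) \<bullet> J (\<tau> x) = 1" using nt[of x] elim by (simp add: dot_square_norm norm_J)
    moreover have "normal \<gamma> x = J (\<tau> x)" using elim by (simp add: normal_def tan)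
    ultimately have "curvature \<gamma> x = ds \<gamma> (tangent \<gamma>) x \<bullet> J (\<tau> x)"
      using elim(1) by simp
    also have "\<dots> = ?k x" using elim(2,3) by (simp add: ds_def dx divide_inverse)
    finally show ?case .
  qed
  have [measurable]: "t \<in> borel_measurable mu" "b \<in> borel_measurable mu"
    "v \<in> borel_measurable mu" "\<tau> \<in> borel_measurable mu" "(\<lambda>x. J (\<tau> x)) \<in> borel_measurable mu"
    using H1_L2[OF \<tau>(1)] H1_L2[OF \<eta>]
    by (auto simp: L2_def intro!: continuous_borel_mu \<gamma> H1_continuous[OF \<tau>(1)]
        bounded_linear.continuous_on[OF bounded_linear_J])
  have "curve_integral \<gamma> (\<lambda>x. (curvature \<gamma> x + \<delta> * curve_div \<gamma> \<eta> x)\<^sup>2)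
      = (LINT x|mu. (?k x + \<delta> * (b x \<bullet> \<tau> x) / norm (v x))\<^sup>2 * norm (v x))"
    unfolding curve_integral_def
  proof (rule LINT_cong_AE_mu)
    show "AE x in mu. (curvature \<gamma> x + \<delta> * curve_div \<gamma> \<eta> x)\<^sup>2 * norm (dx \<gamma> x)
        = (?k x + \<delta> * (b x \<bullet> \<tau> x) / norm (v x))\<^sup>2 * norm (v x)"
      using k db AE_mu_space
      by eventually_elim (simp add: curve_div_def ds_def dx tan divide_inverse mult_ac)
  qed measurable
  moreover have "curve_integral \<gamma> (\<lambda>x. (norm (curve_grad \<gamma> \<eta> x))\<^sup>2)
      = (LINT x|mu. (norm (b x))\<^sup>2 / norm (v x))"
    unfolding curve_integral_def
  proof (rule LINT_cong_AE_mu)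
    show "AE x in mu. (norm (curve_grad \<gamma> \<eta> x))\<^sup>2 * norm (dx \<gamma> x) = (norm (b x))\<^sup>2 / norm (v x)"
      using db AE_mu_space
    proof eventually_elim
      case (elim x)
      have "(norm (curve_grad \<gamma> \<eta> x))\<^sup>2 = (norm (inverse (norm (v x)) *\<^sub>R b x))\<^sup>2"
        unfolding curve_grad_def norm_outer_product using elim nt by (simp add: ds_def dx tan)
      then show ?case using elim \<gamma>(3)[of x] by (simp add: dx power2_eq_square field_simps)
    qed
  qed measurable
  ultimately show ?thesis by (simp add: energy_def)
qed

subsection \<open>Reparametrization\<close>

text \<open>\<open>\<rho>\<close> is the inverse of the primitive of \<open>p\<close>, described by
  the properties that substitution uses.\<close>

locale reparametrization =
  fixes p \<rho> :: "real \<Rightarrow> real"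
  assumes p_cont: "continuous_on {0..2*pi} p" and p_pos: "\<And>x. x \<in> {0..2*pi} \<Longrightarrow> p x > 0"
    and \<rho>_image: "\<And>y. y \<in> {0..2*pi} \<Longrightarrow> \<rho> ` {0..y} = {0..\<rho> y}"
    and \<rho>_inj: "inj_on \<rho> {0..2*pi}"
    and \<rho>_ends: "\<rho> 0 = 0" "\<rho> (2*pi) = 2*pi"
    and \<rho>_deriv: "\<And>y. y \<in> {0..2*pi} \<Longrightarrow>
      (\<rho> has_field_derivative inverse (p (\<rho> y))) (at y within {0..2*pi})"

text \<open>The primitive \<open>\<sigma>\<close> increases strictly and, by \<open>total\<close>,
  maps the interval onto itself. At the end points the derivative of its inverse is one-sided, hence
  taken within the interval.\<close>

lemma reparametrization_exists:
  assumes p: "continuous_on {0..2*pi} p" "\<And>x. x \<in> {0..2*pi} \<Longrightarrow> p x > 0"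
    and total: "integral {0..2*pi} p = 2*pi"
  obtains \<rho> where "reparametrization p \<rho>"
proof -
  define \<sigma> where "\<sigma> x = integral {0..x} p" for x
  have der: "(\<sigma> has_field_derivative p x) (at x within {0..2*pi})" if "x \<in> {0..2*pi}" for x
    unfolding \<sigma>_def by (rule integral_has_real_derivative[OF p(1) that])
  have cont: "continuous_on {0..2*pi} \<sigma>"
    using der by (meson DERIV_continuous_on)
  have mono: "\<sigma> x < \<sigma> y" if xy: "0 \<le> x" "x < y" "y \<le> 2*pi" for x y
  proof -
    have L: "L2 p" by (rule L2_continuous[OF p(1)])
    have c: "continuous_on {x..y} p" by (rule continuous_on_subset[OF p(1)]) (use xy in auto)
    have "\<sigma> y - \<sigma> x = integral {x..y} p"
      unfolding \<sigma>_def using integral_split[OF L, of x y] xy by simp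
    moreover have "integral {x..y} p \<ge> 0"
      by (rule Henstock_Kurzweil_Integration.integral_nonneg)
        (use c xy p(2) in \<open>auto intro: integrable_continuous_real less_imp_le\<close>)
    moreover have "integral {x..y} p \<noteq> 0"
    proof
      assume "integral {x..y} p = 0"
      moreover have "p z \<ge> 0" if "z \<in> {x..y}" for z using p(2)[of z] that xy by auto
      ultimately have "\<forall>z\<in>{x..y}. p z = 0" using integral_eq_0_iff[OF c xy(2)] by auto
      then show False using p(2)[of x] xy by auto
    qed
    ultimately show ?thesis by simp
  qed
  have \<sigma>0: "\<sigma> 0 = 0" and \<sigma>1: "\<sigma> (2*pi) = 2*pi" using total by (simp_all add: \<sigma>_def)
  have mono_le: "\<sigma> x \<le> \<sigma> y" if "0 \<le> x" "x \<le> y" "y \<le> 2*pi" for x y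
    using mono[of x y] that by (cases "x = y") auto
  have inj: "inj_on \<sigma> {0..2*pi}"
    by (rule linorder_inj_onI) (use mono in \<open>force+\<close>)
  have img: "\<sigma> ` {0..x} = {0..\<sigma> x}" if "x \<in> {0..2*pi}" for x
  proof
    show "\<sigma> ` {0..x} \<subseteq> {0..\<sigma> x}" using mono_le[of 0] mono_le[of _ x] \<sigma>0 that by auto
    show "{0..\<sigma> x} \<subseteq> \<sigma> ` {0..x}"
    proof
      fix y assume "y \<in> {0..\<sigma> x}"
      then have "\<exists>z\<ge>0. z \<le> x \<and> \<sigma> z = y"
        by (intro IVT' continuous_on_subset[OF cont]) (use that \<sigma>0 in auto)
      then show "y \<in> \<sigma> ` {0..x}" by auto
    qed
  qed
  define \<rho> where "\<rho> = inv_into {0..2*pi} \<sigma>"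
  have \<rho>\<sigma>: "\<rho> (\<sigma> x) = x" if "x \<in> {0..2*pi}" for x
    unfolding \<rho>_def by (rule inv_into_f_f[OF inj that])
  have full: "\<sigma> ` {0..2*pi} = {0..2*pi}" using img[of "2*pi"] \<sigma>1 by simp
  have \<sigma>\<rho>: "\<sigma> (\<rho> y) = y" and \<rho>_in: "\<rho> y \<in> {0..2*pi}" if "y \<in> {0..2*pi}" for y
    using that f_inv_into_f[of y \<sigma> "{0..2*pi}"] inv_into_into[of y \<sigma> "{0..2*pi}"]
    by (auto simp: \<rho>_def full)
  have c\<rho>: "continuous_on {0..2*pi} \<rho>"
    using continuous_on_inv[OF cont, of \<rho>] \<rho>\<sigma> full by simp
  have "reparametrization p \<rho>"
  proof
    fix y :: real assume y: "y \<in> {0..2*pi}"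
    have "{0..y} = \<sigma> ` {0..\<rho> y}" using img[OF \<rho>_in[OF y]] \<sigma>\<rho>[OF y] by simp
    then have "\<rho> ` {0..y} = (\<lambda>x. \<rho> (\<sigma> x)) ` {0..\<rho> y}" by (simp add: image_image)
    also have "\<dots> = (\<lambda>x. x) ` {0..\<rho> y}"
      by (rule image_cong) (use \<rho>_in[OF y] \<rho>\<sigma> in auto)
    finally show "\<rho> ` {0..y} = {0..\<rho> y}" by simp
    have nz: "p (\<rho> y) \<noteq> 0" using p(2)[OF \<rho>_in[OF y]] by simp
    have "(\<rho> has_derivative (*) (inverse (p (\<rho> y)))) (at (\<sigma> (\<rho> y)) within \<sigma> ` {0..2*pi})"
    proof (rule has_derivative_inverse_within)
      show "(\<sigma> has_derivative (*) (p (\<rho> y))) (at (\<rho> y) within {0..2*pi})"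
        using der[OF \<rho>_in[OF y]] by (simp add: has_field_derivative_def)
      show "continuous (at (\<sigma> (\<rho> y)) within \<sigma> ` {0..2*pi}) \<rho>"
        using c\<rho> y \<sigma>\<rho>[OF y] full by (simp add: continuous_on_eq_continuous_within)
      show "linear ((*) (inverse (p (\<rho> y))))" by (intro bounded_linear.linear bounded_linear_mult_right)
      show "(*) (inverse (p (\<rho> y))) \<circ> (*) (p (\<rho> y)) = id" using nz by (auto simp: fun_eq_iff)
    qed (use \<rho>_in[OF y] \<rho>\<sigma> in auto)
    then show "(\<rho> has_field_derivative inverse (p (\<rho> y))) (at y within {0..2*pi})"
      using \<sigma>\<rho>[OF y] full by (simp add: has_field_derivative_def)
  next
    show "inj_on \<rho> {0..2*pi}" unfolding \<rho>_def
      using inj_on_inv_into[of "{0..2*pi}" \<sigma> "{0..2*pi}"] full by simp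
    show "\<rho> 0 = 0" "\<rho> (2*pi) = 2*pi" using \<rho>\<sigma>[of 0] \<rho>\<sigma>[of "2*pi"] \<sigma>0 \<sigma>1 by auto
  qed (use p in auto)
  then show ?thesis by (rule that)
qed

context reparametrization
begin

definition speed :: "real \<Rightarrow> real" where "speed y = inverse (p (\<rho> y))"

lemma \<rho>_in: "y \<in> {0..2*pi} \<Longrightarrow> \<rho> y \<in> {0..2*pi}"
  using \<rho>_image[of "2*pi"] \<rho>_ends by auto

lemma speed_pos: "y \<in> {0..2*pi} \<Longrightarrow> speed y > 0"
  using p_pos \<rho>_in by (simp add: speed_def)

lemma change_of_variables:
  fixes f :: "real \<Rightarrow> 'a::euclidean_space"
  assumes f: "f absolutely_integrable_on {0..2*pi}" and y: "y \<in> {0..2*pi}"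
  shows "(\<lambda>s. speed s *\<^sub>R f (\<rho> s)) absolutely_integrable_on {0..y}"
    "integral {0..y} (\<lambda>s. speed s *\<^sub>R f (\<rho> s)) = integral {0..\<rho> y} f"
proof -
  have sub: "{0..y} \<subseteq> {0..2*pi}" using y by auto
  have "f absolutely_integrable_on \<rho> ` {0..y}"
    by (rule set_integrable_subset[OF f]) (use \<rho>_image[OF y] \<rho>_in[OF y] in auto)
  then have "f absolutely_integrable_on \<rho> ` {0..y} \<and> integral (\<rho> ` {0..y}) f = integral {0..\<rho> y} f"
    by (simp add: \<rho>_image[OF y])
  then have *: "(\<lambda>s. \<bar>speed s\<bar> *\<^sub>R f (\<rho> s)) absolutely_integrable_on {0..y} \<and>
      integral {0..y} (\<lambda>s. \<bar>speed s\<bar> *\<^sub>R f (\<rho> s)) = integral {0..\<rho> y} f"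
  proof (subst has_absolute_integral_change_of_variables_real)
    show "(\<rho> has_field_derivative speed x) (at x within {0..y})" if "x \<in> {0..y}" for x
      unfolding speed_def using \<rho>_deriv[of x] sub that by (auto intro: DERIV_subset)
  qed (use inj_on_subset[OF \<rho>_inj sub] in auto)
  have eq: "\<bar>speed s\<bar> *\<^sub>R f (\<rho> s) = speed s *\<^sub>R f (\<rho> s)" if "s \<in> {0..y}" for s
    using speed_pos[of s] that sub by auto
  show "(\<lambda>s. speed s *\<^sub>R f (\<rho> s)) absolutely_integrable_on {0..y}"
    using conjunct1[OF *]
    by (rule set_integrable_cong[OF refl refl, THEN iffD1, rotated]) (rule eq)
  show "integral {0..y} (\<lambda>s. speed s *\<^sub>R f (\<rho> s)) = integral {0..\<rho> y} f"
    using * Henstock_Kurzweil_Integration.integral_cong[of "{0..y}", OF eq] by auto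
qed

lemma LINT_change_of_variables:
  fixes f :: "real \<Rightarrow> 'a::euclidean_space"
  assumes f: "integrable mu f"
  shows "integrable mu (\<lambda>s. speed s *\<^sub>R f (\<rho> s))"
    "(LINT s|mu. speed s *\<^sub>R f (\<rho> s)) = (LINT x|mu. f x)"
proof -
  note cv = change_of_variables[OF f[unfolded integrable_mu_iff], of "2*pi"]
  show i: "integrable mu (\<lambda>s. speed s *\<^sub>R f (\<rho> s))"
    unfolding integrable_mu_iff using cv(1) by simp
  show "(LINT s|mu. speed s *\<^sub>R f (\<rho> s)) = (LINT x|mu. f x)"
    using cv(2) \<rho>_ends by (simp add: LINT_mu[OF i] LINT_mu[OF f])
qed

text \<open>Of the two factors \<open>speed\<close> in the square one is consumed by the
  substitution; the other is the reciprocal of \<open>p\<close> composed with \<open>\<rho>\<close>,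
  bounded because \<open>p\<close> is continuous and positive.\<close>

lemma L2_reparametrize:
  fixes f :: "real \<Rightarrow> 'a::euclidean_space"
  assumes f: "L2 f"
  shows "L2 (\<lambda>s. speed s *\<^sub>R f (\<rho> s))"
  unfolding L2_def
proof
  show "(\<lambda>s. speed s *\<^sub>R f (\<rho> s)) \<in> borel_measurable mu"
    using LINT_change_of_variables(1)[OF L2_integrable[OF f]] by auto
  have nz: "\<And>x. x \<in> {0..2*pi} \<Longrightarrow> p x \<noteq> 0" using p_pos by force
  have "continuous_on {0..2*pi} (\<lambda>x. inverse (p x))"
    by (intro continuous_intros p_cont) (use nz in auto)
  then have "integrable mu (\<lambda>x. f x \<bullet> (inverse (p x) *\<^sub>R f x))"
    by (intro L2_inner_integrable L2_multiplier f)
  from LINT_change_of_variables(1)[OF this]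
  show "integrable mu (\<lambda>s. (norm (speed s *\<^sub>R f (\<rho> s)))\<^sup>2)"
    unfolding power2_norm_eq_inner by (simp add: speed_def)
qed

lemma H1_reparametrize:
  assumes f: "H1 f g"
  shows "H1 (\<lambda>y. f (\<rho> y)) (\<lambda>y. speed y *\<^sub>R g (\<rho> y))"
proof (rule H1I)
  show "L2 (\<lambda>y. speed y *\<^sub>R g (\<rho> y))" by (intro L2_reparametrize H1_L2[OF f])
  fix y :: real assume y: "y \<in> {0..2*pi}"
  show "f (\<rho> y) = f (\<rho> 0) + integral {0..y} (\<lambda>y. speed y *\<^sub>R g (\<rho> y))"
    using H1_eq[OF f \<rho>_in[OF y]] change_of_variables(2)[OF L2_absolutely_integrable[OF H1_L2[OF f]] y]
    by (simp add: \<rho>_ends)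
qed

end

subsection \<open>Constant speed\<close>

text \<open>For constant speed \<open>c\<close>, \<open>v = \<gamma>'\<close> and
  \<open>w = (\<gamma>'', \<eta>')\<close>, the curvature is
  \<open>\<gamma>'' \<bullet> J \<gamma>' / c^3\<close>, the divergence is
  \<open>\<eta>' \<bullet> \<gamma>' / c^2\<close>, and the gradient has norm
  \<open>|\<eta>'| / c\<close>. With the length element \<open>c dx\<close> and the factors
  \<open>1/2\<close> and \<open>lam/2\<close>, the squared norm is the energy density.\<close>

definition energy_map :: "real \<Rightarrow> real \<Rightarrow> real \<Rightarrow> real^2 \<Rightarrow> (real^2) \<times> (real^2) \<Rightarrow> real \<times> (real^2)" where
  "energy_map \<delta> lam c v w =
    (sqrt (c/2) * (fst w \<bullet> J v / c^3 + \<delta> * (snd w \<bullet> v) / c\<^sup>2), sqrt (lam/(2*c)) *\<^sub>R snd w)"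

definition reduced_energy ::
  "real \<Rightarrow> real \<Rightarrow> real \<Rightarrow> (real \<Rightarrow> (real^2) \<times> (real^2)) \<Rightarrow> (real \<Rightarrow> (real^2) \<times> (real^2)) \<Rightarrow> real" where
  "reduced_energy \<delta> lam c u w = (LINT x|mu. (norm (energy_map \<delta> lam c (fst (u x)) (w x)))\<^sup>2)"

text \<open>Pairs \<open>u = (\<gamma>', \<eta>)\<close>, \<open>w = u'\<close> for curves \<open>\<gamma>\<close> of constant speed \<open>c\<close> starting at the origin.\<close>

definition reduced :: "real \<Rightarrow> real \<Rightarrow> ((real \<Rightarrow> (real^2) \<times> (real^2)) \<times> (real \<Rightarrow> (real^2) \<times> (real^2))) set" where
  "reduced c A0 = {(u, w). H1 u w \<and>
     (\<forall>x\<in>{0..2*pi}. norm (fst (u x)) = c \<and> norm (snd (u x)) = 1) \<and> u 0 = u (2*pi) \<and>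
     integral {0..2*pi} (\<lambda>x. fst (u x)) = 0 \<and>
     - (1/2) * integral {0..2*pi} (\<lambda>x. integral {0..x} (\<lambda>s. fst (u s)) \<bullet> J (fst (u x))) = A0}"

lemma linear_energy_map: "linear (energy_map \<delta> lam c v)"
  by (rule linearI)
    (simp_all add: energy_map_def inner_add_left scaleR_add_right algebra_simps add_divide_distrib)

lemma energy_map_continuous:
  "continuous_on A v \<Longrightarrow> c \<noteq> 0 \<Longrightarrow> continuous_on A (\<lambda>x. energy_map \<delta> lam c (v x) h)"
  unfolding energy_map_def
  by (intro continuous_intros bounded_linear.continuous_on[OF bounded_linear_J]) auto

lemma norm_energy_map:
  assumes "c > 0" "lam \<ge> 0"
  shows "(norm (energy_map \<delta> lam c v w))\<^sup>2
    = c/2 * (fst w \<bullet> J v / c^3 + \<delta> * (snd w \<bullet> v) / c\<^sup>2)\<^sup>2 + lam/(2*c) * (norm (snd w))\<^sup>2"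
  using assms by (simp add: energy_map_def norm_Pair power_mult_distrib)

lemma L2_energy_map:
  assumes "continuous_on {0..2*pi} v" "c \<noteq> 0" "L2 w"
  shows "L2 (\<lambda>x. energy_map \<delta> lam c (v x) (w x))"
  by (rule L2_linear_image[OF linear_energy_map energy_map_continuous assms(3)]) (use assms in auto)

lemma L2_bounded_linear:
  fixes A :: "'a::euclidean_space \<Rightarrow> 'b::euclidean_space"
  shows "bounded_linear A \<Longrightarrow> L2 f \<Longrightarrow> L2 (\<lambda>x. A (f x))"
  by (rule L2_linear_image) (auto intro: bounded_linear.linear)

text \<open>The curve is recovered as the primitive of its velocity: the vanishing total integral
  closes it, and the periodicity of \<open>u\<close> closes its tangent.\<close>

lemma reduced_imp_admissible:
  assumes red: "(u, w) \<in> reduced c A0" and c: "c > 0" and lam: "lam > 0"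
  defines "\<gamma> \<equiv> \<lambda>x. integral {0..x} (\<lambda>s. fst (u s))" and "\<eta> \<equiv> \<lambda>x. snd (u x)"
  shows "(\<gamma>, \<eta>) \<in> admissible (2*pi*c) A0" "energy \<delta> lam \<gamma> \<eta> = reduced_energy \<delta> lam c u w"
proof -
  have u: "H1 u w" and nv: "\<And>x. x \<in> {0..2*pi} \<Longrightarrow> norm (fst (u x)) = c"
    and n\<eta>: "\<And>x. x \<in> {0..2*pi} \<Longrightarrow> norm (snd (u x)) = 1"
    and per: "u 0 = u (2*pi)" and closed: "integral {0..2*pi} (\<lambda>x. fst (u x)) = 0"
    and area: "- (1/2) * integral {0..2*pi} (\<lambda>x. \<gamma> x \<bullet> J (fst (u x))) = A0"
    using red by (auto simp: reduced_def \<gamma>_def)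
  have v: "H1 (\<lambda>x. fst (u x)) (\<lambda>x. fst (w x))" by (rule H1_bounded_linear[OF u bounded_linear_fst])
  have \<eta>: "H1 \<eta> (\<lambda>x. snd (w x))" unfolding \<eta>_def by (rule H1_bounded_linear[OF u bounded_linear_snd])
  have vc: "continuous_on {0..2*pi} (\<lambda>x. fst (u x))" by (rule H1_continuous[OF v])
  have \<gamma>: "H1 \<gamma> (\<lambda>x. fst (u x))"
    using H1_primitive[OF L2_continuous[OF vc], of 0] by (simp add: \<gamma>_def)
  have nz: "fst (u x) \<noteq> 0" if "x \<in> {0..2*pi}" for x using nv[OF that] c by auto
  note dx = H1_dx_eq[OF \<gamma> vc]
  have "\<gamma> \<in> H2_imm"
    by (rule H2_immI[OF \<gamma> v nz]) (auto simp: \<gamma>_def closed per)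
  moreover have "\<eta> \<in> H_per 1" unfolding H_per_1_iff using \<eta> per by (auto simp: \<eta>_def)
  moreover have "curve_length \<gamma> = 2*pi*c"
  proof -
    have "curve_length \<gamma> = (LINT x|mu. c)"
      unfolding curve_length_def curve_integral_def
      by (rule Bochner_Integration.integral_cong) (auto simp: dx nv)
    also have "\<dots> = integral {0..2*pi} (\<lambda>x. c)"
      by (rule LINT_mu) (intro continuous_integrable_mu continuous_intros)
    finally show ?thesis by simp
  qed
  moreover have "signed_area \<gamma> = A0"
  proof -
    have "(LINT x|mu. \<gamma> x \<bullet> J (dx \<gamma> x)) = (LINT x|mu. \<gamma> x \<bullet> J (fst (u x)))"
      by (rule Bochner_Integration.integral_cong) (auto simp: dx)
    also have "\<dots> = integral {0..2*pi} (\<lambda>x. \<gamma> x \<bullet> J (fst (u x)))"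
      by (rule LINT_mu)
        (intro continuous_integrable_mu continuous_intros H1_continuous[OF \<gamma>] vc
          bounded_linear.continuous_on[OF bounded_linear_J])
    finally show ?thesis using area by (simp add: signed_area_def)
  qed
  ultimately show "(\<gamma>, \<eta>) \<in> admissible (2*pi*c) A0"
    using n\<eta> by (auto simp: admissible_def S_def \<eta>_def)
  have \<tau>: "H1 (\<lambda>x. inverse c *\<^sub>R fst (u x)) (\<lambda>x. inverse c *\<^sub>R fst (w x))"
    by (rule H1_bounded_linear[OF v bounded_linear_scaleR_right])
  let ?T = "\<lambda>x. energy_map \<delta> lam c (fst (u x)) (w x)"
  have T: "L2 ?T" using c by (intro L2_energy_map vc H1_L2[OF u]) auto
  have "energy \<delta> lam \<gamma> \<eta> =
      1/2 * (LINT x|mu. ((inverse c *\<^sub>R fst (w x)) \<bullet> J (inverse c *\<^sub>R fst (u x)) / norm (fst (u x))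
        + \<delta> * (snd (w x) \<bullet> (inverse c *\<^sub>R fst (u x))) / norm (fst (u x)))\<^sup>2 * norm (fst (u x)))
      + lam/2 * (LINT x|mu. (norm (snd (w x)))\<^sup>2 / norm (fst (u x)))"
    by (rule energy_formula[OF \<gamma> vc nz \<tau> _ \<eta>]) (auto simp: nv)
  also have "1/2 * (LINT x|mu. ((inverse c *\<^sub>R fst (w x)) \<bullet> J (inverse c *\<^sub>R fst (u x)) / norm (fst (u x))
        + \<delta> * (snd (w x) \<bullet> (inverse c *\<^sub>R fst (u x))) / norm (fst (u x)))\<^sup>2 * norm (fst (u x)))
      = (LINT x|mu. (norm (fst (?T x)))\<^sup>2)"
    unfolding integral_mult_right_zero[symmetric]
  proof (rule Bochner_Integration.integral_cong)
    fix x assume "x \<in> space mu"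
    then have x: "x \<in> {0..2*pi}" by simp
    have "(inverse c *\<^sub>R fst (w x)) \<bullet> J (inverse c *\<^sub>R fst (u x)) / norm (fst (u x))
        + \<delta> * (snd (w x) \<bullet> (inverse c *\<^sub>R fst (u x))) / norm (fst (u x))
        = fst (w x) \<bullet> J (fst (u x)) / c^3 + \<delta> * (snd (w x) \<bullet> fst (u x)) / c\<^sup>2"
      using c by (simp add: nv[OF x] J_scaleR field_simps power2_eq_square power3_eq_cube)
    then show "1/2 * (((inverse c *\<^sub>R fst (w x)) \<bullet> J (inverse c *\<^sub>R fst (u x)) / norm (fst (u x))
        + \<delta> * (snd (w x) \<bullet> (inverse c *\<^sub>R fst (u x))) / norm (fst (u x)))\<^sup>2 * norm (fst (u x)))
        = (norm (fst (?T x)))\<^sup>2"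
      using c by (simp add: nv[OF x] energy_map_def power_mult_distrib)
  qed simp
  also have "lam/2 * (LINT x|mu. (norm (snd (w x)))\<^sup>2 / norm (fst (u x))) = (LINT x|mu. (norm (snd (?T x)))\<^sup>2)"
    unfolding integral_mult_right_zero[symmetric]
    by (rule Bochner_Integration.integral_cong)
      (use c lam in \<open>auto simp: nv energy_map_def power_mult_distrib\<close>)
  also have "(LINT x|mu. (norm (fst (?T x)))\<^sup>2) + (LINT x|mu. (norm (snd (?T x)))\<^sup>2)
      = (LINT x|mu. (norm (fst (?T x)))\<^sup>2 + (norm (snd (?T x)))\<^sup>2)"
    by (intro Bochner_Integration.integral_add[symmetric] L2_integrable_square
        L2_bounded_linear[OF bounded_linear_fst T] L2_bounded_linear[OF bounded_linear_snd T])
  also have "\<dots> = reduced_energy \<delta> lam c u w"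
    by (simp add: reduced_energy_def norm_prod_def)
  finally show "energy \<delta> lam \<gamma> \<eta> = reduced_energy \<delta> lam c u w" .
qed

text \<open>Chain rule for the normalization, which is smooth away from 0. Applied to a velocity it
  differentiates the unit tangent.\<close>

lemma H1_normalize:
  fixes f g :: "real \<Rightarrow> 'a::euclidean_space"
  assumes f: "H1 f g" and nz: "\<And>x. x \<in> {0..2*pi} \<Longrightarrow> f x \<noteq> 0"
  obtains t where "H1 (\<lambda>x. inverse (norm (f x)) *\<^sub>R f x) t"
proof (rule that, rule H1_chain_rule[OF f, where U="- {0}" and \<Phi>="\<lambda>p. inverse (norm p) *\<^sub>R p"])
  fix p :: 'a assume "p \<in> - {0}"
  then show "((\<lambda>p. inverse (norm p) *\<^sub>R p) has_derivative
      (\<lambda>h. inverse (norm p) *\<^sub>R h + (- (inverse (norm p) * (h \<bullet> sgn p) * inverse (norm p))) *\<^sub>R p)) (at p)"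
    by (auto intro!: derivative_eq_intros has_derivative_norm)
next
  fix h :: 'a
  show "continuous_on (- {0}) (\<lambda>p::'a.
      inverse (norm p) *\<^sub>R h + (- (inverse (norm p) * (h \<bullet> sgn p) * inverse (norm p))) *\<^sub>R p)"
    unfolding sgn_div_norm by (intro continuous_intros) auto
qed (use nz in auto)

text \<open>The reduced pair consists of the velocity of \<open>\<gamma> \<circ> \<rho>\<close> and
  of \<open>\<eta> \<circ> \<rho>\<close>, where \<open>\<rho>\<close> inverts normalized arc
  length. Its energy density is the old one composed with \<open>\<rho>\<close> times
  \<open>speed\<close>, so substitution equates the energies.\<close>

lemma admissible_imp_reduced:
  assumes adm: "(\<gamma>, \<eta>) \<in> admissible L0 A0" and L0: "L0 > 0" and lam: "lam > 0"
  obtains u w where "(u, w) \<in> reduced (L0 / (2*pi)) A0"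
    "reduced_energy \<delta> lam (L0 / (2*pi)) u w = energy \<delta> lam \<gamma> \<eta>"
proof -
  define c where "c = L0 / (2*pi)"
  have c: "c > 0" using L0 by (simp add: c_def)
  define v where "v = dx \<gamma>"
  have \<gamma>_imm: "\<gamma> \<in> H2_imm" and \<eta>_per: "\<eta> \<in> H_per 1" and len: "curve_length \<gamma> = L0"
    and area: "signed_area \<gamma> = A0" and S: "\<And>x. x \<in> {0..2*pi} \<Longrightarrow> S \<eta> x = 0"
    using adm by (auto simp: admissible_def)
  obtain a where "H1 \<gamma> (dx \<gamma>)" "H1 (dx \<gamma>) a" "\<And>x. x \<in> {0..2*pi} \<Longrightarrow> dx \<gamma> x \<noteq> 0"
    "\<gamma> 0 = \<gamma> (2*pi)" "dx \<gamma> 0 = dx \<gamma> (2*pi)"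
    using H2_immD[OF \<gamma>_imm] by blast
  then have \<gamma>: "H1 \<gamma> v" and v: "H1 v a" and nz: "\<And>x. x \<in> {0..2*pi} \<Longrightarrow> v x \<noteq> 0"
    and per: "\<gamma> 0 = \<gamma> (2*pi)" "v 0 = v (2*pi)"
    by (simp_all add: v_def)
  obtain b where \<eta>: "H1 \<eta> b" and \<eta>p: "\<eta> 0 = \<eta> (2*pi)" using \<eta>_per unfolding H_per_1_iff by blast
  have n\<eta>: "norm (\<eta> x) = 1" if "x \<in> {0..2*pi}" for x
    using S[OF that] norm_ge_zero[of "\<eta> x"] by (auto simp: S_def power2_eq_1_iff)
  have vc: "continuous_on {0..2*pi} v" by (rule H1_continuous[OF v])
  \<comment> \<open>The speed relative to its mean value \<open>c\<close>: the total integral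
    becomes \<open>2*pi\<close>, and \<open>\<gamma> \<circ> \<rho>\<close> gets speed
    \<open>c\<close>.\<close>
  define p where "p x = norm (v x) / c" for x
  have p: "continuous_on {0..2*pi} p" unfolding p_def by (intro continuous_intros vc) (use c in auto)
  have p_pos: "p x > 0" if "x \<in> {0..2*pi}" for x using nz[OF that] c by (simp add: p_def)
  have "integral {0..2*pi} p = integral {0..2*pi} (\<lambda>x. norm (v x)) / c"
    unfolding p_def by (simp add: divide_inverse)
  also have "integral {0..2*pi} (\<lambda>x. norm (v x)) = L0"
    using len unfolding curve_length_def curve_integral_def v_def[symmetric]
    by (simp add: LINT_mu continuous_integrable_mu continuous_intros vc)
  finally have "integral {0..2*pi} p = 2*pi" using L0 by (simp add: c_def)
  then obtain \<rho> where "reparametrization p \<rho>" using reparametrization_exists[OF p p_pos] by blast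
  then interpret reparametrization p \<rho> .
  define \<tau> where "\<tau> x = inverse (norm (v x)) *\<^sub>R v x" for x
  obtain t where \<tau>: "H1 \<tau> t" using H1_normalize[OF v nz] unfolding \<tau>_def by blast
  have n\<tau>: "norm (\<tau> x) = 1" if "x \<in> {0..2*pi}" for x using nz[OF that] by (simp add: \<tau>_def)
  have speed: "speed y = c / norm (v (\<rho> y))" for y by (simp add: speed_def p_def)
  have c\<tau>: "c *\<^sub>R \<tau> (\<rho> y) = speed y *\<^sub>R v (\<rho> y)" for y
    by (simp add: speed \<tau>_def divide_inverse)
  \<comment> \<open>Writing the new velocity as \<open>c\<close> times the reparametrized tangent
    gives its derivative from \<open>\<tau>\<close>, without differentiating
    \<open>speed\<close>.\<close>
  define u where "u y = (c *\<^sub>R \<tau> (\<rho> y), \<eta> (\<rho> y))" for y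
  define w where "w y = (c *\<^sub>R (speed y *\<^sub>R t (\<rho> y)), speed y *\<^sub>R b (\<rho> y))" for y
  have u: "H1 u w"
    unfolding u_def w_def
    by (intro H1_Pair H1_bounded_linear[OF _ bounded_linear_scaleR_right] H1_reparametrize \<tau> \<eta>)
  have prim: "integral {0..y} (\<lambda>s. fst (u s)) = \<gamma> (\<rho> y) - \<gamma> 0" if y: "y \<in> {0..2*pi}" for y
  proof -
    have "integral {0..y} (\<lambda>s. fst (u s)) = integral {0..\<rho> y} v"
      unfolding u_def fst_conv c\<tau>
      by (rule change_of_variables(2)[OF _ y]) (intro L2_absolutely_integrable L2_continuous vc order_refl)
    then show ?thesis using H1_eq[OF \<gamma> \<rho>_in[OF y]] by simp
  qed
  have Jc: "continuous_on {0..2*pi} (\<lambda>x. J (v x))"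
    by (rule bounded_linear.continuous_on[OF bounded_linear_J vc])
  have \<gamma>c: "continuous_on {0..2*pi} \<gamma>" by (rule H1_continuous[OF \<gamma>])
  have "(u, w) \<in> reduced c A0"
    unfolding reduced_def
  proof (intro CollectI case_prodI conjI ballI u)
    fix y :: real assume "y \<in> {0..2*pi}"
    then show "norm (fst (u y)) = c" "norm (snd (u y)) = 1"
      using c by (simp_all add: u_def n\<tau> n\<eta> \<rho>_in del: atLeastAtMost_iff)
  next
    show "u 0 = u (2*pi)" by (simp add: u_def \<rho>_ends \<tau>_def per \<eta>p)
    show "integral {0..2*pi} (\<lambda>x. fst (u x)) = 0" using prim[of "2*pi"] per \<rho>_ends by simp
    have "integral {0..2*pi} (\<lambda>x. integral {0..x} (\<lambda>s. fst (u s)) \<bullet> J (fst (u x)))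
        = integral {0..2*pi} (\<lambda>x. speed x *\<^sub>R ((\<gamma> (\<rho> x) - \<gamma> 0) \<bullet> J (v (\<rho> x))))"
      by (rule Henstock_Kurzweil_Integration.integral_cong)
        (auto simp: prim, auto simp: u_def c\<tau> J_scaleR)
    also have "\<dots> = integral {0..\<rho> (2*pi)} (\<lambda>x. (\<gamma> x - \<gamma> 0) \<bullet> J (v x))"
      by (rule change_of_variables(2))
        (auto intro!: absolutely_integrable_continuous_real continuous_intros Jc \<gamma>c)
    also have "\<dots> = integral {0..2*pi} (\<lambda>x. \<gamma> x \<bullet> J (v x)) - integral {0..2*pi} (\<lambda>x. \<gamma> 0 \<bullet> J (v x))"
      unfolding \<rho>_ends inner_diff_left
      by (intro Henstock_Kurzweil_Integration.integral_diff integrable_continuous_real continuous_intros Jc \<gamma>c)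
    \<comment> \<open>Moving the starting point to the origin preserves the area, because the
      velocity of a closed curve integrates to 0.\<close>
    also have "integral {0..2*pi} (\<lambda>x. \<gamma> 0 \<bullet> J (v x)) = 0"
    proof -
      have "bounded_linear (\<lambda>z. \<gamma> 0 \<bullet> J z)"
        using bounded_linear_compose[OF bounded_linear_inner_right bounded_linear_J] .
      moreover have "v integrable_on {0..2*pi}" by (rule integrable_continuous_real[OF vc])
      ultimately have "integral {0..2*pi} (\<lambda>x. \<gamma> 0 \<bullet> J (v x)) = \<gamma> 0 \<bullet> J (integral {0..2*pi} v)"
        using integral_linear[of v "{0..2*pi}" "\<lambda>z. \<gamma> 0 \<bullet> J z"] by (simp add: o_def)
      moreover have "integral {0..2*pi} v = 0" using H1_eq[OF \<gamma>, of "2*pi"] per by simp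
      ultimately show ?thesis
        using linear_0[OF bounded_linear.linear[OF bounded_linear_J]] by simp
    qed
    finally have "integral {0..2*pi} (\<lambda>x. integral {0..x} (\<lambda>s. fst (u s)) \<bullet> J (fst (u x)))
        = (LINT x|mu. \<gamma> x \<bullet> J (v x))"
      by (simp add: LINT_mu continuous_integrable_mu continuous_intros Jc \<gamma>c)
    then show "- (1/2) * integral {0..2*pi} (\<lambda>x. integral {0..x} (\<lambda>s. fst (u s)) \<bullet> J (fst (u x))) = A0"
      using area by (simp add: signed_area_def v_def)
  qed
  moreover have "reduced_energy \<delta> lam c u w = energy \<delta> lam \<gamma> \<eta>"
  proof -
    define k where "k x = t x \<bullet> J (\<tau> x) / norm (v x) + \<delta> * (b x \<bullet> \<tau> x) / norm (v x)" for x
    have tc: "continuous_on {0..2*pi} \<tau>" by (rule H1_continuous[OF \<tau>])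
    have k: "L2 k"
    proof -
      have "L2 (\<lambda>x. (\<lambda>w. fst w \<bullet> J (\<tau> x) / norm (v x) + \<delta> * (snd w \<bullet> \<tau> x) / norm (v x)) (t x, b x))"
      proof (rule L2_linear_image[OF _ _ L2_Pair[OF H1_L2[OF \<tau>] H1_L2[OF \<eta>]]])
        show "linear (\<lambda>w. fst w \<bullet> J (\<tau> x) / norm (v x) + \<delta> * (snd w \<bullet> \<tau> x) / norm (v x))" for x
          by (rule linearI) (simp_all add: inner_add_left add_divide_distrib algebra_simps)
        show "continuous_on {0..2*pi} (\<lambda>x. fst h \<bullet> J (\<tau> x) / norm (v x) + \<delta> * (snd h \<bullet> \<tau> x) / norm (v x))" for h
          by (intro continuous_intros bounded_linear.continuous_on[OF bounded_linear_J] tc vc) (use nz in auto)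
      qed
      then show ?thesis by (simp add: k_def[abs_def])
    qed
    have i1: "integrable mu (\<lambda>x. 1/2 * ((k x)\<^sup>2 * norm (v x)))"
    proof -
      have "integrable mu (\<lambda>x. k x \<bullet> (norm (v x) *\<^sub>R k x))"
        by (intro L2_inner_integrable k L2_multiplier continuous_intros vc)
      then show ?thesis by (intro integrable_mult_right) (simp add: power2_eq_square mult_ac)
    qed
    have i2: "integrable mu (\<lambda>x. lam/2 * ((norm (b x))\<^sup>2 / norm (v x)))"
    proof -
      have "integrable mu (\<lambda>x. b x \<bullet> (inverse (norm (v x)) *\<^sub>R b x))"
        by (intro L2_inner_integrable H1_L2[OF \<eta>] L2_multiplier continuous_intros vc) (use nz in auto)
      moreover have "b x \<bullet> (inverse (norm (v x)) *\<^sub>R b x) = (norm (b x))\<^sup>2 / norm (v x)" for x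
        by (simp add: dot_square_norm divide_inverse)
      ultimately have "integrable mu (\<lambda>x. (norm (b x))\<^sup>2 / norm (v x))" by simp
      then show ?thesis by (rule integrable_mult_right)
    qed
    let ?f = "\<lambda>x. 1/2 * ((k x)\<^sup>2 * norm (v x)) + lam/2 * ((norm (b x))\<^sup>2 / norm (v x))"
    have fi: "integrable mu ?f" by (rule Bochner_Integration.integrable_add[OF i1 i2])
    have "reduced_energy \<delta> lam c u w = (LINT y|mu. speed y *\<^sub>R ?f (\<rho> y))"
      unfolding reduced_energy_def
    proof (rule Bochner_Integration.integral_cong)
      fix y assume "y \<in> space mu"
      then have y: "y \<in> {0..2*pi}" by simp
      define n where "n = norm (v (\<rho> y))"
      have n: "n > 0" using nz[OF \<rho>_in[OF y]] by (simp add: n_def)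
      have q: "speed y = c / n" by (simp add: speed n_def)
      \<comment> \<open>\<open>A / n\<close> and \<open>B / n\<close> are the curvature and the
        divergence of the original pair at \<open>\<rho> y\<close>.\<close>
      define A B where "A = t (\<rho> y) \<bullet> J (\<tau> (\<rho> y))" and "B = b (\<rho> y) \<bullet> \<tau> (\<rho> y)"
      have "fst (w y) \<bullet> J (fst (u y)) = c * (c / n * (c * A))" "snd (w y) \<bullet> fst (u y) = c / n * (c * B)"
        by (simp_all add: u_def w_def J_scaleR q A_def B_def)
      moreover have "c * (c / n * (c * A)) / c^3 = A / n" "\<delta> * (c / n * (c * B)) / c\<^sup>2 = \<delta> * B / n"
        using c by (simp_all add: power2_eq_square power3_eq_cube)
      ultimately have "fst (w y) \<bullet> J (fst (u y)) / c^3 + \<delta> * (snd (w y) \<bullet> fst (u y)) / c\<^sup>2 = k (\<rho> y)"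
        by (simp add: k_def A_def B_def n_def)
      then have "(norm (energy_map \<delta> lam c (fst (u y)) (w y)))\<^sup>2
          = c/2 * (k (\<rho> y))\<^sup>2 + lam/(2*c) * (norm (snd (w y)))\<^sup>2"
        using norm_energy_map[OF c, of lam] lam by simp
      also have "\<dots> = speed y *\<^sub>R ?f (\<rho> y)"
      proof -
        have "norm (snd (w y)) = c / n * norm (b (\<rho> y))" using c n by (simp add: w_def q)
        then have "lam/(2*c) * (norm (snd (w y)))\<^sup>2 = c / n * (lam/2 * ((norm (b (\<rho> y)))\<^sup>2 / n))"
          using c n by (simp add: power2_eq_square mult_ac)
        moreover have "c/2 * (k (\<rho> y))\<^sup>2 = c / n * (1/2 * ((k (\<rho> y))\<^sup>2 * n))" using n by simp
        ultimately show ?thesis by (simp only: q n_def[symmetric] real_scaleR_def distrib_left)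
      qed
      finally show "(norm (energy_map \<delta> lam c (fst (u y)) (w y)))\<^sup>2 = speed y *\<^sub>R ?f (\<rho> y)" .
    qed simp
    also have "\<dots> = (LINT x|mu. ?f x)" by (rule LINT_change_of_variables(2)[OF fi])
    also have "\<dots> = 1/2 * (LINT x|mu. (k x)\<^sup>2 * norm (v x)) + lam/2 * (LINT x|mu. (norm (b x))\<^sup>2 / norm (v x))"
      using Bochner_Integration.integral_add[OF i1 i2] by (simp only: integral_mult_right_zero)
    also have "\<dots> = energy \<delta> lam \<gamma> \<eta>"
      unfolding k_def by (rule energy_formula[OF \<gamma> vc nz \<tau> _ \<eta>, symmetric]) (simp_all add: \<tau>_def)
    finally show ?thesis .
  qed
  ultimately show ?thesis using that unfolding c_def by blast
qed

subsection \<open>Compactness and lower semicontinuity\<close>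

abbreviation sqint :: "(real \<Rightarrow> 'a::euclidean_space) \<Rightarrow> real" where
  "sqint f \<equiv> LINT x|mu. (norm (f x))\<^sup>2"

lemma sqint_nonneg: "0 \<le> sqint f"
  by (rule Bochner_Integration.integral_nonneg) auto

lemma sqint_le_scaled:
  assumes "L2 f" "L2 g" "AE x in mu. norm (f x) \<le> K * norm (g x)"
  shows "sqint f \<le> K\<^sup>2 * sqint g"
proof -
  have "sqint f \<le> (LINT x|mu. K\<^sup>2 * (norm (g x))\<^sup>2)"
  proof (rule integral_mono_AE)
    show "AE x in mu. (norm (f x))\<^sup>2 \<le> K\<^sup>2 * (norm (g x))\<^sup>2"
      using assms(3) by eventually_elim (metis norm_ge_zero power_mono power_mult_distrib)
  qed (use assms in \<open>auto simp: L2_def\<close>)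
  then show ?thesis by simp
qed

text \<open>Young's inequality for the cross term. In the applications \<open>t\<close> tends to 0,
  so the factor of the main term tends to 1.\<close>

lemma sqint_perturb:
  assumes L: "L2 f" "L2 g" "L2 h" and t: "t > 0"
    and le: "\<And>x. x \<in> {0..2*pi} \<Longrightarrow> norm (f x) \<le> norm (g x) + norm (h x)"
  shows "sqint f \<le> (1 + t) * sqint g + (1 + 1/t) * sqint h"
proof -
  have "sqint f \<le> (LINT x|mu. (1 + t) * (norm (g x))\<^sup>2 + (1 + 1/t) * (norm (h x))\<^sup>2)"
  proof (rule integral_mono_AE)
    show "AE x in mu. (norm (f x))\<^sup>2 \<le> (1 + t) * (norm (g x))\<^sup>2 + (1 + 1/t) * (norm (h x))\<^sup>2"
    proof (rule AE_mu_I)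
      fix x :: real assume x: "x \<in> {0..2*pi}"
      define a b where "a = norm (g x)" and "b = norm (h x)"
      have "(norm (f x))\<^sup>2 \<le> (a + b)\<^sup>2" unfolding a_def b_def by (intro power_mono le x) auto
      moreover have "0 \<le> (t * a - b)\<^sup>2 / t" using t by simp
      moreover have "(t * a - b)\<^sup>2 / t = t * a\<^sup>2 - 2 * a * b + b\<^sup>2 / t"
        using t by (simp add: power2_eq_square field_simps)
      ultimately show "(norm (f x))\<^sup>2 \<le> (1 + t) * (norm (g x))\<^sup>2 + (1 + 1/t) * (norm (h x))\<^sup>2"
        unfolding a_def[symmetric] b_def[symmetric] by (simp add: power2_sum algebra_simps)
    qed
  qed (use L in \<open>auto simp: L2_def\<close>)
  also have "\<dots> = (1 + t) * sqint g + (1 + 1/t) * sqint h"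
    using L by (subst Bochner_Integration.integral_add) (auto simp: L2_def)
  finally show ?thesis .
qed

lemma sqint_parallelogram:
  fixes f g :: "real \<Rightarrow> 'a::euclidean_space"
  assumes "L2 f" "L2 g"
  shows "sqint (\<lambda>x. f x - g x) + 4 * sqint (\<lambda>x. (1/2) *\<^sub>R (f x + g x)) = 2 * sqint f + 2 * sqint g"
proof -
  have m: "L2 (\<lambda>x. (1/2) *\<^sub>R (f x + g x))" "L2 (\<lambda>x. f x - g x)"
    using assms by (auto intro: L2_scaleR L2_add L2_diff)
  have "(LINT x|mu. (norm (f x - g x))\<^sup>2 + 4 * (norm ((1/2) *\<^sub>R (f x + g x)))\<^sup>2)
      = (LINT x|mu. 2 * (norm (f x))\<^sup>2 + 2 * (norm (g x))\<^sup>2)"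
  proof (rule Bochner_Integration.integral_cong)
    fix x
    show "(norm (f x - g x))\<^sup>2 + 4 * (norm ((1/2) *\<^sub>R (f x + g x)))\<^sup>2 = 2 * (norm (f x))\<^sup>2 + 2 * (norm (g x))\<^sup>2"
      unfolding power2_norm_eq_inner by (simp add: inner_add_left inner_add_right inner_diff_left inner_diff_right inner_commute field_simps)
  qed simp
  moreover have "(LINT x|mu. (norm (f x - g x))\<^sup>2 + 4 * (norm ((1/2) *\<^sub>R (f x + g x)))\<^sup>2)
      = sqint (\<lambda>x. f x - g x) + 4 * sqint (\<lambda>x. (1/2) *\<^sub>R (f x + g x))"
    using Bochner_Integration.integral_add[OF L2_integrable_square[OF m(2)]
        integrable_mult_right[OF L2_integrable_square[OF m(1)], of 4]] by simp
  moreover have "(LINT x|mu. 2 * (norm (f x))\<^sup>2 + 2 * (norm (g x))\<^sup>2) = 2 * sqint f + 2 * sqint g"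
    using assms by (subst Bochner_Integration.integral_add) (auto simp: L2_def)
  ultimately show ?thesis by simp
qed

lemma L2_integral_tendsto:
  fixes f :: "nat \<Rightarrow> real \<Rightarrow> 'a::euclidean_space"
  assumes f: "\<And>n. L2 (f n)" and g: "L2 g" and lim: "(\<lambda>n. sqint (\<lambda>x. f n x - g x)) \<longlonglongrightarrow> 0"
    and y: "y \<in> {0..2*pi}"
  shows "(\<lambda>n. integral {0..y} (f n)) \<longlonglongrightarrow> integral {0..y} g"
proof (rule Lim_transform2[where f="\<lambda>n. integral {0..y} g", OF tendsto_const])
  define q where "q n = sqint (\<lambda>x. f n x - g x)" for n
  \<comment> \<open>The best weight \<open>sqrt (q n)\<close> may be 0; the second summand keeps it
    positive and vanishes in the limit.\<close>
  define t where "t n = sqrt (q n) + inverse (real (Suc n))" for n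
  have q: "q n \<ge> 0" for n unfolding q_def by (rule sqint_nonneg)
  have t: "t n > 0" for n unfolding t_def using q[of n] by (intro add_nonneg_pos) auto
  have le: "norm (integral {0..y} g - integral {0..y} (f n)) \<le> (t n * y + sqrt (q n)) / 2" for n
  proof -
    have L: "L2 (\<lambda>x. f n x - g x)" by (intro L2_diff f g)
    have "norm (integral {0..y} g - integral {0..y} (f n)) = norm (integral {0..y} (\<lambda>x. f n x - g x))"
      using y by (subst Henstock_Kurzweil_Integration.integral_diff)
        (auto intro: L2_integrable_on f g simp: norm_minus_commute)
    also have "\<dots> \<le> integral {0..y} (\<lambda>x. norm (f n x - g x))"
      using y by (intro Henstock_Kurzweil_Integration.integral_norm_bound_integral L2_integrable_on L L2_norm) auto
    also have "\<dots> \<le> (t n * (y - 0) + q n / t n) / 2"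
      unfolding q_def by (rule L2_integral_norm_le[OF L]) (use y t in auto)
    also have "\<dots> \<le> (t n * y + sqrt (q n)) / 2"
    proof -
      have "q n = sqrt (q n) * sqrt (q n)" using q[of n] by simp
      also have "\<dots> \<le> sqrt (q n) * t n" using q[of n] by (intro mult_left_mono) (auto simp: t_def)
      finally show ?thesis using t[of n] by (simp add: divide_le_eq)
    qed
    finally show ?thesis .
  qed
  have "(\<lambda>n. (t n * y + sqrt (q n)) / 2) \<longlonglongrightarrow> ((sqrt 0 + 0) * y + sqrt 0) / 2"
    unfolding t_def q_def by (intro tendsto_intros lim LIMSEQ_inverse_real_of_nat) simp
  then have "(\<lambda>n. (t n * y + sqrt (q n)) / 2) \<longlonglongrightarrow> 0" by simp
  then show "(\<lambda>n. integral {0..y} g - integral {0..y} (f n)) \<longlonglongrightarrow> 0"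
    by (rule Lim_null_comparison[rotated]) (use le in auto)
qed

text \<open>A bound on \<open>sqint g\<close> gives a modulus of continuity uniform in
  \<open>f\<close>: choose \<open>t\<close> large, then the distance small. This is the
  equicontinuity for Arzela-Ascoli.\<close>

lemma H1_modulus:
  fixes f g :: "real \<Rightarrow> 'a::euclidean_space"
  assumes H: "H1 f g" and xy: "x \<in> {0..2*pi}" "y \<in> {0..2*pi}" and t: "t > 0"
  shows "norm (f x - f y) \<le> (t * \<bar>x - y\<bar> + sqint g / t) / 2"
proof -
  have *: "norm (f y - f x) \<le> (t * (y - x) + sqint g / t) / 2"
    if "0 \<le> x" "x \<le> y" "y \<le> 2*pi" for x y
  proof -
    have "norm (f y - f x) \<le> integral {x..y} (\<lambda>s. norm (g s))"
      unfolding H1_increment[OF H that] using that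
      by (intro Henstock_Kurzweil_Integration.integral_norm_bound_integral L2_integrable_on L2_norm H1_L2[OF H]) auto
    also have "\<dots> \<le> (t * (y - x) + sqint g / t) / 2"
      by (rule L2_integral_norm_le[OF H1_L2[OF H] that t])
    finally show ?thesis .
  qed
  show ?thesis
    using *[of x y] *[of y x] xy by (cases "x \<le> y") (auto simp: norm_minus_commute)
qed

text \<open>Dyadic convex combinations. Closure under midpoints matches the parallelogram law, and
  properties pass to the hull by rule induction.\<close>

inductive_set midpoint_hull :: "(real \<Rightarrow> 'a::real_vector) set \<Rightarrow> (real \<Rightarrow> 'a) set" for A where
  base: "f \<in> A \<Longrightarrow> f \<in> midpoint_hull A"
| mid: "f \<in> midpoint_hull A \<Longrightarrow> g \<in> midpoint_hull A \<Longrightarrow> (\<lambda>x. (1/2) *\<^sub>R (f x + g x)) \<in> midpoint_hull A"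

lemma midpoint_hull_mono:
  assumes "A \<subseteq> B"
  shows "midpoint_hull A \<subseteq> midpoint_hull B"
proof
  fix f assume "f \<in> midpoint_hull A"
  then show "f \<in> midpoint_hull B"
    by induction (use assms in \<open>auto intro: midpoint_hull.intros\<close>)
qed

text \<open>A Mazur-type lemma: elements of almost minimal norm in the hulls of the tails form a Cauchy
  sequence by the parallelogram law.  This replaces weak compactness of bounded sets.\<close>

lemma L2_tail_hulls_converge:
  fixes w :: "nat \<Rightarrow> real \<Rightarrow> 'a::euclidean_space"
  assumes w: "\<And>n. L2 (w n)" and C: "\<And>n. sqint (w n) \<le> C"
  obtains g W where "\<And>n. g n \<in> midpoint_hull (w ` {n..})" "\<And>n. L2 (g n)" "L2 W"
    "(\<lambda>n. sqint (\<lambda>x. g n x - W x)) \<longlonglongrightarrow> 0"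
proof -
  define H where "H n = midpoint_hull (w ` {n..})" for n
  have HL: "L2 f" if "f \<in> H n" for f n
    using that unfolding H_def by induction (auto intro: w L2_scaleR L2_add)
  have wH: "w n \<in> H n" for n unfolding H_def by (rule midpoint_hull.base) auto
  have Hmono: "H m \<subseteq> H n" if "n \<le> m" for m n
    unfolding H_def by (rule midpoint_hull_mono) (use that in auto)
  define d where "d n = Inf (sqint ` H n)" for n
  have bdd: "bdd_below (sqint ` H n)" for n by (rule bdd_belowI2[of _ 0]) (rule sqint_nonneg)
  have dle: "d n \<le> sqint f" if "f \<in> H n" for f n unfolding d_def by (rule cINF_lower[OF bdd that])
  \<comment> \<open>The hulls shrink as \<open>n\<close> grows, so the infima increase; the bound
    \<open>C\<close> makes them converge.\<close>
  have "incseq d"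
    unfolding d_def by (intro incseq_SucI cInf_superset_mono image_mono Hmono bdd) (use wH in auto)
  moreover have "d n \<le> C" for n using dle[OF wH] C order_trans by blast
  ultimately have "Cauchy d"
    using Bseq_mono_convergent[OF incseq_bounded[of d C]] by (auto simp: incseq_def Cauchy_convergent_iff)
  have "\<exists>g. \<forall>n. g n \<in> H n \<and> sqint (g n) < d n + 1 / (1 + real n)"
  proof (rule choice, rule allI)
    fix n
    have "Inf (sqint ` H n) < d n + 1 / (1 + real n)" by (simp add: d_def)
    then show "\<exists>f. f \<in> H n \<and> sqint f < d n + 1 / (1 + real n)"
      using cInf_lessD[of "sqint ` H n"] wH by blast
  qed
  then obtain g where g: "\<And>n. g n \<in> H n" and gd: "\<And>n. sqint (g n) < d n + 1 / (1 + real n)" by blast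
  have gL: "L2 (g n)" for n by (rule HL[OF g])
  \<comment> \<open>The midpoint of \<open>g m\<close> and \<open>g n\<close> lies in
    \<open>H n\<close>, so its squared norm is at least \<open>d n\<close>. The parallelogram law
    then leaves \<open>2 * (d m - d n)\<close> and the excesses of \<open>g m\<close> and
    \<open>g n\<close> over their infima.\<close>
  have key: "sqint (\<lambda>x. g m x - g n x) \<le> 2 * (d m - d n) + 4 / (1 + real n)" if "n \<le> m" for m n
  proof -
    have "(\<lambda>x. (1/2) *\<^sub>R (g m x + g n x)) \<in> H n"
      using g[of n] g[of m] Hmono[OF that] unfolding H_def by (intro midpoint_hull.mid) auto
    then have "d n \<le> sqint (\<lambda>x. (1/2) *\<^sub>R (g m x + g n x))" by (rule dle)
    moreover have "1 / (1 + real m) \<le> 1 / (1 + real n)" using that by (simp add: frac_le)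
    ultimately show ?thesis
      using sqint_parallelogram[OF gL[of m] gL[of n]] gd[of m] gd[of n] by simp
  qed
  obtain W where "L2 W" "(\<lambda>n. sqint (\<lambda>x. g n x - W x)) \<longlonglongrightarrow> 0"
  proof (rule L2_complete[OF gL])
    fix e :: real assume e: "e > 0"
    obtain N1 where N1: "\<And>m n. m \<ge> N1 \<Longrightarrow> n \<ge> N1 \<Longrightarrow> \<bar>d m - d n\<bar> < e/4"
      using \<open>Cauchy d\<close> e unfolding Cauchy_def dist_real_def by (metis zero_less_divide_iff zero_less_numeral)
    obtain N2 where N2: "8 / e < real N2" using reals_Archimedean2 by blast
    have ordered: "sqint (\<lambda>x. g m x - g n x) \<le> e" if mn: "n \<le> m" "n \<ge> max N1 N2" for m n
    proof -
      have "8 / e < 1 + real n" using N2 mn by simp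
      then have "4 / (1 + real n) \<le> e/2" using e by (simp add: field_simps)
      moreover have "d m - d n < e/4" using N1[of m n] mn abs_ge_self[of "d m - d n"] by auto
      ultimately show ?thesis using key[OF mn(1)] by simp
    qed
    have swap: "sqint (\<lambda>x. g m x - g n x) = sqint (\<lambda>x. g n x - g m x)" for m n
      by (simp add: norm_minus_commute)
    have "\<forall>m\<ge>max N1 N2. \<forall>n\<ge>max N1 N2. sqint (\<lambda>x. g m x - g n x) \<le> e"
    proof (intro allI impI)
      fix m n assume mn: "m \<ge> max N1 N2" "n \<ge> max N1 N2"
      show "sqint (\<lambda>x. g m x - g n x) \<le> e"
      proof (cases "n \<le> m")
        case True
        then show ?thesis by (rule ordered[OF _ mn(2)])
      next
        case False
        then show ?thesis unfolding swap[of m n] by (intro ordered mn(1)) simp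
      qed
    qed
    then show "\<exists>N. \<forall>m\<ge>N. \<forall>n\<ge>N. sqint (\<lambda>x. g m x - g n x) \<le> e" by (rule exI)
  qed
  then show ?thesis by (rule that[OF g[unfolded H_def] gL])
qed

text \<open>Stands for closed midpoint convex subsets of L2, which contain the weak limits of their
  sequences. Weak convergence is expressed below through such predicates alone.\<close>

definition convex_closed :: "((real \<Rightarrow> 'a::euclidean_space) \<Rightarrow> bool) \<Rightarrow> bool" where
  "convex_closed P \<longleftrightarrow>
     (\<forall>f g. P f \<longrightarrow> P g \<longrightarrow> P (\<lambda>x. (1/2) *\<^sub>R (f x + g x))) \<and>
     (\<forall>f g. (\<forall>n. L2 (f n) \<and> P (f n)) \<longrightarrow> L2 g \<longrightarrow>
        (\<lambda>n. sqint (\<lambda>x. f n x - g x)) \<longlonglongrightarrow> 0 \<longrightarrow> P g)"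

lemma convex_closed_limit:
  assumes "convex_closed P" "\<And>n. L2 (f n)" "\<And>n. P (f n)" "L2 g"
    "(\<lambda>n. sqint (\<lambda>x. f n x - g x)) \<longlonglongrightarrow> 0"
  shows "P g"
  using assms unfolding convex_closed_def by blast

text \<open>The last conclusion replaces weak convergence of \<open>w (r n)\<close> to
  \<open>W\<close>. \<open>W\<close> is the strong limit of midpoint combinations of the tails; the
  same combinations of the \<open>u (r n)\<close> still converge to \<open>U\<close>, so
  \<open>W\<close> is the derivative of \<open>U\<close>.\<close>

lemma H1_compactness:
  fixes u w :: "nat \<Rightarrow> real \<Rightarrow> 'a::euclidean_space"
  assumes u: "\<And>n. H1 (u n) (w n)" and C: "\<And>n. sqint (w n) \<le> C"
    and R: "\<And>n x. x \<in> {0..2*pi} \<Longrightarrow> norm (u n x) \<le> R"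
  obtains r U W where "strict_mono (r :: nat \<Rightarrow> nat)" "H1 U W"
    "uniform_limit {0..2*pi} (\<lambda>n. u (r n)) U sequentially"
    "\<forall>P. convex_closed P \<longrightarrow> (\<forall>\<^sub>F n in sequentially. P (w (r n))) \<longrightarrow> P W"
proof -
  have C0: "C \<ge> 0" using C[of 0] sqint_nonneg[of "w 0"] by linarith
  obtain U r where r: "strict_mono (r :: nat \<Rightarrow> nat)"
    and lim: "\<And>e. 0 < e \<Longrightarrow> \<exists>N. \<forall>n x. n \<ge> N \<and> x \<in> {0..2*pi} \<longrightarrow> norm (u (r n) x - U x) < e"
  proof (rule Arzela_Ascoli[of "{0..2*pi}" u R])
    fix x e :: real assume x: "x \<in> {0..2*pi}" and e: "0 < e"
    \<comment> \<open>Makes \<open>C / t < e\<close>. At distances below \<open>e / t\<close> both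
      terms in \<open>H1_modulus\<close> are below \<open>e\<close>, and so is their mean.\<close>
    define t where "t = (C + 1) / e"
    have t: "t > 0" using C0 e by (simp add: t_def)
    show "\<exists>d>0. \<forall>n y. y \<in> {0..2*pi} \<and> norm (x - y) < d \<longrightarrow> norm (u n x - u n y) < e"
    proof (intro exI conjI allI impI)
      show "e / t > 0" using e t by simp
      fix n y assume y: "y \<in> {0..2*pi} \<and> norm (x - y) < e / t"
      have "t * \<bar>x - y\<bar> < e" using y t by (simp add: field_simps)
      moreover have "sqint (w n) / t \<le> C / t" using C[of n] t by (simp add: divide_right_mono)
      moreover have "C / t < e" using C0 e by (simp add: t_def field_simps)
      ultimately show "norm (u n x - u n y) < e"
        using H1_modulus[OF u[of n] x, of y t] y t by simp
    qed
  qed (use R in auto)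
  have ul: "uniform_limit {0..2*pi} (\<lambda>n. u (r n)) U sequentially"
    unfolding uniform_limit_sequentially_iff dist_norm using lim by blast
  obtain g W where g: "\<And>n. g n \<in> midpoint_hull ((\<lambda>n. w (r n)) ` {n..})" and gL: "\<And>n. L2 (g n)"
    and W: "L2 W" and gW: "(\<lambda>n. sqint (\<lambda>x. g n x - W x)) \<longlonglongrightarrow> 0"
    by (rule L2_tail_hulls_converge[of "\<lambda>n. w (r n)" C, OF H1_L2[OF u] C]) (rule that)
  have "H1 U W"
  proof (rule H1I[OF W])
    fix x :: real assume x: "x \<in> {0..2*pi}"
    have 0: "0 \<in> {0..2*pi::real}" by simp
    have "(\<lambda>n. U x - U 0 - integral {0..x} (g n)) \<longlonglongrightarrow> 0"
    proof (rule LIMSEQ_I)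
      fix e :: real assume e: "e > 0"
      obtain N where N: "\<And>n x. n \<ge> N \<Longrightarrow> x \<in> {0..2*pi} \<Longrightarrow> norm (u (r n) x - U x) < e/2"
        using lim[of "e/2"] e by auto
      \<comment> \<open>The estimate passes to midpoints because \<open>U x - U 0\<close> is
        averaged with itself; square integrability is carried along to split the integral.\<close>
      have "L2 f \<and> norm (U x - U 0 - integral {0..x} f) < e"
        if "n \<ge> N" "f \<in> midpoint_hull ((\<lambda>n. w (r n)) ` {n..})" for n f
        using that(2)
      proof induction
        case (base f)
        then obtain m where m: "m \<ge> n" "f = w (r m)" by auto
        have "integral {0..x} f = u (r m) x - u (r m) 0" using H1_eq[OF u[of "r m"] x] m by simp
        then have eq: "U x - U 0 - integral {0..x} f = (u (r m) 0 - U 0) - (u (r m) x - U x)" by simp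
        have "norm ((u (r m) 0 - U 0) - (u (r m) x - U x)) < e/2 + e/2"
          using N[of m x] N[of m 0] x m that(1)
          add_strict_mono[of "norm (u (r m) 0 - U 0)" "e/2" "norm (u (r m) x - U x)" "e/2"]
        by (intro le_less_trans[OF norm_triangle_ineq4[of "u (r m) 0 - U 0" "u (r m) x - U x"]]) auto
        then show ?case unfolding eq using H1_L2[OF u] m by simp
      next
        case (mid f g)
        have i: "f integrable_on {0..x}" "g integrable_on {0..x}"
          using mid x by (auto intro: L2_integrable_on)
        have "integral {0..x} (\<lambda>x. (1/2) *\<^sub>R (f x + g x)) = (1/2) *\<^sub>R (integral {0..x} f + integral {0..x} g)"
          using Henstock_Kurzweil_Integration.integral_add[OF i] by simp
        then have "U x - U 0 - integral {0..x} (\<lambda>x. (1/2) *\<^sub>R (f x + g x))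
          = (1/2) *\<^sub>R ((U x - U 0 - integral {0..x} f) + (U x - U 0 - integral {0..x} g))"
          by (simp add: algebra_simps flip: scaleR_add_left)
        moreover have "norm ((U x - U 0 - integral {0..x} f) + (U x - U 0 - integral {0..x} g)) < e + e"
          using mid by (intro norm_add_less) auto
        ultimately show ?case using mid by (auto intro!: L2_scaleR L2_add)
      qed
      then show "\<exists>N. \<forall>n\<ge>N. norm (U x - U 0 - integral {0..x} (g n) - 0) < e" using g by auto
    qed
    moreover have "(\<lambda>n. U x - U 0 - integral {0..x} (g n)) \<longlonglongrightarrow> U x - U 0 - integral {0..x} W"
      by (intro tendsto_intros L2_integral_tendsto[OF gL W gW x])
    ultimately have "U x - U 0 - integral {0..x} W = 0" using LIMSEQ_unique by blast
    then show "U x = U 0 + integral {0..x} W" by (simp add: algebra_simps)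
  qed
  moreover have "P W" if P: "convex_closed P" and ev: "\<forall>\<^sub>F n in sequentially. P (w (r n))" for P
  proof -
    obtain N where N: "\<And>n. n \<ge> N \<Longrightarrow> P (w (r n))" using ev by (auto simp: eventually_sequentially)
    have hull: "P f" if "n \<ge> N" "f \<in> midpoint_hull ((\<lambda>n. w (r n)) ` {n..})" for n f
      using that(2) by induction (use N that(1) P in \<open>auto simp: convex_closed_def\<close>)
    \<comment> \<open>Beyond \<open>N\<close> the tails satisfy \<open>P\<close>, and hence so do
      their hulls.\<close>
    have "P (g (n + N))" for n by (rule hull[OF _ g]) simp
    then show ?thesis
      by (rule convex_closed_limit[OF P gL _ W LIMSEQ_ignore_initial_segment[OF gW, of N]])
  qed
  ultimately show ?thesis using that[OF r _ ul] by blast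
qed

text \<open>Uniform continuity on the closed ball for each of the finitely many basis vectors;
  dividing by the dimension \<open>N\<close> distributes the error \<open>k\<close> among
  them.\<close>

lemma linear_family_close:
  fixes A :: "'p::euclidean_space \<Rightarrow> 'a::euclidean_space \<Rightarrow> 'b::euclidean_space"
  assumes lin: "\<And>p. linear (A p)" and cont: "\<And>h. continuous_on UNIV (\<lambda>p. A p h)" and k: "k > 0"
  obtains d where "d > 0"
    "\<And>p q h. norm p \<le> R \<Longrightarrow> norm q \<le> R \<Longrightarrow> norm (p - q) < d \<Longrightarrow> norm (A p h - A q h) \<le> k * norm h"
proof -
  define N where "N = real (DIM('a))"
  have N: "N > 0" by (simp add: N_def)
  have "\<exists>d>0. \<forall>p q. norm p \<le> R \<longrightarrow> norm q \<le> R \<longrightarrow> norm (p - q) < d \<longrightarrow> norm (A p b - A q b) < k / N" for b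
  proof -
    have "uniformly_continuous_on (cball 0 R) (\<lambda>p. A p b)"
      by (intro compact_uniformly_continuous continuous_on_subset[OF cont]) auto
    moreover have "k / N > 0" using k N by simp
    ultimately obtain d where "d > 0"
      "\<And>x x'. x \<in> cball 0 R \<Longrightarrow> x' \<in> cball 0 R \<Longrightarrow> dist x' x < d \<Longrightarrow> dist (A x' b) (A x b) < k / N"
      unfolding uniformly_continuous_on_def by metis
    then show ?thesis by (intro exI[of _ d]) (auto simp: dist_norm)
  qed
  then obtain D where D: "\<And>b. D b > 0"
    and Dk: "\<And>b p q. norm p \<le> R \<Longrightarrow> norm q \<le> R \<Longrightarrow> norm (p - q) < D b \<Longrightarrow> norm (A p b - A q b) < k / N"
    by metis
  have "Min (D ` Basis) > 0" using D by (simp add: Min_gr_iff)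
  moreover have "norm (A p h - A q h) \<le> k * norm h"
    if pq: "norm p \<le> R" "norm q \<le> R" "norm (p - q) < Min (D ` Basis)" for p q h
  proof -
    have rep: "A r h = (\<Sum>b\<in>Basis. (h \<bullet> b) *\<^sub>R A r b)" for r
    proof -
      interpret linear "A r" by (rule lin)
      have "A r h = A r (\<Sum>b\<in>Basis. (h \<bullet> b) *\<^sub>R b)" by (simp add: euclidean_representation)
      then show ?thesis by (simp add: sum scaleR)
    qed
    have "A p h - A q h = (\<Sum>b\<in>Basis. (h \<bullet> b) *\<^sub>R (A p b - A q b))"
      unfolding rep[of p] rep[of q] by (simp add: sum_subtractf scaleR_diff_right)
    also have "norm \<dots> \<le> (\<Sum>b\<in>(Basis::'a set). norm h * (k / N))"
    proof (rule sum_norm_le)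
      fix b :: 'a assume b: "b \<in> Basis"
      have "norm (p - q) < D b" using pq(3) b by simp
      then show "norm ((h \<bullet> b) *\<^sub>R (A p b - A q b)) \<le> norm h * (k / N)"
        using Dk[OF pq(1,2), of b] mult_mono[OF Basis_le_norm[OF b, of h], of "norm (A p b - A q b)" "k / N"]
        by simp
    qed
    also have "\<dots> = k * norm h" using N by (simp add: N_def)
    finally show ?thesis .
  qed
  ultimately show ?thesis by (rule that)
qed

lemma linear_family_bounded:
  fixes A :: "real \<Rightarrow> 'a::euclidean_space \<Rightarrow> 'b::euclidean_space"
  assumes lin: "\<And>x. linear (A x)" and cont: "\<And>h. continuous_on {0..2*pi} (\<lambda>x. A x h)"
  obtains K where "K > 0" "\<And>x h. x \<in> {0..2*pi} \<Longrightarrow> norm (A x h) \<le> K * norm h"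
proof -
  have "\<exists>K>0. \<forall>x\<in>{0..2*pi}. norm (A x b) \<le> K" for b
    using continuous_bounded_pos[OF cont] by metis
  then obtain K where K0: "\<And>b. K b > 0" and K: "\<And>b x. x \<in> {0..2*pi} \<Longrightarrow> norm (A x b) \<le> K b" by metis
  show ?thesis
  proof (rule that[of "\<Sum>b\<in>Basis. K b"])
    show "0 < (\<Sum>b\<in>Basis. K b)" by (intro sum_pos K0) auto
    fix x :: real and h :: 'a assume x: "x \<in> {0..2*pi}"
    interpret linear "A x" by (rule lin)
    have "A x h = A x (\<Sum>b\<in>Basis. (h \<bullet> b) *\<^sub>R b)" by (simp add: euclidean_representation)
    also have "\<dots> = (\<Sum>b\<in>Basis. (h \<bullet> b) *\<^sub>R A x b)" by (simp add: sum scaleR)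
    also have "norm \<dots> \<le> (\<Sum>b\<in>(Basis::'a set). norm h * K b)"
      by (rule sum_norm_le) (auto intro!: mult_mono K x simp: Basis_le_norm)
    also have "\<dots> = (\<Sum>b\<in>Basis. K b) * norm h" by (simp add: sum_distrib_left mult.commute)
    finally show "norm (A x h) \<le> (\<Sum>b\<in>Basis. K b) * norm h" .
  qed
qed

text \<open>Sublevel sets of the quadratic functional are closed in L2: compare \<open>g\<close>
  with \<open>f n\<close> at the price of a factor \<open>1 + t\<close>, let \<open>n\<close> grow,
  then let \<open>t\<close> tend to 0.\<close>

lemma sqint_linear_closed:
  fixes A :: "real \<Rightarrow> 'a::euclidean_space \<Rightarrow> 'b::euclidean_space"
  assumes lin: "\<And>x. linear (A x)" and cont: "\<And>h. continuous_on {0..2*pi} (\<lambda>x. A x h)"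
    and f: "\<And>n. L2 (f n)" and le: "\<And>n. sqint (\<lambda>x. A x (f n x)) \<le> M"
    and g: "L2 g" and lim: "(\<lambda>n. sqint (\<lambda>x. f n x - g x)) \<longlonglongrightarrow> 0"
  shows "sqint (\<lambda>x. A x (g x)) \<le> M"
proof -
  have A: "L2 (\<lambda>x. A x (h x))" if "L2 h" for h by (rule L2_linear_image[OF lin cont that])
  obtain K where K: "K > 0" "\<And>x h. x \<in> {0..2*pi} \<Longrightarrow> norm (A x h) \<le> K * norm h"
    using linear_family_bounded[OF lin cont] by blast
  have t: "sqint (\<lambda>x. A x (g x)) \<le> (1 + t) * M" if t: "t > 0" for t
  proof -
    have le': "sqint (\<lambda>x. A x (g x)) \<le> (1 + t) * M + (1 + 1/t) * (K\<^sup>2 * sqint (\<lambda>x. f n x - g x))" for n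
    proof -
      have "sqint (\<lambda>x. A x (g x)) \<le> (1 + t) * sqint (\<lambda>x. A x (f n x)) + (1 + 1/t) * sqint (\<lambda>x. A x (f n x - g x))"
      proof (rule sqint_perturb[OF A[OF g] A[OF f] A[OF L2_diff[OF f g]] t])
        fix x :: real
        interpret linear "A x" by (rule lin)
        show "norm (A x (g x)) \<le> norm (A x (f n x)) + norm (A x (f n x - g x))"
          using norm_triangle_ineq4[of "A x (f n x)" "A x (f n x - g x)"] by (simp add: diff)
      qed
      also have "\<dots> \<le> (1 + t) * M + (1 + 1/t) * (K\<^sup>2 * sqint (\<lambda>x. f n x - g x))"
        using t by (intro add_mono mult_left_mono le sqint_le_scaled A L2_diff f g AE_mu_I K(2)) auto
      finally show ?thesis .
    qed
    have "(\<lambda>n. (1 + t) * M + (1 + 1/t) * (K\<^sup>2 * sqint (\<lambda>x. f n x - g x)))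
        \<longlonglongrightarrow> (1 + t) * M + (1 + 1/t) * (K\<^sup>2 * 0)"
      by (intro tendsto_intros lim)
    from LIMSEQ_le_const[OF this] show ?thesis using le' by auto
  qed
  have M: "M \<ge> 0" by (rule order_trans[OF sqint_nonneg le[of 0]])
  show ?thesis
  proof (rule field_le_epsilon)
    fix e :: real assume e: "e > 0"
    have "sqint (\<lambda>x. A x (g x)) \<le> (1 + e / (M + 1)) * M" by (rule t) (use e M in auto)
    also have "\<dots> \<le> M + e" using e M by (simp add: field_simps)
    finally show "sqint (\<lambda>x. A x (g x)) \<le> M + e" .
  qed
qed

theorem H1_weak_lower_semicontinuity:
  fixes u w :: "nat \<Rightarrow> real \<Rightarrow> 'a::euclidean_space"
    and A :: "'a \<Rightarrow> 'a \<Rightarrow> 'b::euclidean_space"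
  assumes u: "\<And>n. H1 (u n) (w n)" and C: "\<And>n. sqint (w n) \<le> C"
    and R: "\<And>n x. x \<in> {0..2*pi} \<Longrightarrow> norm (u n x) \<le> R"
    and lin: "\<And>p. linear (A p)" and cont: "\<And>h. continuous_on UNIV (\<lambda>p. A p h)"
    and m: "(\<lambda>n. sqint (\<lambda>x. A (u n x) (w n x))) \<longlonglongrightarrow> m"
  obtains r U W where "strict_mono (r :: nat \<Rightarrow> nat)" "H1 U W"
    "uniform_limit {0..2*pi} (\<lambda>n. u (r n)) U sequentially"
    "sqint (\<lambda>x. A (U x) (W x)) \<le> m"
proof -
  obtain r U W where r: "strict_mono (r :: nat \<Rightarrow> nat)" and UW: "H1 U W"
    and ul: "uniform_limit {0..2*pi} (\<lambda>n. u (r n)) U sequentially"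
    and weak: "\<forall>P. convex_closed P \<longrightarrow> (\<forall>\<^sub>F n in sequentially. P (w (r n))) \<longrightarrow> P W"
    by (rule H1_compactness[OF u C R]) (assumption, rule that)
  have C0: "C \<ge> 0" using C[of 0] sqint_nonneg[of "w 0"] by linarith
  have m0: "m \<ge> 0" by (rule LIMSEQ_le_const[OF m]) (auto intro: sqint_nonneg)
  have UR: "norm (U x) \<le> R" if x: "x \<in> {0..2*pi}" for x
    by (rule LIMSEQ_le_const2[OF tendsto_norm[OF tendsto_uniform_limitI[OF ul x]]]) (use R x in auto)
  have Ac: "continuous_on {0..2*pi} (\<lambda>x. A (v x) h)" if "continuous_on {0..2*pi} v" for v h
    by (rule continuous_on_compose2[OF cont that]) auto
  note Uc = Ac[OF H1_continuous[OF UW]]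
  have L2A: "L2 (\<lambda>x. A (v x) (f x))" if "continuous_on {0..2*pi} v" "L2 f" for v f
    by (rule L2_linear_image[OF lin Ac[OF that(1)] that(2)])
  have L2U: "L2 (\<lambda>x. A (U x) (f x))" if "L2 f" for f
    by (rule L2A[OF H1_continuous[OF UW] that])
  have step: "sqint (\<lambda>x. A (U x) (W x)) \<le> (1 + t) * (m + t) + t" if t: "t > 0" for t
  proof -
    \<comment> \<open>Chosen so that the freezing error is at most \<open>t\<close>, see
      \<open>kk\<close>; \<open>C + 1\<close> keeps the denominator positive if
      \<open>C = 0\<close>.\<close>
    define k where "k = sqrt (t / ((1 + 1/t) * (C + 1)))"
    have pos: "(1 + 1/t) * (C + 1) > 0" using t C0 by (intro mult_pos_pos) (auto intro: add_pos_pos)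
    have k: "k > 0" unfolding k_def using t pos by simp
    have kk: "(1 + 1/t) * (k\<^sup>2 * C) \<le> t"
    proof -
      have "k\<^sup>2 = t / ((1 + 1/t) * (C + 1))" unfolding k_def using t pos by (intro real_sqrt_pow2) simp
      then have "k\<^sup>2 * ((1 + 1/t) * (C + 1)) = t"
        using pos by (metis nonzero_eq_divide_eq order_less_irrefl)
      then have "(1 + 1/t) * (k\<^sup>2 * (C + 1)) = t" by (simp only: mult_ac)
      moreover have "(1 + 1/t) * (k\<^sup>2 * C) \<le> (1 + 1/t) * (k\<^sup>2 * (C + 1))"
        using t by (intro mult_left_mono) auto
      ultimately show ?thesis by simp
    qed
    obtain d where d: "d > 0" and close: "\<And>p q h. norm p \<le> R \<Longrightarrow> norm q \<le> R \<Longrightarrow> norm (p - q) < d \<Longrightarrow>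
        norm (A p h - A q h) \<le> k * norm h"
      using linear_family_close[of A k R, OF lin cont k] by blast
    \<comment> \<open>The three \<open>t\<close> in the bound account for Young's inequality, the
      distance of the energies from \<open>m\<close>, and the freezing error.\<close>
    define P where "P f \<longleftrightarrow> L2 f \<and> sqint (\<lambda>x. A (U x) (f x)) \<le> (1 + t) * (m + t) + t" for f
    have "\<forall>\<^sub>F n in sequentially. P (w (r n))"
    proof -
      have "\<forall>\<^sub>F n in sequentially. sqint (\<lambda>x. A (u (r n) x) (w (r n) x)) < m + t"
        using LIMSEQ_subseq_LIMSEQ[OF m r, unfolded o_def] t by (intro order_tendstoD(2)) auto
      moreover have "\<forall>\<^sub>F n in sequentially. \<forall>x\<in>{0..2*pi}. norm (U x - u (r n) x) < d"
        using uniform_limitD[OF ul d] by (simp add: dist_norm norm_minus_commute)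
      ultimately show "\<forall>\<^sub>F n in sequentially. P (w (r n))"
      proof eventually_elim
        case (elim n)
        have Lw: "L2 (w (r n))" by (rule H1_L2[OF u])
        have Lu: "L2 (\<lambda>x. A (u (r n) x) (w (r n) x))" by (rule L2A[OF H1_continuous[OF u] Lw])
        have Ld: "L2 (\<lambda>x. A (U x) (w (r n) x) - A (u (r n) x) (w (r n) x))" by (rule L2_diff[OF L2U[OF Lw] Lu])
        have "sqint (\<lambda>x. A (U x) (w (r n) x)) \<le> (1 + t) * sqint (\<lambda>x. A (u (r n) x) (w (r n) x))
            + (1 + 1/t) * sqint (\<lambda>x. A (U x) (w (r n) x) - A (u (r n) x) (w (r n) x))"
          by (rule sqint_perturb[OF L2U[OF Lw] Lu Ld t]) (rule norm_triangle_sub)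
        also have "\<dots> \<le> (1 + t) * (m + t) + (1 + 1/t) * (k\<^sup>2 * C)"
        proof (intro add_mono mult_left_mono)
          have "sqint (\<lambda>x. A (U x) (w (r n) x) - A (u (r n) x) (w (r n) x)) \<le> k\<^sup>2 * sqint (w (r n))"
            by (rule sqint_le_scaled[OF Ld Lw]) (use elim(2) in \<open>auto intro!: AE_mu_I close UR R\<close>)
          also have "\<dots> \<le> k\<^sup>2 * C" by (intro mult_left_mono C) simp
          finally show "sqint (\<lambda>x. A (U x) (w (r n) x) - A (u (r n) x) (w (r n) x)) \<le> k\<^sup>2 * C" .
        qed (use elim(1) t in auto)
        finally show ?case using kk Lw by (simp add: P_def)
      qed
    qed
    moreover have "convex_closed P"
      unfolding convex_closed_def
    proof (intro conjI allI impI)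
      fix f g assume fg: "P f" "P g"
      then have L: "L2 f" "L2 g" by (auto simp: P_def)
      have m2: "A (U x) ((1/2) *\<^sub>R (f x + g x)) = (1/2) *\<^sub>R (A (U x) (f x) + A (U x) (g x))" for x
        using lin[of "U x"] by (simp add: linear_add linear_scale)
      have "4 * sqint (\<lambda>x. A (U x) ((1/2) *\<^sub>R (f x + g x)))
          \<le> 2 * sqint (\<lambda>x. A (U x) (f x)) + 2 * sqint (\<lambda>x. A (U x) (g x))"
        unfolding m2 using sqint_parallelogram[OF L2U[OF L(1)] L2U[OF L(2)]]
          sqint_nonneg[of "\<lambda>x. A (U x) (f x) - A (U x) (g x)"] by linarith
      then show "P (\<lambda>x. (1/2) *\<^sub>R (f x + g x))"
        using fg by (auto simp: P_def intro!: L2_scaleR L2_add)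
    next
      fix f g assume "\<forall>n. L2 (f n) \<and> P (f n)" "L2 g" "(\<lambda>n. sqint (\<lambda>x. f n x - g x)) \<longlonglongrightarrow> 0"
      then show "P g"
        using sqint_linear_closed[of "\<lambda>x. A (U x)" f _ g, OF lin Uc] by (simp add: P_def)
    qed
    ultimately have "P W" using weak by blast
    then show ?thesis by (simp add: P_def)
  qed
  have "sqint (\<lambda>x. A (U x) (W x)) \<le> m"
  proof (rule LIMSEQ_le_const)
    have "(\<lambda>n. (1 + inverse (real (Suc n))) * (m + inverse (real (Suc n))) + inverse (real (Suc n)))
        \<longlonglongrightarrow> (1 + 0) * (m + 0) + 0"
      by (intro tendsto_intros LIMSEQ_inverse_real_of_nat)
    then show "(\<lambda>n. (1 + inverse (real (Suc n))) * (m + inverse (real (Suc n))) + inverse (real (Suc n))) \<longlonglongrightarrow> m"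
      by simp
    show "\<exists>N. \<forall>n\<ge>N. sqint (\<lambda>x. A (U x) (W x))
        \<le> (1 + inverse (real (Suc n))) * (m + inverse (real (Suc n))) + inverse (real (Suc n))"
      by (intro exI allI impI step) simp
  qed
  then show ?thesis by (rule that[OF r UW ul])
qed

subsection \<open>Existence of minimizers\<close>

lemma uniform_limit_integral_tendsto:
  fixes f :: "nat \<Rightarrow> real \<Rightarrow> 'a::euclidean_space"
  assumes ul: "uniform_limit {0..2*pi} f g sequentially"
    and c: "\<And>n. continuous_on {0..2*pi} (f n)" and y: "y \<in> {0..2*pi}"
  shows "(\<lambda>n. integral {0..y} (f n)) \<longlonglongrightarrow> integral {0..y} g"
proof -
  have sub: "{0..y} \<subseteq> {0..2*pi}" using y by auto
  obtain I J where I: "\<And>n. (f n has_integral I n) {0..y}" and J: "(g has_integral J) {0..y}" and IJ: "I \<longlonglongrightarrow> J"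
    using uniform_limit_integral[OF uniform_limit_on_subset[OF ul sub] continuous_on_subset[OF c sub]]
    by auto
  from IJ show ?thesis unfolding integral_unique[OF I] integral_unique[OF J] .
qed

text \<open>The \<open>lam\<close> term controls \<open>\<eta>'\<close> and with it the divergence;
  what remains of the sum controls the curvature. As \<open>\<gamma>''\<close> is normal, its norm
  is \<open>c^2\<close> times the absolute curvature.\<close>

lemma reduced_coercive:
  assumes c: "c > 0" and lam: "lam > 0"
  obtains K where "\<And>u w A0. (u, w) \<in> reduced c A0 \<Longrightarrow> sqint w \<le> K\<^sup>2 * reduced_energy \<delta> lam c u w"
proof -
  \<comment> \<open>With \<open>T\<close> the norm of \<open>energy_map\<close>, \<open>K1\<close>
    comes from \<open>lam/(2*c) * |\<eta>'|^2 \<le> T^2\<close>. In \<open>K2\<close> the first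
    summand comes from \<open>c/2 * k^2 \<le> T^2\<close>, the second from the divergence, and
    \<open>c^2\<close> converts curvature into \<open>|\<gamma>''|\<close>.\<close>
  define K1 where "K1 = sqrt (2*c/lam)"
  define K2 where "K2 = c\<^sup>2 * (sqrt (2/c) + \<bar>\<delta>\<bar> * K1 / c)"
  have K1: "K1 > 0" using c lam by (simp add: K1_def)
  show ?thesis
  proof (rule that[of "K1 + K2"])
    fix u w A0 assume "(u, w) \<in> reduced c A0"
    then have u: "H1 u w" and nv: "\<And>x. x \<in> {0..2*pi} \<Longrightarrow> norm (fst (u x)) = c"
      by (auto simp: reduced_def)
    have v: "H1 (\<lambda>x. fst (u x)) (\<lambda>x. fst (w x))" by (rule H1_bounded_linear[OF u bounded_linear_fst])
    have orth: "AE x in mu. fst (w x) \<bullet> fst (u x) = 0" by (rule H1_constant_norm_orthogonal[OF v nv])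
    show "sqint w \<le> (K1 + K2)\<^sup>2 * reduced_energy \<delta> lam c u w"
      unfolding reduced_energy_def
    proof (rule sqint_le_scaled[OF H1_L2[OF u] L2_energy_map[OF H1_continuous[OF v] _ H1_L2[OF u]]])
      show "AE x in mu. norm (w x) \<le> (K1 + K2) * norm (energy_map \<delta> lam c (fst (u x)) (w x))"
        using orth AE_mu_space
      proof eventually_elim
        case (elim x)
        define T where "T = norm (energy_map \<delta> lam c (fst (u x)) (w x))"
        define k where "k = fst (w x) \<bullet> J (fst (u x)) / c^3 + \<delta> * (snd (w x) \<bullet> fst (u x)) / c\<^sup>2"
        have T0: "T \<ge> 0" by (simp add: T_def)
        have T: "T\<^sup>2 = c/2 * k\<^sup>2 + lam/(2*c) * (norm (snd (w x)))\<^sup>2"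
          unfolding T_def k_def using norm_energy_map[OF c] lam by simp
        have nvx: "norm (fst (u x)) = c" using nv elim by simp
        have b: "norm (snd (w x)) \<le> K1 * T"
        proof (rule power2_le_imp_le)
          have "lam/(2*c) * (norm (snd (w x)))\<^sup>2 \<le> T\<^sup>2" unfolding T using c by simp
          then have "(norm (snd (w x)))\<^sup>2 \<le> (2*c/lam) * T\<^sup>2" using c lam by (simp add: field_simps)
          then show "(norm (snd (w x)))\<^sup>2 \<le> (K1 * T)\<^sup>2"
            using c lam by (simp add: K1_def power_mult_distrib)
        qed (use K1 T0 in simp)
        have k: "\<bar>k\<bar> \<le> sqrt (2/c) * T"
        proof (rule power2_le_imp_le)
          have "c/2 * k\<^sup>2 \<le> T\<^sup>2" unfolding T using c lam by simp
          then have "k\<^sup>2 \<le> (2/c) * T\<^sup>2" using c by (simp add: field_simps)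
          then show "\<bar>k\<bar>\<^sup>2 \<le> (sqrt (2/c) * T)\<^sup>2" using c by (simp add: power_mult_distrib)
        qed (use c T0 in simp)
        define j where "j = fst (w x) \<bullet> J (fst (u x))"
        have "c\<^sup>2 * norm (fst (w x)) = norm ((norm (fst (u x)))\<^sup>2 *\<^sub>R fst (w x))"
          by (simp add: nvx)
        also have "\<dots> = \<bar>j\<bar> * c"
          unfolding j_def orthogonal_in_plane[OF elim(1)] by (simp add: norm_J nvx)
        finally have a: "norm (fst (w x)) = c\<^sup>2 * (\<bar>j\<bar> / c^3)"
          using c by (simp add: power2_eq_square power3_eq_cube field_simps)
        have "\<bar>j\<bar> / c^3 = \<bar>k - \<delta> * (snd (w x) \<bullet> fst (u x)) / c\<^sup>2\<bar>"
          using c by (simp add: k_def j_def)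
        also have "\<dots> \<le> \<bar>k\<bar> + \<bar>\<delta>\<bar> * \<bar>snd (w x) \<bullet> fst (u x)\<bar> / c\<^sup>2"
          using abs_triangle_ineq4[of k "\<delta> * (snd (w x) \<bullet> fst (u x)) / c\<^sup>2"] by (simp add: abs_mult)
        also have "\<dots> \<le> sqrt (2/c) * T + \<bar>\<delta>\<bar> * (K1 * T * c) / c\<^sup>2"
        proof -
          have "\<bar>snd (w x) \<bullet> fst (u x)\<bar> \<le> norm (snd (w x)) * c"
            using Cauchy_Schwarz_ineq2[of "snd (w x)" "fst (u x)"] by (simp add: nvx)
          also have "\<dots> \<le> K1 * T * c" using b c by (intro mult_right_mono) auto
          finally show ?thesis using k by (intro add_mono divide_right_mono mult_left_mono) auto
        qed
        also have "\<dots> = (sqrt (2/c) + \<bar>\<delta>\<bar> * K1 / c) * T"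
          using c by (simp add: power2_eq_square algebra_simps)
        finally have "\<bar>j\<bar> / c^3 \<le> (sqrt (2/c) + \<bar>\<delta>\<bar> * K1 / c) * T" .
        then have "c\<^sup>2 * (\<bar>j\<bar> / c^3) \<le> c\<^sup>2 * ((sqrt (2/c) + \<bar>\<delta>\<bar> * K1 / c) * T)"
          by (rule mult_left_mono) simp
        then have "norm (fst (w x)) \<le> K2 * T" by (simp only: a K2_def mult.assoc)
        moreover have "norm (w x) \<le> norm (fst (w x)) + norm (snd (w x))"
          by (metis norm_Pair_le prod.collapse)
        ultimately show ?case using b unfolding T_def[symmetric] by (simp add: distrib_right)
      qed
    qed (use c in auto)
  qed
qed

text \<open>The constraints involve \<open>u\<close> but not its derivative, so uniform convergence
  preserves them. The area is an iterated integral and passes to the limit by dominated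
  convergence.\<close>

lemma reduced_uniform_limit:
  assumes uw: "\<And>n. (u n, w n) \<in> reduced c A0" and UW: "H1 U W"
    and ul: "uniform_limit {0..2*pi} u U sequentially"
  shows "(U, W) \<in> reduced c A0"
proof -
  have u: "\<And>n. H1 (u n) (w n)" and nv: "\<And>n x. x \<in> {0..2*pi} \<Longrightarrow> norm (fst (u n x)) = c"
    and n\<eta>: "\<And>n x. x \<in> {0..2*pi} \<Longrightarrow> norm (snd (u n x)) = 1"
    and per: "\<And>n. u n 0 = u n (2*pi)" and closed: "\<And>n. integral {0..2*pi} (\<lambda>x. fst (u n x)) = 0"
    and area: "\<And>n. - (1/2) * integral {0..2*pi} (\<lambda>x. integral {0..x} (\<lambda>s. fst (u n s)) \<bullet> J (fst (u n x))) = A0"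
    using uw by (auto simp: reduced_def)
  have lim: "(\<lambda>n. u n x) \<longlonglongrightarrow> U x" if "x \<in> {0..2*pi}" for x
    by (rule tendsto_uniform_limitI[OF ul that])
  have vc: "continuous_on {0..2*pi} (\<lambda>x. fst (u n x))" for n
    by (intro continuous_intros H1_continuous[OF u])
  have ulv: "uniform_limit {0..2*pi} (\<lambda>n x. fst (u n x)) (\<lambda>x. fst (U x)) sequentially"
    by (rule bounded_linear.uniform_limit[OF bounded_linear_fst ul])
  have prim: "(\<lambda>n. integral {0..x} (\<lambda>s. fst (u n s))) \<longlonglongrightarrow> integral {0..x} (\<lambda>s. fst (U s))"
    if "x \<in> {0..2*pi}" for x
    by (rule uniform_limit_integral_tendsto[OF ulv vc that])
  have const: "a = b" if "(\<lambda>n. X n) \<longlonglongrightarrow> a" "\<And>n. X n = b" for X :: "nat \<Rightarrow> 'a::t2_space" and a b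
    using that LIMSEQ_unique[of "\<lambda>n. b" a b] by simp
  show ?thesis
    unfolding reduced_def
  proof (intro CollectI case_prodI conjI ballI UW)
    fix x :: real assume x: "x \<in> {0..2*pi}"
    show "norm (fst (U x)) = c" by (rule const[OF tendsto_norm[OF tendsto_fst[OF lim[OF x]]] nv[OF x]])
    show "norm (snd (U x)) = 1" by (rule const[OF tendsto_norm[OF tendsto_snd[OF lim[OF x]]] n\<eta>[OF x]])
  next
    have "(\<lambda>n. u n 0) \<longlonglongrightarrow> U 0" "(\<lambda>n. u n 0) \<longlonglongrightarrow> U (2*pi)"
      using lim[of 0] lim[of "2*pi"] per by auto
    then show "U 0 = U (2*pi)" by (rule LIMSEQ_unique)
    show "integral {0..2*pi} (\<lambda>x. fst (U x)) = 0"
      by (rule const[OF prim closed]) simp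
    have "(\<lambda>n. integral {0..2*pi} (\<lambda>x. integral {0..x} (\<lambda>s. fst (u n s)) \<bullet> J (fst (u n x))))
        \<longlonglongrightarrow> integral {0..2*pi} (\<lambda>x. integral {0..x} (\<lambda>s. fst (U s)) \<bullet> J (fst (U x)))"
    proof (rule dominated_convergence(2))
      show "(\<lambda>x. integral {0..x} (\<lambda>s. fst (u n s)) \<bullet> J (fst (u n x))) integrable_on {0..2*pi}" for n
        by (intro integrable_continuous_real continuous_intros indefinite_integral_continuous_1
            bounded_linear.continuous_on[OF bounded_linear_J] vc)
      \<comment> \<open>The curve stays within distance \<open>c * (2*pi)\<close> of its start at
        the origin, and its velocity has norm \<open>c\<close>.\<close>
      show "(\<lambda>x. c * (2*pi) * c) integrable_on {0..2*pi}"
        by (intro integrable_continuous_real continuous_intros)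
      fix n and x :: real assume x: "x \<in> {0..2*pi}"
      have c0: "c \<ge> 0" using nv[OF x, of n] norm_ge_zero by metis
      have "norm (integral {0..x} (\<lambda>s. fst (u n s))) \<le> c * (x - 0)"
        by (rule integral_bound) (use x nv in \<open>auto intro: continuous_on_subset[OF vc]\<close>)
      also have "\<dots> \<le> c * (2*pi)" using x c0 by (intro mult_left_mono) auto
      finally show "norm (integral {0..x} (\<lambda>s. fst (u n s)) \<bullet> J (fst (u n x))) \<le> c * (2*pi) * c"
        using Cauchy_Schwarz_ineq2[of "integral {0..x} (\<lambda>s. fst (u n s))" "J (fst (u n x))"]
          mult_right_mono[of _ "c * (2*pi)" c] c0 nv[OF x, of n]
        by (fastforce simp: norm_J)
    next
      fix x :: real assume x: "x \<in> {0..2*pi}"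
      show "(\<lambda>n. integral {0..x} (\<lambda>s. fst (u n s)) \<bullet> J (fst (u n x)))
          \<longlonglongrightarrow> integral {0..x} (\<lambda>s. fst (U s)) \<bullet> J (fst (U x))"
        by (intro tendsto_inner prim x bounded_linear.tendsto[OF bounded_linear_J] tendsto_fst lim)
    qed
    then have "(\<lambda>n. - (1/2) * integral {0..2*pi} (\<lambda>x. integral {0..x} (\<lambda>s. fst (u n s)) \<bullet> J (fst (u n x))))
        \<longlonglongrightarrow> - (1/2) * integral {0..2*pi} (\<lambda>x. integral {0..x} (\<lambda>s. fst (U s)) \<bullet> J (fst (U x)))"
      by (intro tendsto_mult tendsto_const)
    then show "- (1/2) * integral {0..2*pi} (\<lambda>x. integral {0..x} (\<lambda>s. fst (U s)) \<bullet> J (fst (U x))) = A0"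
      by (rule const[OF _ area])
  qed
qed

section \<open>Closed curves with prescribed length and area\<close>

definition plane :: "real \<Rightarrow> real \<Rightarrow> real^2" where
  "plane p q = p *\<^sub>R axis 1 1 + q *\<^sub>R axis 2 1"

lemma plane_nth: "plane p q $ 1 = p" "plane p q $ 2 = q"
  by (simp_all add: plane_def axis_def)

lemma norm_plane: "norm (plane p q) = sqrt (p\<^sup>2 + q\<^sup>2)"
  by (simp add: norm_eq_sqrt_inner inner_real2 plane_nth power2_eq_square)

lemma H1_plane:
  assumes "\<And>x. (f has_real_derivative f' x) (at x)" "\<And>x. (g has_real_derivative g' x) (at x)"
    and "continuous_on UNIV f'" "continuous_on UNIV g'"
  shows "H1 (\<lambda>x. plane (f x) (g x)) (\<lambda>x. plane (f' x) (g' x))"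
proof (rule H1_of_derivative)
  show "((\<lambda>x. plane (f x) (g x)) has_vector_derivative plane (f' x) (g' x)) (at x within {0..2*pi})" for x
    unfolding plane_def
    using has_vector_derivative_scaleR[OF has_field_derivative_at_within[OF assms(1)] has_vector_derivative_const]
      has_vector_derivative_scaleR[OF has_field_derivative_at_within[OF assms(2)] has_vector_derivative_const]
    by (intro has_vector_derivative_add) (simp_all del: has_vector_derivative_const)
  show "continuous_on {0..2*pi} (\<lambda>x. plane (f' x) (g' x))"
    unfolding plane_def by (intro continuous_intros continuous_on_subset[OF assms(3)] continuous_on_subset[OF assms(4)]) auto
qed

text \<open>Ellipses for \<open>d = 0\<close>, a figure eight for \<open>b = 0\<close>.\<close>

lemma admissible_lissajous:
  fixes b d s :: real
  assumes s: "s > 0" and bd: "b \<noteq> 0 \<and> d = 0 \<or> b = 0 \<and> d = 1"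
  defines "len \<equiv> integral {0..2*pi} (\<lambda>x. sqrt ((sin x)\<^sup>2 + (b * cos x + 2 * d * cos (2*x))\<^sup>2))"
  shows "\<exists>\<gamma> \<eta>. (\<gamma>, \<eta>) \<in> admissible (s * len) (s\<^sup>2 * pi * b)"
proof -
  define \<gamma> where "\<gamma> x = plane (s * cos x) (s * (b * sin x + d * sin (2*x)))" for x
  define v where "v x = plane (s * - sin x) (s * (b * cos x + 2 * d * cos (2*x)))" for x
  define a where "a x = plane (s * - cos x) (s * (- b * sin x - 4 * d * sin (2*x)))" for x
  have \<gamma>: "H1 \<gamma> v" unfolding \<gamma>_def v_def
    by (rule H1_plane) (auto intro!: derivative_eq_intros continuous_intros simp: algebra_simps)
  have v: "H1 v a" unfolding v_def a_def
    by (rule H1_plane) (auto intro!: derivative_eq_intros continuous_intros simp: algebra_simps)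
  have vc: "continuous_on {0..2*pi} v" by (rule H1_continuous[OF v])
  note dx = H1_dx_eq[OF \<gamma> vc]
  have nv: "norm (v x) = s * sqrt ((sin x)\<^sup>2 + (b * cos x + 2 * d * cos (2*x))\<^sup>2)" for x
  proof -
    have "norm (v x) = sqrt (s\<^sup>2 * ((sin x)\<^sup>2 + (b * cos x + 2 * d * cos (2*x))\<^sup>2))"
      by (simp add: v_def norm_plane power2_eq_square algebra_simps)
    then show ?thesis using s by (simp add: real_sqrt_mult)
  qed
  have nz: "v x \<noteq> 0" for x
  proof
    assume "v x = 0"
    then have "(sin x)\<^sup>2 + (b * cos x + 2 * d * cos (2*x))\<^sup>2 = 0" using nv[of x] s by simp
    then have 0: "sin x = 0" "b * cos x + 2 * d * cos (2*x) = 0" by (auto simp: sum_power2_eq_zero_iff)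
    \<comment> \<open>Where \<open>sin x\<close> vanishes, the second component of the velocity is
      \<open>s * b * cos x\<close> for the ellipse and \<open>2 * s\<close> for the figure
      eight.\<close>
    moreover have "cos (2*x) = 1" "cos x \<noteq> 0"
      using 0(1) sin_cos_squared_add[of x] by (auto simp: cos_double_sin)
    ultimately show False using bd by auto
  qed
  have imm: "\<gamma> \<in> H2_imm"
    by (rule H2_immI[OF \<gamma> v nz]) (auto simp: \<gamma>_def v_def)
  have \<eta>: "(\<lambda>x. axis 1 1 :: real^2) \<in> H_per 1"
    unfolding H_per_1_iff by (auto intro!: exI[of _ "\<lambda>x. 0"] H1I L2_const)
  have "curve_length \<gamma> = (LINT x|mu. norm (v x))"
    unfolding curve_length_def curve_integral_def
    by (rule Bochner_Integration.integral_cong) (auto simp: dx)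
  also have "\<dots> = integral {0..2*pi} (\<lambda>x. norm (v x))"
    by (intro LINT_mu continuous_integrable_mu continuous_intros vc)
  also have "\<dots> = s * len" by (simp add: nv len_def)
  finally have len: "curve_length \<gamma> = s * len" .
  have "(LINT x|mu. \<gamma> x \<bullet> J (dx \<gamma> x)) = (LINT x|mu. \<gamma> x \<bullet> J (v x))"
    by (rule Bochner_Integration.integral_cong) (auto simp: dx)
  also have "\<dots> = integral {0..2*pi} (\<lambda>x. \<gamma> x \<bullet> J (v x))"
    by (intro LINT_mu continuous_integrable_mu continuous_intros H1_continuous[OF \<gamma>] vc
          bounded_linear.continuous_on[OF bounded_linear_J])
  also have "\<dots> = - (s\<^sup>2) * (b * (2*pi))"
  proof -
    \<comment> \<open>Antiderivative of the area integrand; only its linear term in \<open>x\<close>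
      contributes over a full period.\<close>
    define G where "G x = - (s\<^sup>2) * (b * x + d * (2 * sin x - 2/3 * (sin x)^3))" for x
    have "((\<lambda>x. \<gamma> x \<bullet> J (v x)) has_integral G (2*pi) - G 0) {0..2*pi}"
    proof (rule fundamental_theorem_of_calculus)
      fix x :: real
      have "(G has_real_derivative - (s\<^sup>2) * (b + d * (2 * cos x - 2 * (sin x)\<^sup>2 * cos x))) (at x)"
        unfolding G_def by (auto intro!: derivative_eq_intros simp: power2_eq_square algebra_simps)
      also have "- (s\<^sup>2) * (b + d * (2 * cos x - 2 * (sin x)\<^sup>2 * cos x)) = \<gamma> x \<bullet> J (v x)"
      proof -
        have "b + d * (2 * cos x - 2 * (sin x)\<^sup>2 * cos x)
            = cos x * (b * cos x + 2 * d * cos (2*x)) + (b * sin x + d * sin (2*x)) * sin x"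
        proof -
          have "cos x * (b * cos x + 2 * d * cos (2*x)) + (b * sin x + d * sin (2*x)) * sin x
              = b * ((sin x)\<^sup>2 + (cos x)\<^sup>2) + d * (2 * cos x - 2 * (sin x)\<^sup>2 * cos x)"
            unfolding cos_double_sin sin_double by algebra
          then show ?thesis by simp
        qed
        then show ?thesis
          by (simp add: \<gamma>_def v_def inner_real2 J_nth plane_nth power2_eq_square algebra_simps)
      qed
      finally show "(G has_vector_derivative \<gamma> x \<bullet> J (v x)) (at x within {0..2*pi})"
        by (simp add: has_real_derivative_iff_has_vector_derivative has_vector_derivative_at_within)
    qed simp
    then show ?thesis by (simp add: integral_unique G_def)
  qed
  finally have "signed_area \<gamma> = s\<^sup>2 * pi * b" by (simp add: signed_area_def)
  with imm \<eta> len show ?thesis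
    by (intro exI[of _ \<gamma>] exI[of _ "\<lambda>x. axis 1 1"]) (simp add: admissible_def S_def)
qed

text \<open>The quotient of area and squared length is invariant under scaling, so it suffices to
  realize \<open>A0 / L0^2\<close> and rescale. For ellipses it runs continuously through the
  allowed range between the two orientations of the circle.\<close>

lemma admissible_nonempty:
  assumes L0: "L0 > 0" and A0: "A0 \<in> {- (L0\<^sup>2 / (4 * pi)) .. L0\<^sup>2 / (4 * pi)}"
  shows "\<exists>\<gamma> \<eta>. (\<gamma>, \<eta>) \<in> admissible L0 A0"
proof -
  define len where "len b d = integral {0..2*pi} (\<lambda>x. sqrt ((sin x)\<^sup>2 + (b * cos x + 2 * d * cos (2*x))\<^sup>2))"
    for b d :: real
  have pos: "len b d > 0" for b d
  proof -
    let ?f = "\<lambda>x. sqrt ((sin x)\<^sup>2 + (b * cos x + 2 * d * cos (2*x))\<^sup>2)"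
    have c: "continuous_on {0..2*pi} ?f" by (intro continuous_intros)
    have "len b d \<ge> 0"
      unfolding len_def by (rule Henstock_Kurzweil_Integration.integral_nonneg[OF integrable_continuous_real[OF c]]) auto
    moreover have "len b d \<noteq> 0"
    proof
      assume "len b d = 0"
      then have "\<forall>x\<in>{0..2*pi}. ?f x = 0"
        using integral_eq_0_iff[OF c] unfolding len_def by auto
      then have "?f (pi/2) = 0" by (rule bspec) auto
      then show False by (simp add: add_nonneg_eq_0_iff)
    qed
    ultimately show ?thesis by simp
  qed
  \<comment> \<open>Area over squared length for the ellipse with semi-axes 1 and
    \<open>\<bar>b\<bar>\<close>, signed by orientation.\<close>
  define h where "h b = pi * b / (len b 0)\<^sup>2" for b
  have "continuous_on {-1..1} (\<lambda>b. integral (cbox 0 (2*pi)) (\<lambda>x. sqrt ((sin x)\<^sup>2 + (b * cos x + 2 * 0 * cos (2*x))\<^sup>2)))"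
    by (rule integral_continuous_on_param) (auto intro!: continuous_intros simp: case_prod_unfold)
  then have "continuous_on {-1..1} (\<lambda>b. len b 0)" by (simp add: len_def)
  then have hc: "continuous_on {-1..1} h"
    unfolding h_def using pos by (intro continuous_intros) (auto simp: less_imp_neq[symmetric])
  have "len 1 0 = 2*pi" "len (-1) 0 = 2*pi" by (simp_all add: len_def)
  then have "h 1 = 1 / (4*pi)" "h (-1) = - (1 / (4*pi))"
    by (simp_all add: h_def power2_eq_square)
  moreover have "- (1 / (4*pi)) \<le> A0 / L0\<^sup>2" "A0 / L0\<^sup>2 \<le> 1 / (4*pi)"
    using A0 L0 by (auto simp: field_simps)
  ultimately obtain b where b: "h b = A0 / L0\<^sup>2"
    using IVT'[of h "-1" "A0 / L0\<^sup>2" 1] hc by auto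
  \<comment> \<open>For \<open>b = 0\<close> the ellipse is a segment traversed back and forth; then
    \<open>A0 = 0\<close> and the figure eight takes its place.\<close>
  define d where "d = (if b = 0 then 1 else 0 :: real)"
  define s where "s = L0 / len b d"
  have s: "s > 0" using L0 pos by (simp add: s_def)
  have "\<exists>\<gamma> \<eta>. (\<gamma>, \<eta>) \<in> admissible (s * len b d) (s\<^sup>2 * pi * b)"
    unfolding len_def by (rule admissible_lissajous[OF s]) (auto simp: d_def)
  moreover have "s * len b d = L0" using pos[of b d] by (simp add: s_def)
  moreover have "s\<^sup>2 * pi * b = A0"
  proof (cases "b = 0")
    case True
    then show ?thesis using b L0 by (simp add: h_def)
  next
    case False
    then have "s\<^sup>2 * pi * b = L0\<^sup>2 * h b" by (simp add: s_def d_def h_def power_divide)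
    then show ?thesis using b L0 by simp
  qed
  ultimately show ?thesis by simp
qed

theorem corollary3p4:
  fixes \<delta> lam L0 A0 :: real
  assumes "lam > 0" and "L0 > 0"
    and "A0 \<in> {- (L0\<^sup>2 / (4 * pi)) .. L0\<^sup>2 / (4 * pi)}"
  shows "\<exists>(\<gamma>, \<eta>) \<in> admissible L0 A0. \<forall>(\<gamma>', \<eta>') \<in> admissible L0 A0.
           energy \<delta> lam \<gamma> \<eta> \<le> energy \<delta> lam \<gamma>' \<eta>'"
proof -
  define c where "c = L0 / (2*pi)"
  have c: "c > 0" and L0c: "2*pi*c = L0" using assms by (auto simp: c_def)
  define E where "E p = reduced_energy \<delta> lam c (fst p) (snd p)" for p
  have E0: "E p \<ge> 0" for p unfolding E_def reduced_energy_def by (rule sqint_nonneg)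
  have reduce: "\<exists>p\<in>reduced c A0. E p = energy \<delta> lam \<gamma> \<eta>" if "(\<gamma>, \<eta>) \<in> admissible L0 A0" for \<gamma> \<eta>
    using admissible_imp_reduced[OF that assms(2,1), of \<delta>] unfolding E_def c_def
    by (metis fst_conv snd_conv)
  have ne: "reduced c A0 \<noteq> {}" using admissible_nonempty[OF assms(2,3)] reduce by blast
  define m where "m = Inf (E ` reduced c A0)"
  have bdd: "bdd_below (E ` reduced c A0)" by (rule bdd_belowI2[of _ 0]) (rule E0)
  have m_le: "m \<le> E p" if "p \<in> reduced c A0" for p unfolding m_def by (rule cINF_lower[OF bdd that])
  have "\<exists>p. p \<in> reduced c A0 \<and> E p < m + inverse (real (Suc n))" for n
    using cInf_lessD[of "E ` reduced c A0" "m + inverse (real (Suc n))"] ne by (auto simp: m_def)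
  then obtain p where p: "\<And>n. p n \<in> reduced c A0" and pE: "\<And>n. E (p n) < m + inverse (real (Suc n))"
    by metis
  define u w where "u n = fst (p n)" and "w n = snd (p n)" for n
  have uw: "(u n, w n) \<in> reduced c A0" for n using p by (simp add: u_def w_def)
  have lim: "(\<lambda>n. E (p n)) \<longlonglongrightarrow> m"
  proof (rule tendsto_sandwich[of "\<lambda>n. m" _ _ "\<lambda>n. m + inverse (real (Suc n))"])
    show "(\<lambda>n. m + inverse (real (Suc n))) \<longlonglongrightarrow> m"
      by (rule LIMSEQ_inverse_real_of_nat_add)
  qed (use m_le[OF p] less_imp_le[OF pE] in auto)
  obtain K where K: "\<And>u w A0. (u, w) \<in> reduced c A0 \<Longrightarrow> sqint w \<le> K\<^sup>2 * reduced_energy \<delta> lam c u w"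
    using reduced_coercive[OF c assms(1), of \<delta>] by blast
  obtain r U W where r: "strict_mono (r :: nat \<Rightarrow> nat)" and UW: "H1 U W"
    and ul: "uniform_limit {0..2*pi} (\<lambda>n. u (r n)) U sequentially"
    and le: "sqint (\<lambda>x. energy_map \<delta> lam c (fst (U x)) (W x)) \<le> m"
  \<comment> \<open>\<open>R\<close> adds the norms \<open>c\<close> and 1 of the two components.
    \<open>C\<close> is the coercivity bound for energies at most \<open>m + 1\<close>.\<close>
  proof (rule H1_weak_lower_semicontinuity[where u=u and w=w and C="K\<^sup>2 * (m + 1)" and R="c + 1" and m=m
        and A="\<lambda>p. energy_map \<delta> lam c (fst p)"])
    fix n
    show "H1 (u n) (w n)" using uw[of n] by (simp add: reduced_def)
    have "E (p n) \<le> m + 1" using pE[of n] le_imp_inverse_le[of 1 "real (Suc n)"] by simp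
    then have "K\<^sup>2 * reduced_energy \<delta> lam c (u n) (w n) \<le> K\<^sup>2 * (m + 1)"
      unfolding u_def w_def E_def[symmetric] by (intro mult_left_mono) auto
    then show "sqint (w n) \<le> K\<^sup>2 * (m + 1)" using K[OF uw[of n]] by simp
    fix x :: real assume "x \<in> {0..2*pi}"
    then have "norm (fst (u n x)) = c" "norm (snd (u n x)) = 1" using uw[of n] by (auto simp: reduced_def)
    then show "norm (u n x) \<le> c + 1" using norm_Pair_le[of "fst (u n x)" "snd (u n x)"] by simp
  next
    show "linear (energy_map \<delta> lam c (fst p))" for p :: "(real^2) \<times> (real^2)" by (rule linear_energy_map)
    show "continuous_on UNIV (\<lambda>p::(real^2) \<times> (real^2). energy_map \<delta> lam c (fst p) h)" for h
      by (rule energy_map_continuous) (use c in \<open>auto intro: continuous_intros\<close>)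
    show "(\<lambda>n. sqint (\<lambda>x. energy_map \<delta> lam c (fst (u n x)) (w n x))) \<longlonglongrightarrow> m"
      using lim unfolding E_def reduced_energy_def u_def w_def .
  qed (rule that)
  have red: "(U, W) \<in> reduced c A0" by (rule reduced_uniform_limit[OF uw UW ul])
  define \<gamma> where "\<gamma> = (\<lambda>x. integral {0..x} (\<lambda>s. fst (U s)))"
  define \<eta> where "\<eta> = (\<lambda>x. snd (U x))"
  have adm: "(\<gamma>, \<eta>) \<in> admissible L0 A0"
    and en: "energy \<delta> lam \<gamma> \<eta> = reduced_energy \<delta> lam c U W"
    using reduced_imp_admissible(1)[OF red c assms(1)] reduced_imp_admissible(2)[OF red c assms(1)]
    unfolding L0c \<gamma>_def \<eta>_def by blast+
  have "energy \<delta> lam \<gamma> \<eta> \<le> energy \<delta> lam \<gamma>' \<eta>'" 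
    if competitor: "(\<gamma>', \<eta>') \<in> admissible L0 A0" for \<gamma>' \<eta>'
  proof -
    \<comment> \<open>A competitor of variable speed is compared through its reduced pair, whose
      energy is at least the infimum \<open>m\<close>.\<close>
    obtain p where "p \<in> reduced c A0" "E p = energy \<delta> lam \<gamma>' \<eta>'" using reduce[OF competitor] by blast
    then show ?thesis using le m_le[of p] unfolding en reduced_energy_def by simp
  qed
  with adm show ?thesis by blast
qed

end
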